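(* If $G$ is an elementary group, then the residual rank of $G$ is well-defined and it equals the decomposition rank of $G$: $\xi(G)=\mathrm{r}(G)$.
   Context: All groups are totally disconnected, locally compact, second countable (t.d.l.c.s.c.) topological groups. A topological group is compactly generated if it is generated by a compact subset. The class $\mathcal{E}$ of elementary groups is the smallest class of t.d.l.c.s.c. groups such that: (i) $\mathcal{E}$ contains all second countable profinite groups and all countable discrete groups; (ii) $\mathcal{E}$ is closed under group extensions; (iii) $\mathcal{E}$ is closed under closed subgroups; (iv) $\mathcal{E}$ is closed under quotients by closed normal subgroups; (v) if a t.d.l.c.s.c. group $G$ is the union of an increasing sequence of open subgroups $O_i\in\mathcal{E}$, $i\in\mathbb{N}$, then $G\in\mathcal{E}$. The discrete residual $\mathrm{Res}(G)$ is the intersection of all open normal subgroups of $G$. The decomposition rank $\xi:\mathcal{E}\to[1,\omega_1)$ is the (well-defined) function with: $\xi(\{1\})=1$; $\xi(G)=\xi(\mathrm{Res}(G))+1$ if $G$ is non-trivial and compactly generated; and, for $G$ non-trivial and any increasing sequence $(O_i)_{i\in\mathbb{N}}$ of compactly generated open subgroups with union $G$, $\xi(G)=\sup_{i}\xi(\mathrm{Res}(O_i))+1$. Residual order, height, rank. $\mathcal{K}(G)$ is the set of closed compactly generated subgroups of $G$. For $K\leq G$, $\mathrm{Res}_G(K)$ is the intersection of all open subgroups $O\leq G$ with $kOk^{-1}=O$ for all $k\in K$. For $K_1,K_2\in\mathcal{K}(G)$ write $K_1\preccurlyeq K_2$ if $K_1\leq\mathrm{Res}_G(K_2)$ or $K_1=K_2$,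 and $K_1\prec K_2$ if $K_1\preccurlyeq K_2$ and $K_1\neq K_2$. Define recursively for countable ordinals: $\mathcal{K}_0(G)=\{\{1\}\}$; $\mathcal{K}_1(G)=\{K\in\mathcal{K}(G):\mathrm{Res}_G(K)=\{1\}\}$; for $1\leq\gamma<\omega_1$, $\mathcal{K}_{\gamma+1}(G)$ is the set of $K\in\mathcal{K}(G)$ such that every $L\prec K$ lies in $\mathcal{K}_\beta(G)$ for some $\beta\leq\gamma$; for limit $\lambda$, $\mathcal{K}_\lambda(G)=\bigcup_{\beta<\lambda}\mathcal{K}_\beta(G)$. Put $\mathcal{K}_{\omega_1}(G)=\bigcup_{\alpha<\omega_1}\mathcal{K}_\alpha(G)$. For $K\in\mathcal{K}_{\omega_1}(G)$ the residual height is $\mathrm{h}_G(K)=\min\{\alpha<\omega_1: K\in\mathcal{K}_\alpha(G)\}$. The residual rank of $G$ is well-defined if $\mathcal{K}(G)=\mathcal{K}_{\omega_1}(G)$, and then $\mathrm{r}(G)=\sup^+_{K\in\mathcal{K}(G)}(\mathrm{h}_G(K)+1)$, where $\sup^+$ of a family of ordinals is its supremum if that is a successor ordinal and its supremum plus one otherwise. *)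

theory Defs
  imports "HOL-Analysis.Analysis" "HOL-Algebra.Algebra"
begin

section \<open>Ordinals\<close>

text \<open>
  Decomposition ranks are countable ordinals, but the supremum in the definition of the residual
  rank ranges over a possibly uncountable family and may a priori be \<open>\<omega>\<^sub>1 + 1\<close>.
  We therefore work with the ordinals below \<open>\<omega>\<^sub>2\<close>.
\<close>

typedef ordinal = "Field (cardSuc (cardSuc natLeq))"
proof -
  have "Card_order (cardSuc natLeq)"
    by (simp add: cardSuc_Card_order natLeq_Card_order)
  then show ?thesis
    using Field_cardSuc_not_empty by blast
qed

lemma Well_order_omega2: "Well_order (cardSuc (cardSuc natLeq))"
  by (simp add: cardSuc_Card_order cardSuc_Well_order natLeq_Card_order)

instantiation ordinal :: wellorder
begin

definition less_eq_ordinal :: "ordinal \<Rightarrow> ordinal \<Rightarrow> bool" where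
  "\<alpha> \<le> \<beta> \<longleftrightarrow> (Rep_ordinal \<alpha>, Rep_ordinal \<beta>) \<in> cardSuc (cardSuc natLeq)"

definition less_ordinal :: "ordinal \<Rightarrow> ordinal \<Rightarrow> bool" where
  "less_ordinal \<alpha> \<beta> \<longleftrightarrow> \<alpha> \<le> \<beta> \<and> \<alpha> \<noteq> \<beta>"

instance
proof -
  let ?r = "cardSuc (cardSuc natLeq)"
  have wo: "Well_order ?r" by (rule Well_order_omega2)
  have refl: "refl_on (Field ?r) ?r" and tr: "trans ?r" and anti: "antisym ?r"
    and tot: "total_on (Field ?r) ?r" and wf: "wf (?r - Id)"
    using wo unfolding well_order_on_def linear_order_on_def partial_order_on_def preorder_on_def
    by auto
  show "OFCLASS(ordinal, wellorder_class)"
  proof (intro_classes, goal_cases)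
    case (1 x y)
    then show ?case
      using anti
      by (auto simp: less_ordinal_def less_eq_ordinal_def antisym_def simp flip: Rep_ordinal_inject)
  next
    case (2 x)
    then show ?case
      using refl Rep_ordinal by (auto simp: less_eq_ordinal_def refl_on_def)
  next
    case (3 x y z)
    then show ?case
      using tr by (auto simp: less_eq_ordinal_def trans_def)
  next
    case (4 x y)
    then show ?case
      using anti by (auto simp: less_eq_ordinal_def antisym_def simp flip: Rep_ordinal_inject)
  next
    case (5 x y)
    then show ?case
      using tot refl Rep_ordinal[of x] Rep_ordinal[of y]
      by (cases "Rep_ordinal x = Rep_ordinal y")
         (auto simp: less_eq_ordinal_def total_on_def refl_on_def)
  next
    case (6 P a)
    have "wf (inv_image (?r - Id) Rep_ordinal)"
      using wf by (rule wf_inv_image)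
    moreover have "inv_image (?r - Id) Rep_ordinal = {(x, y). x < y}"
      by (auto simp: inv_image_def less_ordinal_def less_eq_ordinal_def Rep_ordinal_inject)
    ultimately have "wf {(x :: ordinal, y). x < y}" by simp
    then show ?case
      using 6 by (induction a rule: wf_induct_rule) auto
  qed
qed

end

definition ord_succ :: "ordinal \<Rightarrow> ordinal" where
  "ord_succ \<alpha> = (LEAST \<beta>. \<alpha> < \<beta>)"

definition is_succ :: "ordinal \<Rightarrow> bool" where
  "is_succ \<alpha> \<longleftrightarrow> (\<exists>\<beta>. \<alpha> = ord_succ \<beta>)"

instantiation ordinal :: "{zero, one}"
begin
definition zero_ordinal :: ordinal where "0 = (LEAST \<alpha> :: ordinal. True)"
definition one_ordinal :: ordinal where "1 = ord_succ 0"
instance ..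
end

definition ord_sup :: "ordinal set \<Rightarrow> ordinal" where
  "ord_sup A = (LEAST \<beta>. \<forall>\<alpha>\<in>A. \<alpha> \<le> \<beta>)"

definition ord_sup_plus :: "ordinal set \<Rightarrow> ordinal" where
  "ord_sup_plus A = (if is_succ (ord_sup A) then ord_sup A else ord_succ (ord_sup A))"

definition omega_1 :: ordinal where
  "omega_1 = (LEAST \<alpha>. uncountable {..<\<alpha>})"

text \<open>The minima in the definitions of \<open>ord_succ\<close> and \<open>omega_1\<close> exist.\<close>

lemma less_ord_succ: "\<alpha> < ord_succ \<alpha>"
proof -
  let ?r = "cardSuc (cardSuc natLeq)"
  have inf: "infinite (Field ?r)"
    using Cinfinite_cardSuc[OF Cinfinite_cardSuc[OF natLeq_Cinfinite]] by (simp add: cinfinite_def)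
  have "Card_order ?r"
    by (simp add: cardSuc_Card_order natLeq_Card_order)
  then obtain b where b: "b \<in> Field ?r" "Rep_ordinal \<alpha> \<noteq> b" "(Rep_ordinal \<alpha>, b) \<in> ?r"
    using infinite_Card_order_limit[OF _ inf Rep_ordinal[of \<alpha>]] by auto
  have "\<alpha> < Abs_ordinal b"
    using b by (auto simp: less_ordinal_def less_eq_ordinal_def Abs_ordinal_inverse)
  then show ?thesis
    unfolding ord_succ_def by (rule LeastI)
qed

lemma countable_iff_ordLeq_natLeq: "countable A \<longleftrightarrow> |A| \<le>o natLeq"
proof -
  have "countable A \<longleftrightarrow> |A| \<le>o |UNIV :: nat set|"
    unfolding countable_def card_of_ordLeq[symmetric] by simp
  also have "\<dots> \<longleftrightarrow> |A| \<le>o natLeq"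
    using ordLeq_ordIso_trans[OF _ card_of_nat] ordLeq_ordIso_trans[OF _ ordIso_symmetric[OF card_of_nat]]
    by blast
  finally show ?thesis .
qed

lemma uncountable_omega_1: "uncountable {..<omega_1}"
proof -
  let ?k = "cardSuc natLeq" and ?r = "cardSuc (cardSuc natLeq)"
  have co: "Card_order ?k" by (simp add: cardSuc_Card_order natLeq_Card_order)
  have "?k <o ?r" by (rule cardSuc_greater[OF co])
  moreover have "Well_order ?k" by (simp add: cardSuc_Well_order natLeq_Card_order)
  ultimately obtain a where a: "a \<in> Field ?r" "?k =o Restr ?r (underS ?r a)"
    using ordLess_iff_ordIso_Restr[OF Well_order_omega2] by blast
  have "underS ?r a \<subseteq> Field ?r" by (auto simp: underS_def Field_def)
  have Field: "Field (Restr ?r (underS ?r a)) = underS ?r a"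
    using Well_order_omega2 \<open>underS ?r a \<subseteq> Field ?r\<close>
    by (simp add: Refl_Field_Restr2 order_on_defs)
  have "|Field ?k| =o |underS ?r a|"
    using card_of_cong[OF a(2)] Field by simp
  moreover have "uncountable (Field ?k)"
  proof
    assume "countable (Field ?k)"
    then have "|Field ?k| \<le>o natLeq"
      by (simp only: countable_iff_ordLeq_natLeq)
    then have "?k \<le>o natLeq"
      by (rule ordIso_ordLeq_trans[OF ordIso_symmetric[OF card_of_Field_ordIso[OF co]]])
    moreover have "natLeq <o ?k" by (rule cardSuc_greater[OF natLeq_Card_order])
    ultimately show False by (metis not_ordLess_ordLeq)
  qed
  ultimately have unc: "uncountable (underS ?r a)"
    unfolding countable_iff_ordLeq_natLeq by (metis ordIso_ordLeq_trans)
  have "underS ?r a \<subseteq> Rep_ordinal ` {..<Abs_ordinal a}"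
  proof
    fix x assume x: "x \<in> underS ?r a"
    then have xF: "x \<in> Field ?r" using \<open>underS ?r a \<subseteq> Field ?r\<close> by blast
    have "Abs_ordinal x < Abs_ordinal a"
      using x xF a(1)
      by (auto simp: less_ordinal_def less_eq_ordinal_def Abs_ordinal_inverse Abs_ordinal_inject
          underS_def)
    then show "x \<in> Rep_ordinal ` {..<Abs_ordinal a}"
      using xF by (intro image_eqI[of _ _ "Abs_ordinal x"]) (auto simp: Abs_ordinal_inverse)
  qed
  with unc have "uncountable {..<Abs_ordinal a}"
    by (metis countable_subset countable_image)
  then show ?thesis
    unfolding omega_1_def by (rule LeastI)
qed

section \<open>Totally disconnected locally compact second countable groups\<close>

text \<open>
  A topological group is given by a group \<open>G\<close> and a topology \<open>T\<close> on its carrier.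
\<close>

definition topological_group :: "'a monoid \<Rightarrow> 'a topology \<Rightarrow> bool" where
  "topological_group G T \<longleftrightarrow>
     group G \<and> topspace T = carrier G \<and>
     continuous_map (prod_topology T T) T (\<lambda>(x, y). x \<otimes>\<^bsub>G\<^esub> y) \<and>
     continuous_map T T (\<lambda>x. inv\<^bsub>G\<^esub> x)"

definition totally_disconnected_space :: "'a topology \<Rightarrow> bool" where
  "totally_disconnected_space T \<longleftrightarrow> (\<forall>S. connectedin T S \<longrightarrow> (\<exists>a. S \<subseteq> {a}))"

definition tdlcsc_group :: "'a monoid \<Rightarrow> 'a topology \<Rightarrow> bool" where
  "tdlcsc_group G T \<longleftrightarrow>
     topological_group G T \<and> Hausdorff_space T \<and> totally_disconnected_space T \<and>
     locally_compact_space T \<and> second_countable T"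

abbreviation subgrp :: "'a monoid \<Rightarrow> 'a set \<Rightarrow> 'a monoid" where
  "subgrp G H \<equiv> G\<lparr>carrier := H\<rparr>"

definition quotient_topology :: "'a monoid \<Rightarrow> 'a topology \<Rightarrow> 'a set \<Rightarrow> 'a set topology" where
  "quotient_topology G T N =
     topology (\<lambda>\<U>. \<U> \<subseteq> carrier (G Mod N) \<and> openin T (\<Union>\<U>))"

lemma openin_quotient_topology:
  assumes "group G" "N \<lhd> G"
  shows "openin (quotient_topology G T N) \<U> \<longleftrightarrow>
           \<U> \<subseteq> carrier (G Mod N) \<and> openin T (\<Union>\<U>)"
proof -
  interpret normal N G by (rule assms(2))
  have eq: "\<Union>(\<U> \<inter> \<V>) = \<Union>\<U> \<inter> \<Union>\<V>"
    if "\<U> \<subseteq> carrier (G Mod N)" "\<V> \<subseteq> carrier (G Mod N)" for \<U> \<V>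
  proof
    show "\<Union>\<U> \<inter> \<Union>\<V> \<subseteq> \<Union>(\<U> \<inter> \<V>)"
    proof
      fix x assume "x \<in> \<Union>\<U> \<inter> \<Union>\<V>"
      then obtain A B where "A \<in> \<U>" "x \<in> A" "B \<in> \<V>" "x \<in> B" by auto
      moreover have "A = B"
        using rcos_disjoint[OF subgroup_axioms] that calculation
        by (auto simp: FactGroup_def pairwise_def disjnt_def)
      ultimately show "x \<in> \<Union>(\<U> \<inter> \<V>)" by auto
    qed
  qed auto
  have "istopology (\<lambda>\<U>. \<U> \<subseteq> carrier (G Mod N) \<and> openin T (\<Union>\<U>))"
    unfolding istopology_def
  proof (intro conjI allI impI, goal_cases)
    case (2 S T')
    then show ?case by (subst eq) auto
  next
    case (4 K)
    have "\<Union>(\<Union>K) = \<Union>(Union ` K)" by auto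
    moreover have "openin T (\<Union>(Union ` K))"
      using 4 by (intro openin_Union) auto
    ultimately show ?case by simp
  qed auto
  then show ?thesis
    by (simp add: quotient_topology_def topology_inverse')
qed

definition top_group_isomorphic ::
  "'a monoid \<Rightarrow> 'a topology \<Rightarrow> 'b monoid \<Rightarrow> 'b topology \<Rightarrow> bool" where
  "top_group_isomorphic G T H S \<longleftrightarrow> (\<exists>f. f \<in> iso G H \<and> homeomorphic_map T S f)"

definition compactly_generated :: "'a monoid \<Rightarrow> 'a topology \<Rightarrow> bool" where
  "compactly_generated G T \<longleftrightarrow> (\<exists>C. compactin T C \<and> generate G C = carrier G)"

section \<open>Elementary groups\<close>

text \<open>
  The class of elementary groups contains groups on different carriers (quotients, extensions).
  A second countable Hausdorff space with countable base \<open>B\<^sub>0, B\<^sub>1, \<dots>\<close> embeds as a set in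
  \<open>nat set\<close> via \<open>x \<mapsto> {n. x \<in> B\<^sub>n}\<close>, so every t.d.l.c.s.c. group has an isomorphic copy whose
  elements are of type \<open>nat set\<close>. The class is generated on these copies, quotient groups
  being replaced by isomorphic copies; the rule \<open>quotient\<close> with trivial \<open>N\<close> makes it closed under
  isomorphism. Profinite groups are the compact t.d.l.c. groups.
\<close>

inductive elementary_copy :: "nat set monoid \<Rightarrow> nat set topology \<Rightarrow> bool" where
  profinite:
    "\<lbrakk>tdlcsc_group G T; compact_space T\<rbrakk> \<Longrightarrow> elementary_copy G T"
| discrete:
    "\<lbrakk>tdlcsc_group G T; countable (carrier G); T = discrete_topology (carrier G)\<rbrakk>
      \<Longrightarrow> elementary_copy G T"
| extension:
    "\<lbrakk>tdlcsc_group G T; N \<lhd> G; closedin T N;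
      elementary_copy (subgrp G N) (subtopology T N);
      elementary_copy Q S; top_group_isomorphic (G Mod N) (quotient_topology G T N) Q S\<rbrakk>
      \<Longrightarrow> elementary_copy G T"
| closed_subgroup:
    "\<lbrakk>elementary_copy G T; subgroup H G; closedin T H\<rbrakk>
      \<Longrightarrow> elementary_copy (subgrp G H) (subtopology T H)"
| quotient:
    "\<lbrakk>elementary_copy G T; N \<lhd> G; closedin T N;
      tdlcsc_group Q S; top_group_isomorphic (G Mod N) (quotient_topology G T N) Q S\<rbrakk>
      \<Longrightarrow> elementary_copy Q S"
| increasing_union:
    "\<lbrakk>tdlcsc_group G T; incseq U; (\<Union>i. U i) = carrier G;
      \<And>i::nat. subgroup (U i) G; \<And>i. openin T (U i);
      \<And>i. elementary_copy (subgrp G (U i)) (subtopology T (U i))\<rbrakk>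
      \<Longrightarrow> elementary_copy G T"

definition elementary :: "'a monoid \<Rightarrow> 'a topology \<Rightarrow> bool" where
  "elementary G T \<longleftrightarrow>
     tdlcsc_group G T \<and> (\<exists>H S. elementary_copy H S \<and> top_group_isomorphic G T H S)"

section \<open>Decomposition rank\<close>

definition discrete_residual :: "'a monoid \<Rightarrow> 'a topology \<Rightarrow> 'a set" where
  "discrete_residual G T = \<Inter>{N. N \<lhd> G \<and> openin T N}"

text \<open>
  The defining equations relate the rank of \<open>G\<close> only to ranks of closed subgroups of \<open>G\<close>, so they
  determine the rank separately on the groups with elements of a fixed type.
\<close>

definition is_decomposition_rank :: "('a monoid \<Rightarrow> 'a topology \<Rightarrow> ordinal) \<Rightarrow> bool" where
  "is_decomposition_rank \<xi> \<longleftrightarrow>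
     (\<forall>G T. elementary G T \<longrightarrow>
        1 \<le> \<xi> G T \<and> \<xi> G T < omega_1 \<and>
        (carrier G = {\<one>\<^bsub>G\<^esub>} \<longrightarrow> \<xi> G T = 1) \<and>
        (carrier G \<noteq> {\<one>\<^bsub>G\<^esub>} \<and> compactly_generated G T \<longrightarrow>
           \<xi> G T = ord_succ (\<xi> (subgrp G (discrete_residual G T))
                               (subtopology T (discrete_residual G T)))) \<and>
        (\<forall>U :: nat \<Rightarrow> 'a set.
           carrier G \<noteq> {\<one>\<^bsub>G\<^esub>} \<and> incseq U \<and> (\<Union>i. U i) = carrier G \<and>
           (\<forall>i. subgroup (U i) G \<and> openin T (U i) \<and>
                compactly_generated (subgrp G (U i)) (subtopology T (U i))) \<longrightarrow>
           \<xi> G T = ord_succ (ord_sup (range (\<lambda>i.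
             let R = discrete_residual (subgrp G (U i)) (subtopology T (U i))
             in \<xi> (subgrp G R) (subtopology T R))))))"

text \<open>
  The equations determine the rank on elementary groups only; \<open>SOME\<close> rather than
  \<open>THE\<close> leaves the values at other arguments arbitrary.
\<close>

definition decomposition_rank :: "'a monoid \<Rightarrow> 'a topology \<Rightarrow> ordinal" where
  "decomposition_rank = (SOME \<xi>. is_decomposition_rank \<xi>)"

section \<open>Residual rank\<close>

definition cg_closed_subgroups :: "'a monoid \<Rightarrow> 'a topology \<Rightarrow> 'a set set" where
  "cg_closed_subgroups G T =
     {K. subgroup K G \<and> closedin T K \<and> compactly_generated (subgrp G K) (subtopology T K)}"

definition relative_residual :: "'a monoid \<Rightarrow> 'a topology \<Rightarrow> 'a set \<Rightarrow> 'a set" where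
  "relative_residual G T K =
     \<Inter>{U. subgroup U G \<and> openin T U \<and> (\<forall>k\<in>K. (\<lambda>x. k \<otimes>\<^bsub>G\<^esub> x \<otimes>\<^bsub>G\<^esub> inv\<^bsub>G\<^esub> k) ` U = U)}"

definition residual_le :: "'a monoid \<Rightarrow> 'a topology \<Rightarrow> 'a set \<Rightarrow> 'a set \<Rightarrow> bool" where
  "residual_le G T K\<^sub>1 K\<^sub>2 \<longleftrightarrow> K\<^sub>1 \<subseteq> relative_residual G T K\<^sub>2 \<or> K\<^sub>1 = K\<^sub>2"

definition residual_less :: "'a monoid \<Rightarrow> 'a topology \<Rightarrow> 'a set \<Rightarrow> 'a set \<Rightarrow> bool" where
  "residual_less G T K\<^sub>1 K\<^sub>2 \<longleftrightarrow> residual_le G T K\<^sub>1 K\<^sub>2 \<and> K\<^sub>1 \<noteq> K\<^sub>2"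

text \<open>
  For \<open>\<alpha> = \<gamma> + 1\<close> the condition \<open>\<beta> \<le> \<gamma>\<close> is written \<open>\<beta> < \<alpha>\<close>. Only the levels with
  \<open>\<alpha> < \<omega>\<^sub>1\<close> are used below.
\<close>

function residual_level :: "'a monoid \<Rightarrow> 'a topology \<Rightarrow> ordinal \<Rightarrow> 'a set set" where
  "residual_level G T \<alpha> =
     (if \<alpha> = 0 then {{\<one>\<^bsub>G\<^esub>}}
      else if \<alpha> = 1 then {K \<in> cg_closed_subgroups G T. relative_residual G T K = {\<one>\<^bsub>G\<^esub>}}
      else if is_succ \<alpha> then
        {K \<in> cg_closed_subgroups G T.
           \<forall>L\<in>cg_closed_subgroups G T. residual_less G T L K \<longrightarrow>
             (\<exists>\<beta>\<in>{..<\<alpha>}. L \<in> residual_level G T \<beta>)}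
      else (\<Union>\<beta>\<in>{..<\<alpha>}. residual_level G T \<beta>))"
  by pat_completeness auto
termination
  by (relation "inv_image {(\<alpha>, \<beta>). \<alpha> < \<beta>} (\<lambda>(_, _, \<alpha>). \<alpha>)") (auto intro: wf_inv_image wf)

declare residual_level.simps [simp del]

definition residual_height :: "'a monoid \<Rightarrow> 'a topology \<Rightarrow> 'a set \<Rightarrow> ordinal" where
  "residual_height G T K = (LEAST \<alpha>. \<alpha> < omega_1 \<and> K \<in> residual_level G T \<alpha>)"

definition residual_rank_well_defined :: "'a monoid \<Rightarrow> 'a topology \<Rightarrow> bool" where
  "residual_rank_well_defined G T \<longleftrightarrow>
     cg_closed_subgroups G T = (\<Union>\<alpha>\<in>{..<omega_1}. residual_level G T \<alpha>)"

definition residual_rank :: "'a monoid \<Rightarrow> 'a topology \<Rightarrow> ordinal" where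
  "residual_rank G T =
     ord_sup_plus ((\<lambda>K. ord_succ (residual_height G T K)) ` cg_closed_subgroups G T)"

end

theory Submission
  imports Defs
begin

text \<open>
  Call a group decomposable if passing from a group to the discrete residual of a compactly
  generated open subgroup is a well-founded process. Elementary groups are decomposable, and only
  closure under quotients \<open>G \<rightarrow> Q\<close> needs an idea. One follows the closure \<open>R'\<close> in \<open>Q\<close> of the
  image of a closed subgroup \<open>R\<close> of \<open>G\<close>. A compactly generated open subgroup of \<open>R'\<close> need not
  be the closure of the image of a compactly generated subgroup of \<open>R\<close>, but it becomes an image
  once a compact group \<open>V\<close> normalizing \<open>R\<close> is adjoined. Adjoining \<open>V\<close> does not change the
  discrete residual, and by an argument of Caprace and Monod the residual of the image lies in the
  closure of the image of the residual.

  Let \<open>R = Res(O)\<close> with \<open>O \<le> G\<close> open and compactly generated. Every compactly generated closed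
  \<open>L \<le> R\<close> satisfies \<open>Res\<^sub>R(L) = Res\<^sub>G(L)\<close>, so the residual order on \<open>\<K>(R)\<close> and its heights are
  inherited from \<open>G\<close>. Hence the order is well-founded on decomposable groups and
  \<open>h\<^sub>G(O) = r(R)\<close> for \<open>O \<noteq> 1\<close>. As the height is monotone and every member of \<open>\<K>(G)\<close> lies in
  some \<open>O\<^sub>i\<close> of an exhaustion, the residual rank satisfies the equations that define the
  decomposition rank, and by induction over decomposability these have only one solution.
\<close>

section \<open>Totally disconnected locally compact groups\<close>

text \<open>The equality Res_R(L) = Res_G(L) rests on the compact generation of L. If R is normal, a
  relatively open subgroup of R normalized by L contains the trace on R of an open subgroup of the
  ambient group normalized by L. The same thickening handles the compact group V: if B is compactly
  generated, closed and normal in BV, the V-conjugates of an open subgroup normalized by B intersect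
  in an open subgroup normalized by BV.

  Decomposability quantifies over all compactly generated open subgroups rather than over one
  exhaustion, so it is stated without a rank function. It passes from the target of a continuous
  homomorphism to its source as soon as the closed subgroups killed by the homomorphism are
  decomposable; this one principle covers closed subgroups, extensions and the passage between
  \<open>nat set\<close> and other carrier types. Neither existence nor uniqueness of the
  decomposition rank is presupposed: the residual rank itself is the solution whose existence is
  required.\<close>

definition normalizes :: "('a, 'b) monoid_scheme \<Rightarrow> 'a set \<Rightarrow> 'a set \<Rightarrow> bool" where
  "normalizes G K U \<longleftrightarrow> (\<forall>k\<in>K. \<forall>x\<in>U. k \<otimes>\<^bsub>G\<^esub> x \<otimes>\<^bsub>G\<^esub> inv\<^bsub>G\<^esub> k \<in> U)"

locale tdlcsc = group G for G :: "'a monoid" (structure) +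
  fixes T :: "'a topology"
  assumes tdlcsc_group: "tdlcsc_group G T"

lemma tdlcsc_iff: "tdlcsc G T \<longleftrightarrow> tdlcsc_group G T"
  by (auto simp: tdlcsc_def tdlcsc_axioms_def tdlcsc_group_def topological_group_def)

section \<open>Subgroups, conjugation and generated subgroups\<close>

context group
begin

lemma inv_mult_cancel:
  "\<lbrakk>x \<in> carrier G; y \<in> carrier G\<rbrakk> \<Longrightarrow> inv x \<otimes> (x \<otimes> y) = y"
  "\<lbrakk>x \<in> carrier G; y \<in> carrier G\<rbrakk> \<Longrightarrow> x \<otimes> (inv x \<otimes> y) = y"
  by (simp_all add: m_assoc[symmetric])

lemmas group_simps = m_assoc inv_mult_group inv_mult_cancel

lemma inv_subgrp: "\<lbrakk>subgroup H G; x \<in> H\<rbrakk> \<Longrightarrow> inv\<^bsub>G\<lparr>carrier := H\<rparr>\<^esub> x = inv x"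
  by (simp add: m_inv_consistent)

lemma subgroup_of_subgroup:
  assumes "subgroup H G" "K \<subseteq> H"
  shows "subgroup K (G\<lparr>carrier := H\<rparr>) \<longleftrightarrow> subgroup K G"
proof
  assume "subgroup K (G\<lparr>carrier := H\<rparr>)"
  then show "subgroup K G" using assms incl_subgroup by blast
next
  assume "subgroup K G"
  then show "subgroup K (G\<lparr>carrier := H\<rparr>)" using assms subgroup_incl by blast
qed

lemma subgroup_subgrp_iff:
  assumes "subgroup H G"
  shows "subgroup K (G\<lparr>carrier := H\<rparr>) \<longleftrightarrow> subgroup K G \<and> K \<subseteq> H"
  using subgroup_of_subgroup[OF assms] subgroup.subset[of K "G\<lparr>carrier := H\<rparr>"] by auto

lemma normalizes_subgrp:
  assumes "subgroup H G" "K \<subseteq> H"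
  shows "normalizes (G\<lparr>carrier := H\<rparr>) K U \<longleftrightarrow> normalizes G K U"
  using assms by (auto simp: normalizes_def inv_subgrp subset_iff)

text \<open>\<open>normalizes\<close> only asks for the inclusion kUk^-1 \<subseteq> U, so for a
  generating set C that need not be symmetric the inverses of its elements are a separate
  assumption.\<close>

lemma normalizes_generate:
  assumes C: "C \<subseteq> carrier G" and U: "U \<subseteq> carrier G"
    and 1: "normalizes G C U" and 2: "\<And>c x. c \<in> C \<Longrightarrow> x \<in> U \<Longrightarrow> inv c \<otimes> x \<otimes> c \<in> U"
  shows "normalizes G (generate G C) U"
proof -
  have "\<forall>x\<in>U. k \<otimes> x \<otimes> inv k \<in> U" if "k \<in> generate G C" for k
    using that
  proof (induction rule: generate.induct)
    case one then show ?case using U by auto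
  next
    case (incl h) then show ?case using 1 by (auto simp: normalizes_def)
  next
    case (inv h) then show ?case using 2 C by auto
  next
    case (eng h1 h2)
    have c: "h1 \<in> carrier G" "h2 \<in> carrier G"
      using eng generate_in_carrier[OF C] by auto
    show ?case
    proof
      fix x assume x: "x \<in> U"
      then have "h1 \<otimes> (h2 \<otimes> x \<otimes> inv h2) \<otimes> inv h1 \<in> U" using eng by blast
      then show "h1 \<otimes> h2 \<otimes> x \<otimes> inv (h1 \<otimes> h2) \<in> U"
        using c x U by (simp add: m_assoc inv_mult_group subset_iff)
    qed
  qed
  then show ?thesis by (auto simp: normalizes_def)
qed

lemma normalizes_on_generate:
  assumes K: "K \<subseteq> carrier G" and C: "C \<subseteq> carrier G"
    and 1: "\<And>k c. k \<in> K \<Longrightarrow> c \<in> C \<Longrightarrow> k \<otimes> c \<otimes> inv k \<in> generate G C"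
  shows "normalizes G K (generate G C)"
  unfolding normalizes_def
proof (intro ballI)
  fix k x assume k: "k \<in> K" and "x \<in> generate G C"
  from this(2) show "k \<otimes> x \<otimes> inv k \<in> generate G C"
  proof (induction rule: generate.induct)
    case one
    have "k \<in> carrier G" using k K by auto
    then show ?case by (simp add: generate.one)
  next
    case (incl h) then show ?case using 1 k by auto
  next
    case (inv h)
    have "inv (k \<otimes> h \<otimes> inv k) \<in> generate G C"
      using 1[OF k inv] C generate_m_inv_closed by blast
    moreover have "k \<in> carrier G" "h \<in> carrier G" using k K inv C by auto
    ultimately show ?case by (simp add: inv_mult_group m_assoc)
  next
    case (eng h1 h2)
    have c: "h1 \<in> carrier G" "h2 \<in> carrier G" "k \<in> carrier G"
      using eng k K generate_in_carrier[OF C] by auto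
    have "(k \<otimes> h1 \<otimes> inv k) \<otimes> (k \<otimes> h2 \<otimes> inv k) \<in> generate G C"
      using eng by (auto intro: generate.eng)
    also have "(k \<otimes> h1 \<otimes> inv k) \<otimes> (k \<otimes> h2 \<otimes> inv k) = k \<otimes> (h1 \<otimes> h2) \<otimes> inv k"
      using c by (simp add: group_simps)
    finally show ?case .
  qed
qed

lemma normalizes_mult:
  assumes "K \<subseteq> carrier G" "L \<subseteq> carrier G" "U \<subseteq> carrier G" "normalizes G K U" "normalizes G L U"
  shows "normalizes G (K <#> L) U"
  unfolding normalizes_def set_mult_def
proof clarsimp
  fix x k l assume *: "x \<in> U" "k \<in> K" "l \<in> L"
  then have "k \<otimes> (l \<otimes> x \<otimes> inv l) \<otimes> inv k \<in> U" using assms by (auto simp: normalizes_def)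
  then show "k \<otimes> l \<otimes> x \<otimes> inv (k \<otimes> l) \<in> U"
    using assms * by (simp add: m_assoc inv_mult_group subset_iff)
qed

lemma subgroup_set_mult:
  assumes N: "subgroup N G" and W: "subgroup W G" and n: "normalizes G W N"
  shows "subgroup (N <#> W) G"
proof (rule subgroupI)
  have c: "N \<subseteq> carrier G" "W \<subseteq> carrier G" using subgroup.subset[OF N] subgroup.subset[OF W] by auto
  show "N <#> W \<subseteq> carrier G" using c set_mult_closed by blast
  show "N <#> W \<noteq> {}" using subgroup.one_closed[OF N] subgroup.one_closed[OF W]
    by (auto simp: set_mult_def)
next
  fix a assume "a \<in> N <#> W"
  then obtain x w where a: "a = x \<otimes> w" "x \<in> N" "w \<in> W" by (auto simp: set_mult_def)
  have c: "x \<in> carrier G" "w \<in> carrier G" using a subgroup.subset[OF N] subgroup.subset[OF W] by auto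
  have "inv w \<otimes> inv x \<otimes> inv (inv w) \<in> N"
    using n a subgroup.m_inv_closed[OF W] subgroup.m_inv_closed[OF N] by (auto simp: normalizes_def)
  moreover have "inv a = (inv w \<otimes> inv x \<otimes> inv (inv w)) \<otimes> inv w"
    using a c by (simp add: inv_mult_group m_assoc)
  ultimately show "inv a \<in> N <#> W"
    using a subgroup.m_inv_closed[OF W] by (auto simp: set_mult_def)
next
  fix a b assume "a \<in> N <#> W" "b \<in> N <#> W"
  then obtain x w y v where a: "a = x \<otimes> w" "x \<in> N" "w \<in> W" and b: "b = y \<otimes> v" "y \<in> N" "v \<in> W"
    by (auto simp: set_mult_def)
  have c: "x \<in> carrier G" "w \<in> carrier G" "y \<in> carrier G" "v \<in> carrier G"
    using a b subgroup.subset[OF N] subgroup.subset[OF W] by auto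
  have "x \<otimes> (w \<otimes> y \<otimes> inv w) \<in> N"
    using n a b subgroup.m_closed[OF N] by (auto simp: normalizes_def)
  moreover have "a \<otimes> b = (x \<otimes> (w \<otimes> y \<otimes> inv w)) \<otimes> (w \<otimes> v)"
    using a b c by (simp add: group_simps)
  ultimately show "a \<otimes> b \<in> N <#> W"
    using a b subgroup.m_closed[OF W] by (auto simp: set_mult_def)
qed

lemma generate_leI: "\<lbrakk>subgroup H G; C \<subseteq> H\<rbrakk> \<Longrightarrow> generate G C \<subseteq> H"
  by (rule generate_subgroup_incl)

lemma generate_superset: "C \<subseteq> generate G C"
  by (auto intro: generate.incl)

end

section \<open>Uniform neighbourhoods of the identity, compact open subgroups, closed
  subgroups\<close>

context tdlcsc
begin

lemma
  shows topspace: "topspace T = carrier G"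
    and cont_mult: "continuous_map (prod_topology T T) T (\<lambda>(x, y). x \<otimes> y)"
    and cont_inv: "continuous_map T T (\<lambda>x. inv x)"
    and Hausdorff: "Hausdorff_space T"
    and totally_disc: "totally_disconnected_space T"
    and loc_compact: "locally_compact_space T"
    and second_countable: "second_countable T"
  using tdlcsc_group by (auto simp: tdlcsc_group_def topological_group_def)

lemma subtopology_carrier: "subtopology T (carrier G) = T"
  using subtopology_topspace[of T] by (simp add: topspace)

lemma openin_carrier: "openin T (carrier G)"
  using openin_topspace[of T] by (simp add: topspace)

lemma closedin_carrier: "closedin T (carrier G)"
  using closedin_topspace[of T] by (simp add: topspace)

lemma open_carrier: "openin T U \<Longrightarrow> U \<subseteq> carrier G"
  using openin_subset topspace by blast

lemma closed_carrier: "closedin T U \<Longrightarrow> U \<subseteq> carrier G"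
  using closedin_subset topspace by blast

lemma compact_carrier: "compactin T U \<Longrightarrow> U \<subseteq> carrier G"
  using compactin_subset_topspace topspace by blast

lemma compact_closed: "compactin T C \<Longrightarrow> closedin T C"
  by (simp add: Hausdorff compactin_imp_closedin)

lemma continuous_mult:
  assumes "continuous_map Y T f" "continuous_map Y T g"
  shows "continuous_map Y T (\<lambda>x. f x \<otimes> g x)"
proof -
  have "continuous_map Y (prod_topology T T) (\<lambda>x. (f x, g x))"
    using assms by (simp add: continuous_map_pairedI)
  from continuous_map_compose[OF this cont_mult] show ?thesis by (simp add: o_def)
qed

lemma continuous_inv:
  assumes "continuous_map Y T f"
  shows "continuous_map Y T (\<lambda>x. inv (f x))"
  using continuous_map_compose[OF assms cont_inv] by (simp add: o_def)

lemma continuous_const: "a \<in> carrier G \<Longrightarrow> continuous_map Y T (\<lambda>_. a)"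
  by (simp add: topspace)

lemma continuous_conj: "continuous_map (prod_topology T T) T (\<lambda>(k, x). k \<otimes> x \<otimes> inv k)"
  unfolding case_prod_unfold
  by (intro continuous_mult continuous_inv continuous_map_fst continuous_map_snd)

lemma openin_l_coset:
  assumes "openin T U" "a \<in> carrier G"
  shows "openin T (a <# U)"
proof -
  have "a <# U = {x \<in> topspace T. inv a \<otimes> x \<in> U}"
    using assms open_carrier[OF assms(1)]
    by (force simp: l_coset_def topspace m_assoc[symmetric])
  moreover have "continuous_map T T (\<lambda>x. inv a \<otimes> x)"
    using assms by (intro continuous_mult continuous_const) auto
  ultimately show ?thesis
    using assms openin_continuous_map_preimage by fastforce
qed

lemma openin_r_coset:
  assumes "openin T U" "a \<in> carrier G"
  shows "openin T (U #> a)"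
proof -
  have "U #> a = {x \<in> topspace T. x \<otimes> inv a \<in> U}"
    using assms open_carrier[OF assms(1)]
    by (force simp: r_coset_def topspace m_assoc)
  moreover have "continuous_map T T (\<lambda>x. x \<otimes> inv a)"
    using assms by (intro continuous_mult continuous_const) auto
  ultimately show ?thesis
    using assms openin_continuous_map_preimage by fastforce
qed

lemma openin_set_mult_right:
  assumes "openin T U" "A \<subseteq> carrier G"
  shows "openin T (A <#> U)"
proof -
  have "A <#> U = (\<Union>a\<in>A. a <# U)" by (auto simp: set_mult_def l_coset_def)
  moreover have "openin T V" if "V \<in> (\<lambda>a. a <# U) ` A" for V
    using that assms openin_l_coset by blast
  ultimately show ?thesis by (simp add: openin_Union)
qed

lemma openin_set_mult_left:
  assumes "openin T U" "A \<subseteq> carrier G"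
  shows "openin T (U <#> A)"
proof -
  have "U <#> A = (\<Union>a\<in>A. U #> a)" by (auto simp: set_mult_def r_coset_def)
  moreover have "openin T V" if "V \<in> (\<lambda>a. U #> a) ` A" for V
    using that assms openin_r_coset by blast
  ultimately show ?thesis by (simp add: openin_Union)
qed

lemma openin_subgroupI:
  assumes H: "subgroup H G" and W: "openin T W" "w \<in> W" "W \<subseteq> H"
  shows "openin T H"
proof -
  have w: "w \<in> H" "w \<in> carrier G" using W open_carrier by auto
  have "\<exists>V. openin T V \<and> h \<in> V \<and> V \<subseteq> H" if h: "h \<in> H" for h
  proof (intro exI conjI)
    have hc: "h \<in> carrier G" using h subgroup.subset[OF H] by blast
    show "openin T (h \<otimes> inv w <# W)" using hc w W openin_l_coset by auto
    have "h \<otimes> inv w \<otimes> w = h" using hc w by (simp add: m_assoc)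
    then show "h \<in> h \<otimes> inv w <# W" using W by (force simp: l_coset_def)
    show "h \<otimes> inv w <# W \<subseteq> H"
      using h w W by (auto simp: l_coset_def intro!: subgroup.m_closed[OF H] subgroup.m_inv_closed[OF H])
  qed
  then show ?thesis using openin_subopen[of T H] by blast
qed

lemma open_subgroup_closed:
  assumes H: "subgroup H G" "openin T H"
  shows "closedin T H"
proof -
  have "(carrier G - H) <#> H = carrier G - H"
  proof -
    have "x \<otimes> h \<in> carrier G - H" if "x \<in> carrier G - H" "h \<in> H" for x h
    proof -
      have h: "h \<in> carrier G" using that subgroup.subset[OF H(1)] by blast
      have "(x \<otimes> h) \<otimes> inv h = x" using that h by (simp add: m_assoc)
      then have "x \<otimes> h \<notin> H"
        using that subgroup.m_closed[OF H(1), of "x \<otimes> h" "inv h"] subgroup.m_inv_closed[OF H(1)]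
        by auto
      then show ?thesis using that h by auto
    qed
    moreover have "x \<in> (carrier G - H) <#> H" if "x \<in> carrier G - H" for x
      using that subgroup.one_closed[OF H(1)] by (force simp: set_mult_def)
    ultimately show ?thesis by (auto simp: set_mult_def)
  qed
  then have "openin T (carrier G - H)"
    using openin_set_mult_right[OF H(2), of "carrier G - H"] by auto
  then show ?thesis
    using subgroup.subset[OF H(1)] by (simp add: closedin_def topspace)
qed

text \<open>K x {1} is compact and lies in the open set where f takes values in Y, so Wallace's
  theorem fits a box around it. This yields neighbourhoods of 1 that work uniformly over a compact
  set.\<close>

lemma tube:
  assumes K: "compactin T K" and f: "continuous_map (prod_topology T T) T f"
    and Y: "openin T Y" and 1: "\<And>k. k \<in> K \<Longrightarrow> f (k, \<one>) \<in> Y"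
  obtains W where "openin T W" "\<one> \<in> W" "\<And>k w. k \<in> K \<Longrightarrow> w \<in> W \<Longrightarrow> f (k, w) \<in> Y"
proof -
  let ?P = "{p \<in> topspace (prod_topology T T). f p \<in> Y}"
  have "openin (prod_topology T T) ?P"
    using f Y openin_continuous_map_preimage by blast
  moreover have "K \<times> {\<one>} \<subseteq> ?P"
    using 1 compact_carrier[OF K] by (auto simp: topspace)
  moreover have "compactin T {\<one>}" by (simp add: topspace)
  ultimately show thesis
  proof (elim Wallace_theorem_prod_topology[OF K])
    fix U V assume UV: "openin T V" "K \<subseteq> U" "{\<one>} \<subseteq> V" "U \<times> V \<subseteq> ?P"
    show thesis
    proof (rule that[OF UV(1)])
      show "\<one> \<in> V" using UV by blast
      fix k w assume "k \<in> K" "w \<in> V"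
      then have "(k, w) \<in> ?P" using UV by blast
      then show "f (k, w) \<in> Y" by simp
    qed
  qed
qed

text \<open>In a compact Hausdorff neighbourhood C of x the components are the quasi-components, so
  {x} is a quasi-component, and compactness separates it from C - (U \<inter> Y) by a clopen
  set.\<close>

lemma compact_open_nbhd:
  assumes Y: "openin T Y" and x: "x \<in> Y"
  obtains K where "compactin T K" "openin T K" "x \<in> K" "K \<subseteq> Y"
proof -
  have xc: "x \<in> topspace T" using Y x openin_subset by blast
  obtain U C where UC: "openin T U" "compactin T C" "x \<in> U" "U \<subseteq> C"
    using loc_compact xc unfolding locally_compact_space_def by blast
  have C: "closedin T C" "C \<subseteq> topspace T"
    using UC compact_closed compactin_subset_topspace by blast+
  define S where "S = subtopology T C"
  have tS: "topspace S = C" using C by (auto simp: S_def)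
  have cS: "compact_space S" using UC by (simp add: S_def compact_space_subtopology)
  have hS: "Hausdorff_space S" using Hausdorff by (simp add: S_def Hausdorff_space_subtopology)
  have lS: "locally_compact_space S" using cS by (simp add: compact_imp_locally_compact_space)
  define D where "D = connected_component_of_set S x"
  have xS: "x \<in> topspace S" using UC tS by auto
  have D: "D \<in> connected_components_of S"
    using xS by (simp add: D_def connected_component_in_connected_components_of)
  have "connectedin T D"
    using connectedin_connected_component_of[of S x] by (simp add: D_def S_def connectedin_subtopology)
  then obtain a where "D \<subseteq> {a}" using totally_disc by (auto simp: totally_disconnected_space_def)
  moreover have "x \<in> D" using xS by (simp add: D_def connected_component_of_refl)
  ultimately have Dx: "D = {x}" by auto
  have "{x} \<in> quasi_components_of S"
    using compact_quasi_eq_connected_components_of[OF lS hS, of D] D Dx xS by (simp)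
  moreover have cl: "compactin S (C - (U \<inter> Y))"
  proof -
    have "closedin T (C - (U \<inter> Y))" using C UC Y by (simp add: closedin_diff openin_Int)
    then have "closedin S (C - (U \<inter> Y))"
      by (metis C(1) Diff_subset S_def closedin_closed_subtopology)
    then show ?thesis using cS closedin_compact_space by blast
  qed
  ultimately have "separated_between S {x} (C - (U \<inter> Y))"
    using separated_between_quasi_component_compact UC x by (metis DiffE IntI disjnt_insert1 disjnt_empty1)
  then obtain K where K: "closedin S K" "openin S K" "x \<in> K" "C - (U \<inter> Y) \<subseteq> C - K"
    unfolding separated_between tS by auto
  have KC: "K \<subseteq> C" using K(1) closedin_subset tS by metis
  then have KU: "K \<subseteq> U \<inter> Y" using K by auto
  have "compactin S K" using K cS closedin_compact_space by blast
  then have cK: "compactin T K" by (simp add: S_def compactin_subtopology)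
  obtain K' where K': "openin T K'" "K = K' \<inter> C"
    using K(2) by (auto simp: S_def openin_subtopology)
  \<comment> \<open>K is so far open only in C; as it lies in the open set U \<subseteq> C, it is
    open in \<open>T\<close>.\<close>
  then have "K = K' \<inter> U" using KU UC by auto
  then have "openin T K" using K' UC by auto
  then show thesis using that cK K KU by auto
qed

text \<open>With K compact open around 1, a symmetric V near 1 with KV \<subseteq> K generates a
  subgroup that still maps K to K by right multiplication. This subgroup lies in K because 1 \<in>
  K.\<close>

lemma van_Dantzig:
  assumes Y: "openin T Y" and x: "\<one> \<in> Y"
  obtains U where "subgroup U G" "openin T U" "compactin T U" "U \<subseteq> Y"
proof -
  obtain K where K: "compactin T K" "openin T K" "\<one> \<in> K" "K \<subseteq> Y"
    using compact_open_nbhd[OF Y x] .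
  obtain W where W: "openin T W" "\<one> \<in> W" "\<And>k w. k \<in> K \<Longrightarrow> w \<in> W \<Longrightarrow> k \<otimes> w \<in> K"
  proof -
    have "(\<lambda>(x, y). x \<otimes> y) (k, \<one>) \<in> K" if "k \<in> K" for k
      using that compact_carrier[OF K(1)] by auto
    then show thesis using tube[OF K(1) cont_mult K(2)] that by auto
  qed
  define V where "V = W \<inter> {x \<in> topspace T. inv x \<in> W}"
  have V: "openin T V" using W openin_continuous_map_preimage[OF cont_inv] by (auto simp: V_def)
  have Vc: "V \<subseteq> carrier G" using V open_carrier by blast
  have one: "\<one> \<in> V" using W by (auto simp: V_def topspace)
  let ?U = "generate G V"
  have *: "\<forall>k\<in>K. k \<otimes> u \<in> K" if "u \<in> ?U" for u
    using that
  proof (induction rule: generate.induct)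
    case one then show ?case using compact_carrier[OF K(1)] by auto
  next
    case (eng h1 h2)
    have "h1 \<in> carrier G" "h2 \<in> carrier G"
      using eng generate_in_carrier[OF Vc] by auto
    then show ?case using eng compact_carrier[OF K(1)] by (metis m_assoc subsetD)
  qed (use W V_def in auto)
  have sub: "subgroup ?U G" using generate_is_subgroup Vc by blast
  have UK: "?U \<subseteq> K"
  proof
    fix u assume u: "u \<in> ?U"
    then have "\<one> \<otimes> u \<in> K" using * K by blast
    then show "u \<in> K" using generate_in_carrier[OF Vc u] by simp
  qed
  have op: "openin T ?U" using openin_subgroupI[OF sub V one generate_superset] .
  have "compactin T ?U"
    using closed_compactin[OF K(1) UK open_subgroup_closed[OF sub op]] .
  then show thesis using that sub op UK K by auto
qed

lemma open_subgroup_avoiding: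
  assumes "x \<in> carrier G" "x \<noteq> \<one>"
  obtains U where "subgroup U G" "openin T U" "x \<notin> U"
proof -
  have "openin T (carrier G - {x})"
    using assms compact_closed[of "{x}"] openin_carrier by (simp add: openin_diff topspace)
  then obtain U where "subgroup U G" "openin T U" "U \<subseteq> carrier G - {x}"
    using van_Dantzig[of "carrier G - {x}"] assms(2) by blast
  then show thesis using that[of U] by blast
qed

lemma tube_subgroup:
  assumes K: "compactin T K" and f: "continuous_map (prod_topology T T) T f"
    and Y: "openin T Y" and 1: "\<And>k. k \<in> K \<Longrightarrow> f (k, \<one>) \<in> Y"
  obtains W where "subgroup W G" "openin T W" "compactin T W"
    "\<And>k w. k \<in> K \<Longrightarrow> w \<in> W \<Longrightarrow> f (k, w) \<in> Y"
proof (rule tube[OF K f Y])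
  fix k assume "k \<in> K"
  then show "f (k, \<one>) \<in> Y" by (rule 1)
next
  fix W assume W: "openin T W" "\<one> \<in> W" "\<And>k w. k \<in> K \<Longrightarrow> w \<in> W \<Longrightarrow> f (k, w) \<in> Y"
  obtain U where U: "subgroup U G" "openin T U" "compactin T U" "U \<subseteq> W"
    using van_Dantzig[OF W(1,2)] .
  show thesis
    by (rule that[OF U(1-3)]) (use U(4) W(3) in auto)
qed

lemma conj_tube:
  assumes K: "compactin T K" and Y: "openin T Y" "\<one> \<in> Y"
  obtains W where "subgroup W G" "openin T W" "compactin T W"
    "\<And>k w. k \<in> K \<Longrightarrow> w \<in> W \<Longrightarrow> k \<otimes> w \<otimes> inv k \<in> Y"
proof -
  have "(\<lambda>(k, x). k \<otimes> x \<otimes> inv k) (k, \<one>) \<in> Y" if "k \<in> K" for k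
    using that Y(2) compact_carrier[OF K] by auto
  then show thesis
    using tube_subgroup[OF K continuous_conj Y(1)] that by auto
qed

lemma compact_image2:
  assumes "compactin T A" "compactin T B" "continuous_map (prod_topology T T) T f"
  shows "compactin T (f ` (A \<times> B))"
  by (rule image_compactin[OF _ assms(3)]) (simp add: compactin_Times assms)

lemma compact_inv: "compactin T A \<Longrightarrow> compactin T ((\<lambda>x. inv x) ` A)"
  by (rule image_compactin[OF _ cont_inv])

text \<open>If x is outside CV, the compact set xV^-1 misses C; a uniform neighbourhood W keeps
  xWV^-1 off C, so xW misses CV.\<close>

lemma closed_set_mult_compact:
  assumes C: "closedin T C" and V: "compactin T V"
  shows "closedin T (C <#> V)"
proof -
  have Cc: "C \<subseteq> carrier G" "V \<subseteq> carrier G"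
    using C V closed_carrier compact_carrier by auto
  have "\<exists>W. openin T W \<and> x \<in> W \<and> W \<subseteq> carrier G - (C <#> V)" if x: "x \<in> carrier G - (C <#> V)" for x
  proof -
    let ?f = "\<lambda>(v, w). x \<otimes> w \<otimes> inv v"
    have f: "continuous_map (prod_topology T T) T ?f"
      unfolding case_prod_unfold using x
      by (intro continuous_mult continuous_inv continuous_map_fst continuous_map_snd continuous_const) auto
    have op: "openin T (carrier G - C)" using C by (simp add: openin_diff flip: topspace)
    have "?f (v, \<one>) \<in> carrier G - C" if v: "v \<in> V" for v
    proof -
      have vc: "v \<in> carrier G" using v Cc by auto
      have "x \<otimes> inv v \<notin> C"
      proof
        assume "x \<otimes> inv v \<in> C"
        moreover have "x = x \<otimes> inv v \<otimes> v" using x vc by (simp add: m_assoc)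
        ultimately have "x \<in> C <#> V" using v by (auto simp: set_mult_def)
        then show False using x by auto
      qed
      then show ?thesis using x vc by auto
    qed
    then obtain W where W: "subgroup W G" "openin T W" "\<And>v w. v \<in> V \<Longrightarrow> w \<in> W \<Longrightarrow> ?f (v, w) \<in> carrier G - C"
      using tube_subgroup[OF V f op] by blast
    have "x \<in> x <# W" using x subgroup.one_closed[OF W(1)] by (force simp: l_coset_def)
    moreover have "x <# W \<subseteq> carrier G - (C <#> V)"
    proof
      fix y assume "y \<in> x <# W"
      then obtain w where w: "w \<in> W" "y = x \<otimes> w" by (auto simp: l_coset_def)
      have wc: "w \<in> carrier G" using w W open_carrier by auto
      have "y \<notin> C <#> V"
      proof
        assume "y \<in> C <#> V"
        then obtain c v where "c \<in> C" "v \<in> V" "y = c \<otimes> v" by (auto simp: set_mult_def)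
        then have "y \<otimes> inv v = c" using Cc by (auto simp: m_assoc subset_iff)
        then have "?f (v, w) \<in> C" using w \<open>c \<in> C\<close> by auto
        then show False using W(3) w \<open>v \<in> V\<close> by blast
      qed
      then show "y \<in> carrier G - (C <#> V)" using w x wc by auto
    qed
    moreover have "openin T (x <# W)" using W x openin_l_coset by auto
    ultimately show ?thesis by blast
  qed
  then have "openin T (carrier G - (C <#> V))" using openin_subopen[of T "carrier G - (C <#> V)"] by blast
  moreover have "C <#> V \<subseteq> carrier G" using Cc set_mult_closed by blast
  ultimately show ?thesis by (simp add: closedin_def topspace)
qed

lemma tdlcsc_subgroup:
  assumes H: "subgroup H G" "closedin T H"
  shows "tdlcsc_group (subgrp G H) (subtopology T H)"
proof -
  interpret S: group "subgrp G H" using H subgroup.subgroup_is_group group_axioms by blast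
  have ts: "topspace (subtopology T H) = H"
    using closedin_subset[OF H(2)] by auto
  have cm: "continuous_map (prod_topology (subtopology T H) (subtopology T H)) (subtopology T H) (\<lambda>(x, y). x \<otimes> y)"
    unfolding prod_topology_subtopology subtopology_subtopology
    using H subgroup.m_closed[OF H(1)]
    by (auto simp: continuous_map_in_subtopology continuous_map_from_subtopology[OF cont_mult] Pi_iff topspace_subtopology
       intro!: continuous_map_from_subtopology cont_mult)
  have ci: "continuous_map (subtopology T H) (subtopology T H) (\<lambda>x. inv\<^bsub>subgrp G H\<^esub> x)"
  proof -
    have "continuous_map (subtopology T H) (subtopology T H) (\<lambda>x. inv x)"
      using H subgroup.m_inv_closed[OF H(1)]
      by (auto simp: continuous_map_in_subtopology intro!: continuous_map_from_subtopology cont_inv)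
    then show ?thesis
      by (rule continuous_map_eq) (simp add: inv_subgrp H)
  qed
  have td: "totally_disconnected_space (subtopology T H)"
    using totally_disc by (auto simp: totally_disconnected_space_def connectedin_subtopology)
  have "topological_group (subgrp G H) (subtopology T H)"
    using S.is_group ts cm ci unfolding topological_group_def by simp
  moreover have "locally_compact_space (subtopology T H)"
    using loc_compact H(2) by (rule locally_compact_space_closed_subset)
  ultimately show ?thesis
    using Hausdorff second_countable td
    by (simp add: tdlcsc_group_def Hausdorff_space_subtopology second_countable_subtopology)
qed

end

section \<open>Residuals\<close>

text \<open>
  \<open>residual_in G T A K\<close> is \<open>Res\<^sub>A(K)\<close>, computed inside the ambient group \<open>G\<close>; the discrete residual
  of \<open>A\<close> is the case \<open>K = A\<close>.
\<close>

definition residual_in :: "('a, 'b) monoid_scheme \<Rightarrow> 'a topology \<Rightarrow> 'a set \<Rightarrow> 'a set \<Rightarrow> 'a set" where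
  "residual_in G T A K =
     \<Inter>{N. subgroup N G \<and> N \<subseteq> A \<and> openin (subtopology T A) N \<and> normalizes G K N}"

lemma residual_in_mono:
  assumes "K \<subseteq> K'"
  shows "residual_in G T A K \<subseteq> residual_in G T A K'"
proof -
  have "normalizes G K' N \<Longrightarrow> normalizes G K N" for N
    using assms by (auto simp: normalizes_def)
  then show ?thesis unfolding residual_in_def by blast
qed

context group
begin

lemma normalizes_self: "subgroup H G \<Longrightarrow> K \<subseteq> H \<Longrightarrow> normalizes G K H"
  by (auto simp: normalizes_def intro!: subgroup.m_closed subgroup.m_inv_closed)

text \<open>For a subgroup K the one-sided condition already gives equality, by conjugating with the
  inverse.\<close>

lemma conj_image_normalizes:
  assumes K: "subgroup K G" and U: "U \<subseteq> carrier G"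
  shows "(\<forall>k\<in>K. (\<lambda>x. k \<otimes> x \<otimes> inv k) ` U = U) \<longleftrightarrow> normalizes G K U"
proof
  assume "\<forall>k\<in>K. (\<lambda>x. k \<otimes> x \<otimes> inv k) ` U = U"
  then show "normalizes G K U" unfolding normalizes_def by blast
next
  assume n: "normalizes G K U"
  show "\<forall>k\<in>K. (\<lambda>x. k \<otimes> x \<otimes> inv k) ` U = U"
  proof (intro ballI equalityI subsetI)
    fix k x assume k: "k \<in> K" and x: "x \<in> U"
    have c: "k \<in> carrier G" "x \<in> carrier G" using k x U subgroup.subset[OF K] by auto
    have "inv k \<otimes> x \<otimes> inv (inv k) \<in> U"
      using n x subgroup.m_inv_closed[OF K k] by (auto simp: normalizes_def)
    moreover have "k \<otimes> (inv k \<otimes> x \<otimes> inv (inv k)) \<otimes> inv k = x"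
      using c by (simp add: group_simps)
    ultimately show "x \<in> (\<lambda>x. k \<otimes> x \<otimes> inv k) ` U" by force
  next
    fix k x assume "k \<in> K" "x \<in> (\<lambda>x. k \<otimes> x \<otimes> inv k) ` U"
    then show "x \<in> U" using n by (auto simp: normalizes_def)
  qed
qed

text \<open>Lets statements proved for a whole group be applied to a subgroup M regarded as a group
  of its own, and read back in G.\<close>

lemma residual_in_subgrp:
  assumes "subgroup M G" "K \<subseteq> A" "A \<subseteq> M"
  shows "residual_in (G\<lparr>carrier := M\<rparr>) (subtopology T M) A K = residual_in G T A K"
proof -
  have "subtopology (subtopology T M) A = subtopology T A"
    using assms by (simp add: subtopology_subtopology Int_absorb1)
  then have "{N. subgroup N (G\<lparr>carrier := M\<rparr>) \<and> N \<subseteq> A \<and> openin (subtopology (subtopology T M) A) N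
         \<and> normalizes (G\<lparr>carrier := M\<rparr>) K N}
     = {N. subgroup N G \<and> N \<subseteq> A \<and> openin (subtopology T A) N \<and> normalizes G K N}"
    using assms by (auto simp: subgroup_subgrp_iff normalizes_subgrp)
  then show ?thesis by (simp add: residual_in_def)
qed

lemma normal_iff_normalizes:
  "N \<lhd> G \<longleftrightarrow> subgroup N G \<and> normalizes G (carrier G) N"
  by (auto simp: normal_inv_iff normalizes_def)

text \<open>The set is the intersection of the conjugates vPv^-1 with v \<in> V.\<close>

lemma subgroup_Inter_conj:
  assumes P: "subgroup P G" and V: "V \<subseteq> carrier G"
  shows "subgroup {x \<in> carrier G. \<forall>v\<in>V. inv v \<otimes> x \<otimes> v \<in> P} G"
proof (rule subgroupI)
  show "{x \<in> carrier G. \<forall>v\<in>V. inv v \<otimes> x \<otimes> v \<in> P} \<noteq> {}"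
    using V subgroup.one_closed[OF P] by (auto intro!: exI[of _ \<one>] simp: subset_iff)
next
  fix a assume a: "a \<in> {x \<in> carrier G. \<forall>v\<in>V. inv v \<otimes> x \<otimes> v \<in> P}"
  have "inv v \<otimes> inv a \<otimes> v \<in> P" if v: "v \<in> V" for v
  proof -
    have "inv (inv v \<otimes> a \<otimes> v) \<in> P" using a v subgroup.m_inv_closed[OF P] by auto
    moreover have "v \<in> carrier G" "a \<in> carrier G" using a v V by auto
    ultimately show ?thesis by (simp add: group_simps)
  qed
  then show "inv a \<in> {x \<in> carrier G. \<forall>v\<in>V. inv v \<otimes> x \<otimes> v \<in> P}" using a by auto
next
  fix a b assume a: "a \<in> {x \<in> carrier G. \<forall>v\<in>V. inv v \<otimes> x \<otimes> v \<in> P}"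
    and b: "b \<in> {x \<in> carrier G. \<forall>v\<in>V. inv v \<otimes> x \<otimes> v \<in> P}"
  have "inv v \<otimes> (a \<otimes> b) \<otimes> v \<in> P" if v: "v \<in> V" for v
  proof -
    have "(inv v \<otimes> a \<otimes> v) \<otimes> (inv v \<otimes> b \<otimes> v) \<in> P" using a b v subgroup.m_closed[OF P] by auto
    moreover have "v \<in> carrier G" "a \<in> carrier G" "b \<in> carrier G" using a b v V by auto
    ultimately show ?thesis by (simp add: group_simps)
  qed
  then show "a \<otimes> b \<in> {x \<in> carrier G. \<forall>v\<in>V. inv v \<otimes> x \<otimes> v \<in> P}" using a b by auto
qed auto

end

context tdlcsc
begin

lemma closed_subgroup_tdlcsc:
  "subgroup H G \<Longrightarrow> closedin T H \<Longrightarrow> tdlcsc (subgrp G H) (subtopology T H)"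
  by (simp add: tdlcsc_iff tdlcsc_subgroup)

lemma openin_subgroup_self: "subgroup A G \<Longrightarrow> openin (subtopology T A) A"
  using subgroup.subset[of A G] by (metis openin_topspace topspace topspace_subtopology_subset)

lemma residual_in_subset:
  assumes "subgroup A G" "K \<subseteq> A"
  shows "residual_in G T A K \<subseteq> A"
  using openin_subgroup_self[OF assms(1)] normalizes_self[OF assms] assms(1)
  unfolding residual_in_def by blast

lemma relative_residual_eq:
  assumes "subgroup K G"
  shows "relative_residual G T K = residual_in G T (carrier G) K"
proof -
  have "(subgroup U G \<and> openin T U \<and> (\<forall>k\<in>K. (\<lambda>x. k \<otimes> x \<otimes> inv k) ` U = U)) \<longleftrightarrow>
        (subgroup U G \<and> U \<subseteq> carrier G \<and> openin (subtopology T (carrier G)) U \<and> normalizes G K U)" for U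
    using conj_image_normalizes[OF assms, of U] subgroup.subset[of U G]
    by (auto simp: subtopology_carrier)
  then show ?thesis by (simp add: relative_residual_def residual_in_def)
qed

lemma relative_residual_subgrp:
  assumes "subgroup A G" "closedin T A" "subgroup K G" "K \<subseteq> A"
  shows "relative_residual (subgrp G A) (subtopology T A) K = residual_in G T A K"
proof -
  interpret A: tdlcsc "subgrp G A" "subtopology T A" using closed_subgroup_tdlcsc assms by blast
  have "relative_residual (subgrp G A) (subtopology T A) K = residual_in (subgrp G A) (subtopology T A) A K"
    using A.relative_residual_eq[of K] assms subgroup_subgrp_iff[OF assms(1)] by simp
  then show ?thesis using residual_in_subgrp[OF assms(1,4)] by simp
qed

lemma discrete_residual_eq:
  "discrete_residual G T = residual_in G T (carrier G) (carrier G)"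
proof -
  have "(N \<lhd> G \<and> openin T N) \<longleftrightarrow>
     (subgroup N G \<and> N \<subseteq> carrier G \<and> openin (subtopology T (carrier G)) N \<and> normalizes G (carrier G) N)" for N
    using subgroup.subset[of N G] unfolding normal_iff_normalizes
    by (auto simp: subtopology_carrier)
  then show ?thesis by (simp add: discrete_residual_def residual_in_def)
qed

lemma discrete_residual_subgrp:
  assumes "subgroup A G" "closedin T A"
  shows "discrete_residual (subgrp G A) (subtopology T A) = residual_in G T A A"
proof -
  interpret A: tdlcsc "subgrp G A" "subtopology T A" using closed_subgroup_tdlcsc assms by blast
  show ?thesis
    using A.discrete_residual_eq residual_in_subgrp[OF assms(1)] by simp
qed

lemma closed_rel_open_subgroup:
  assumes A: "subgroup A G" "closedin T A" and N: "subgroup N G" "N \<subseteq> A" "openin (subtopology T A) N"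
  shows "closedin T N"
proof -
  interpret A: tdlcsc "subgrp G A" "subtopology T A" using closed_subgroup_tdlcsc A by blast
  have "closedin (subtopology T A) N"
    using A.open_subgroup_closed[of N] N subgroup_subgrp_iff[OF A(1)] by blast
  then show ?thesis using A(2) closedin_trans_full by blast
qed

lemma residual_in_subgroup:
  assumes A: "subgroup A G" "K \<subseteq> A"
  shows "subgroup (residual_in G T A K) G"
  unfolding residual_in_def
proof (rule subgroups_Inter)
  show "{N. subgroup N G \<and> N \<subseteq> A \<and> openin (subtopology T A) N \<and> normalizes G K N} \<noteq> {}"
    using openin_subgroup_self[OF A(1)] normalizes_self[OF A] A(1) by blast
qed auto

lemma residual_in_closed:
  assumes A: "subgroup A G" "closedin T A" "K \<subseteq> A"
  shows "closedin T (residual_in G T A K)"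
  unfolding residual_in_def
proof (rule closedin_Inter)
  show "{N. subgroup N G \<and> N \<subseteq> A \<and> openin (subtopology T A) N \<and> normalizes G K N} \<noteq> {}"
    using openin_subgroup_self[OF A(1)] normalizes_self[OF A(1,3)] A(1) by blast
qed (use closed_rel_open_subgroup A in blast)

lemma residual_in_normalizes: "normalizes G K (residual_in G T A K)"
  by (auto simp: normalizes_def residual_in_def)

lemma residual_in_mono_ambient:
  assumes A: "subgroup A G" and B: "subgroup B G" "A \<subseteq> B" and K: "K \<subseteq> A"
  shows "residual_in G T A K \<subseteq> residual_in G T B K"
proof
  fix x assume x: "x \<in> residual_in G T A K"
  have "x \<in> N" if N: "subgroup N G" "N \<subseteq> B" "openin (subtopology T B) N" "normalizes G K N" for N
  proof -
    have "openin (subtopology T A) (N \<inter> A)"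
      using N(3) B(2) by (auto simp: openin_subtopology) 
    moreover have "subgroup (N \<inter> A) G" using N(1) A subgroups_Inter_pair by blast
    moreover have "normalizes G K (N \<inter> A)"
      using N(4) normalizes_self[OF A K] by (auto simp: normalizes_def)
    ultimately show ?thesis using x by (auto simp: residual_in_def)
  qed
  then show "x \<in> residual_in G T B K" by (auto simp: residual_in_def)
qed

text \<open>When A is relatively open in B, so are its own relatively open subgroups; hence every N
  that counts for A also counts for B.\<close>

lemma residual_in_rel_open:
  assumes A: "subgroup A G" and B: "subgroup B G" "A \<subseteq> B" and K: "K \<subseteq> A"
    and op: "openin (subtopology T B) A"
  shows "residual_in G T A K = residual_in G T B K"
proof
  show "residual_in G T A K \<subseteq> residual_in G T B K"
    by (rule residual_in_mono_ambient[OF A B K])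
  have "openin (subtopology T B) N" if "openin (subtopology T A) N" for N
  proof -
    have "subtopology T A = subtopology (subtopology T B) A"
      using B by (simp add: subtopology_subtopology Int_absorb1)
    then show ?thesis using that op openin_trans_full by metis
  qed
  then show "residual_in G T B K \<subseteq> residual_in G T A K"
    using B(2) unfolding residual_in_def by blast
qed

text \<open>
  Near the identity, elements of \<open>G\<close> commute with the compact generating set \<open>S\<close> modulo
  the \<open>L\<close>-normal closure of a compact open subgroup of \<open>N\<close>, so this closure can be thickened
  to an open subgroup of \<open>G\<close>.
\<close>

lemma thicken_normalized_subgroup:
  assumes R: "subgroup R G" "normalizes G (carrier G) R"
    and S: "compactin T S" "S \<subseteq> R" and L: "L = generate G S"
    and N: "subgroup N G" "N \<subseteq> R" "openin (subtopology T R) N" "normalizes G L N"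
  obtains P where "subgroup P G" "openin T P" "normalizes G L P" "P \<inter> R \<subseteq> N"
proof -
  obtain N' where N': "openin T N'" "N = N' \<inter> R" using N(3) by (auto simp: openin_subtopology)
  have "\<one> \<in> N'" using N' subgroup.one_closed[OF N(1)] by auto
  then obtain W where W: "subgroup W G" "openin T W" "compactin T W" "W \<subseteq> N'"
    using van_Dantzig[OF N'(1)] by blast
  have Rc: "R \<subseteq> carrier G" and Wc: "W \<subseteq> carrier G"
    using subgroup.subset[OF R(1)] subgroup.subset[OF W(1)] by auto
  have Sc: "S \<subseteq> carrier G" using S(2) Rc by auto
  have LR: "L \<subseteq> R" unfolding L by (rule generate_leI[OF R(1) S(2)])
  have Lc: "L \<subseteq> carrier G" using LR Rc by auto
  have Ls: "subgroup L G" unfolding L by (rule generate_is_subgroup[OF Sc])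
  \<comment> \<open>A is the seed: it is open in R and lies in N. The group N0 generated by its
    L-conjugates still lies in N and is normalized by L.\<close>
  define A where "A = W \<inter> R"
  have AN: "A \<subseteq> N" using W N' by (auto simp: A_def)
  have Ac: "A \<subseteq> carrier G" using Rc by (auto simp: A_def)
  have A1: "\<one> \<in> A" using subgroup.one_closed[OF R(1)] subgroup.one_closed[OF W(1)] by (auto simp: A_def)
  define C where "C = (\<Union>l\<in>L. (\<lambda>a. l \<otimes> a \<otimes> inv l) ` A)"
  have Cc: "C \<subseteq> carrier G" using Lc Ac by (auto simp: C_def subset_iff)
  define N0 where "N0 = generate G C"
  have N0: "subgroup N0 G" unfolding N0_def by (rule generate_is_subgroup[OF Cc])
  have N0c: "N0 \<subseteq> carrier G" using subgroup.subset[OF N0] .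
  have "C \<subseteq> N" using N(4) AN by (auto simp: C_def normalizes_def)
  then have N0N: "N0 \<subseteq> N" unfolding N0_def by (rule generate_leI[OF N(1)])
  have AC: "A \<subseteq> C"
  proof
    fix a assume a: "a \<in> A"
    then have "\<one> \<otimes> a \<otimes> inv \<one> \<in> C" using subgroup.one_closed[OF Ls] unfolding C_def by blast
    then show "a \<in> C" using a Ac by auto
  qed
  then have AN0: "A \<subseteq> N0" unfolding N0_def using generate_superset by blast
  have nL: "normalizes G L N0"
    unfolding N0_def
  proof (rule normalizes_on_generate[OF Lc Cc])
    fix k c assume k: "k \<in> L" and "c \<in> C"
    then obtain l a where c: "l \<in> L" "a \<in> A" "c = l \<otimes> a \<otimes> inv l" by (auto simp: C_def)
    have "k \<otimes> l \<in> L" using subgroup.m_closed[OF Ls] k c by auto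
    then have "(k \<otimes> l) \<otimes> a \<otimes> inv (k \<otimes> l) \<in> C" using c unfolding C_def by blast
    moreover have "k \<otimes> c \<otimes> inv k = (k \<otimes> l) \<otimes> a \<otimes> inv (k \<otimes> l)"
      using k c Lc Ac by (simp add: group_simps subset_iff)
    ultimately show "k \<otimes> c \<otimes> inv k \<in> generate G C" using generate_superset by auto
  qed
  obtain W1 where W1: "subgroup W1 G" "openin T W1" "compactin T W1"
    "\<And>k w. k \<in> S \<Longrightarrow> w \<in> W1 \<Longrightarrow> k \<otimes> w \<otimes> inv k \<in> W"
    using conj_tube[OF S(1) W(2) subgroup.one_closed[OF W(1)]] by blast
  define W' where "W' = W1 \<inter> W"
  have W': "subgroup W' G" "openin T W'" "W' \<subseteq> W"
    using W1 W subgroups_Inter_pair by (auto simp: W'_def)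
  have W'c: "W' \<subseteq> carrier G" using W'(3) Wc by auto
  \<comment> \<open>Bracketed as w(hw^-1h^-1) the commutator lies in W by the choice of W1;
    bracketed as (whw^-1)h^-1 it lies in R by normality. So it lies in A = W \<inter> R.\<close>
  have comm_gen: "w \<otimes> h \<otimes> inv w \<otimes> inv h \<in> N0" if w: "w \<in> W'" and h: "h \<in> S" for w h
  proof -
    have c: "w \<in> carrier G" "h \<in> carrier G" using w h W'c Sc by auto
    have "inv w \<in> W1" using w subgroup.m_inv_closed[OF W1(1)] by (auto simp: W'_def)
    then have "h \<otimes> inv w \<otimes> inv h \<in> W" using W1(4) h by blast
    then have "w \<otimes> (h \<otimes> inv w \<otimes> inv h) \<in> W" using w W'(3) subgroup.m_closed[OF W(1)] by blast
    moreover have "(w \<otimes> h \<otimes> inv w) \<otimes> inv h \<in> R"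
      using R(2) h S(2) c subgroup.m_closed[OF R(1)] subgroup.m_inv_closed[OF R(1)]
      by (auto simp: normalizes_def subset_iff)
    moreover have "w \<otimes> (h \<otimes> inv w \<otimes> inv h) = (w \<otimes> h \<otimes> inv w) \<otimes> inv h"
      using c by (simp add: m_assoc)
    ultimately have "w \<otimes> h \<otimes> inv w \<otimes> inv h \<in> A" by (simp add: A_def)
    then show ?thesis using AN0 by blast
  qed
  \<comment> \<open>[w,h1h2] is the product of [w,h1] and h1[w,h2]h1^-1, and L normalizes N0, so the
    property passes from S to all of L.\<close>
  have comm: "w \<otimes> l \<otimes> inv w \<otimes> inv l \<in> N0" if w: "w \<in> W'" and l: "l \<in> L" for w l
    using l[unfolded L]
  proof (induction rule: generate.induct)
    case one
    have "w \<in> carrier G" using w W'c by auto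
    then show ?case using subgroup.one_closed[OF N0] by simp
  next
    case (incl h)
    show ?case by (rule comm_gen[OF w incl])
  next
    case (inv h)
    have c: "w \<in> carrier G" "h \<in> carrier G" using w inv W'c Sc by auto
    have hL: "h \<in> L" "inv h \<in> L"
      using inv subgroup.m_inv_closed[OF Ls] unfolding L by (auto intro: generate.incl)
    have "inv (w \<otimes> h \<otimes> inv w \<otimes> inv h) \<in> N0"
      using subgroup.m_inv_closed[OF N0 comm_gen[OF w inv]] .
    then have "inv h \<otimes> inv (w \<otimes> h \<otimes> inv w \<otimes> inv h) \<otimes> inv (inv h) \<in> N0"
      using nL hL by (auto simp: normalizes_def)
    moreover have "inv h \<otimes> inv (w \<otimes> h \<otimes> inv w \<otimes> inv h) \<otimes> inv (inv h) = w \<otimes> inv h \<otimes> inv w \<otimes> inv (inv h)"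
      using c by (simp add: group_simps)
    ultimately show ?case by simp
  next
    case (eng h1 h2)
    have hL: "h1 \<in> L" using eng unfolding L by auto
    have c: "w \<in> carrier G" "h1 \<in> carrier G" "h2 \<in> carrier G"
      using w eng W'c generate_in_carrier[OF Sc] by auto
    have "h1 \<otimes> (w \<otimes> h2 \<otimes> inv w \<otimes> inv h2) \<otimes> inv h1 \<in> N0"
      using nL hL eng by (auto simp: normalizes_def)
    then have "(w \<otimes> h1 \<otimes> inv w \<otimes> inv h1) \<otimes> (h1 \<otimes> (w \<otimes> h2 \<otimes> inv w \<otimes> inv h2) \<otimes> inv h1) \<in> N0"
      using eng subgroup.m_closed[OF N0] by blast
    moreover have "(w \<otimes> h1 \<otimes> inv w \<otimes> inv h1) \<otimes> (h1 \<otimes> (w \<otimes> h2 \<otimes> inv w \<otimes> inv h2) \<otimes> inv h1)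
       = w \<otimes> (h1 \<otimes> h2) \<otimes> inv w \<otimes> inv (h1 \<otimes> h2)"
      using c by (simp add: group_simps)
    ultimately show ?case by simp
  qed
  \<comment> \<open>w(lal^-1)w^-1 is the conjugate of l(waw^-1)l^-1 by the commutator [w,l], which
    lies in N0.\<close>
  have nW': "normalizes G W' N0"
    unfolding N0_def
  proof (rule normalizes_on_generate[OF W'c Cc])
    fix w c assume w: "w \<in> W'" and "c \<in> C"
    then obtain l a where c: "l \<in> L" "a \<in> A" "c = l \<otimes> a \<otimes> inv l" by (auto simp: C_def)
    have cc: "w \<in> carrier G" "l \<in> carrier G" "a \<in> carrier G" using w c W'c Lc Ac by auto
    have "w \<otimes> a \<otimes> inv w \<in> A"
      using c w W'(3) R(2) normalizes_self[OF W(1) W'(3)] cc by (auto simp: A_def normalizes_def)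
    then have "l \<otimes> (w \<otimes> a \<otimes> inv w) \<otimes> inv l \<in> N0"
      using c AN0 nL by (auto simp: normalizes_def)
    then have "(w \<otimes> l \<otimes> inv w \<otimes> inv l) \<otimes> (l \<otimes> (w \<otimes> a \<otimes> inv w) \<otimes> inv l) \<otimes> inv (w \<otimes> l \<otimes> inv w \<otimes> inv l) \<in> N0"
      using comm[OF w c(1)] subgroup.m_closed[OF N0] subgroup.m_inv_closed[OF N0] by blast
    moreover have "(w \<otimes> l \<otimes> inv w \<otimes> inv l) \<otimes> (l \<otimes> (w \<otimes> a \<otimes> inv w) \<otimes> inv l) \<otimes> inv (w \<otimes> l \<otimes> inv w \<otimes> inv l)
      = w \<otimes> c \<otimes> inv w"
      using cc c(3) by (simp add: group_simps)
    ultimately show "w \<otimes> c \<otimes> inv w \<in> generate G C" by (simp add: N0_def)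
  qed
  define P where "P = N0 <#> W'"
  have P: "subgroup P G" unfolding P_def by (rule subgroup_set_mult[OF N0 W'(1) nW'])
  have "openin T P" unfolding P_def by (rule openin_set_mult_right[OF W'(2) N0c])
  moreover have "normalizes G L P"
    unfolding normalizes_def
  proof (intro ballI)
    fix l x assume l: "l \<in> L" and "x \<in> P"
    then obtain n w where x: "x = n \<otimes> w" "n \<in> N0" "w \<in> W'" by (auto simp: P_def set_mult_def)
    have cc: "w \<in> carrier G" "l \<in> carrier G" "n \<in> carrier G" using l x W'c Lc N0c by auto
    have "(l \<otimes> n \<otimes> inv l) \<otimes> inv (w \<otimes> l \<otimes> inv w \<otimes> inv l) \<in> N0"
      using comm[OF x(3) l] nL l x subgroup.m_closed[OF N0] subgroup.m_inv_closed[OF N0]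
      by (auto simp: normalizes_def)
    moreover have "l \<otimes> x \<otimes> inv l = ((l \<otimes> n \<otimes> inv l) \<otimes> inv (w \<otimes> l \<otimes> inv w \<otimes> inv l)) \<otimes> w"
      using cc x(1) by (simp add: group_simps)
    ultimately show "l \<otimes> x \<otimes> inv l \<in> P" using x(3) by (auto simp: P_def set_mult_def)
  qed
  \<comment> \<open>The W'-factor of an element of P \<inter> R lies in W \<inter> R = A, hence
    already in N0.\<close>
  moreover have "P \<inter> R \<subseteq> N"
  proof
    fix x assume "x \<in> P \<inter> R"
    then obtain n w where x: "x = n \<otimes> w" "n \<in> N0" "w \<in> W'" "x \<in> R" by (auto simp: P_def set_mult_def)
    have cc: "w \<in> carrier G" "n \<in> carrier G" using x W'c N0c by auto
    have "n \<in> R" using x N0N N(2) by auto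
    then have "inv n \<otimes> x \<in> R" using x subgroup.m_closed[OF R(1)] subgroup.m_inv_closed[OF R(1)] by blast
    then have "w \<in> R" using x(1) cc by (simp add: inv_mult_cancel)
    then have "w \<in> N0" using x W'(3) AN0 by (auto simp: A_def)
    then have "x \<in> N0" using x subgroup.m_closed[OF N0] by blast
    then show "x \<in> N" using N0N by blast
  qed
  ultimately show thesis using that P by blast
qed

text \<open>Each N intersected for R contains P \<inter> R for an open P normalized by the same
  generated group, and P counts in the whole group. Compactness of S enters through the
  thickening.\<close>

lemma residual_in_normal_subgroup:
  assumes R: "subgroup R G" "normalizes G (carrier G) R"
    and S: "compactin T S" "S \<subseteq> R"
  shows "residual_in G T (carrier G) (generate G S) \<inter> R \<subseteq> residual_in G T R (generate G S)"
proof
  fix x assume x: "x \<in> residual_in G T (carrier G) (generate G S) \<inter> R"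
  have "x \<in> N"
    if N: "subgroup N G" "N \<subseteq> R" "openin (subtopology T R) N" "normalizes G (generate G S) N" for N
  proof -
    obtain P where P: "subgroup P G" "openin T P" "normalizes G (generate G S) P" "P \<inter> R \<subseteq> N"
      using thicken_normalized_subgroup[OF R S refl N] by blast
    have "openin (subtopology T (carrier G)) P"
      using P(2) by (simp add: subtopology_carrier)
    then have "x \<in> P"
      using x P(1,3) subgroup.subset[OF P(1)] unfolding residual_in_def by blast
    then show ?thesis using x P(4) by blast
  qed
  then show "x \<in> residual_in G T R (generate G S)" by (auto simp: residual_in_def)
qed

text \<open>The version inside a closed subgroup A in which R is normal. With A open and R the
  residual of A it makes the relative residuals of compactly generated subgroups of R independent of
  the ambient group.\<close>

lemma residual_in_relatively_normal:
  assumes A: "subgroup A G" "closedin T A"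
    and R: "subgroup R G" "R \<subseteq> A" "normalizes G A R"
    and S: "compactin T S" "S \<subseteq> R"
  shows "residual_in G T A (generate G S) \<inter> R = residual_in G T R (generate G S)"
proof
  interpret A: tdlcsc "subgrp G A" "subtopology T A" using closed_subgroup_tdlcsc A by blast
  have SA: "S \<subseteq> A" using R S by blast
  have gen: "generate (subgrp G A) S = generate G S" by (rule generate_consistent[OF SA A(1)])
  have genA: "generate G S \<subseteq> R" by (rule generate_leI[OF R(1) S(2)])
  have "normalizes (subgrp G A) (carrier (subgrp G A)) R" "subgroup R (subgrp G A)"
     "compactin (subtopology T A) S"
    using R A S SA normalizes_subgrp[OF A(1) order_refl, of R] 
    by (auto simp: subgroup_subgrp_iff compactin_subtopology)
  from A.residual_in_normal_subgroup[OF this(2,1,3) S(2)]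
  show "residual_in G T A (generate G S) \<inter> R \<subseteq> residual_in G T R (generate G S)"
    using residual_in_subgrp[OF A(1), of "generate G S" A] residual_in_subgrp[OF A(1), of "generate G S" R]
      genA R(2) by (simp add: gen)
  show "residual_in G T R (generate G S) \<subseteq> residual_in G T A (generate G S) \<inter> R"
    using residual_in_mono_ambient[OF R(1) A(1) R(2) genA] residual_in_subset[OF R(1) genA] by blast
qed

section \<open>Residuals and cocompact normal subgroups\<close>

lemma residual_in_carrier_leI:
  assumes "subgroup P G" "openin T P" "normalizes G (carrier G) P"
  shows "residual_in G T (carrier G) (carrier G) \<subseteq> P"
proof -
  have "openin (subtopology T (carrier G)) P"
    using assms(2) by (simp add: subtopology_carrier)
  then show ?thesis
    using assms subgroup.subset[OF assms(1)] unfolding residual_in_def by blast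
qed

text \<open>The intersection Q of the vPv^-1 over v \<in> V is open by compactness of V, is
  normalized by V by construction, and is normalized by B because V normalizes B. Hence G = BV
  normalizes Q \<subseteq> P.\<close>

lemma residual_le_cocompact_normalized:
  assumes B: "subgroup B G" "normalizes G (carrier G) B"
    and V: "subgroup V G" "compactin T V" and BV: "B <#> V = carrier G"
    and P: "subgroup P G" "openin T P" "normalizes G B P"
  shows "residual_in G T (carrier G) (carrier G) \<subseteq> P"
proof -
  have Bc: "B \<subseteq> carrier G" and Vc: "V \<subseteq> carrier G" and Pc: "P \<subseteq> carrier G"
    using subgroup.subset B(1) V(1) P(1) by auto
  define Q where "Q = {x \<in> carrier G. \<forall>v\<in>V. inv v \<otimes> x \<otimes> v \<in> P}"
  have Q: "subgroup Q G" unfolding Q_def by (rule subgroup_Inter_conj[OF P(1) Vc])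
  have "openin T Q"
  proof -
    obtain W where W: "subgroup W G" "openin T W" "compactin T W"
      "\<And>k w. k \<in> V \<Longrightarrow> w \<in> W \<Longrightarrow> k \<otimes> w \<otimes> inv k \<in> P"
      using conj_tube[OF V(2) P(2) subgroup.one_closed[OF P(1)]] by blast
    have "W \<subseteq> Q"
    proof
      fix w assume w: "w \<in> W"
      have "inv v \<otimes> w \<otimes> v \<in> P" if "v \<in> V" for v
        using W(4)[OF subgroup.m_inv_closed[OF V(1) that] w] that Vc by auto
      then show "w \<in> Q" using w subgroup.subset[OF W(1)] by (auto simp: Q_def)
    qed
    then show ?thesis using openin_subgroupI[OF Q W(2) subgroup.one_closed[OF W(1)]] by blast
  qed
  moreover have "normalizes G (B <#> V) Q"
  proof (rule normalizes_mult[OF Bc Vc subgroup.subset[OF Q]])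
    show "normalizes G V Q"
      unfolding normalizes_def
    proof (intro ballI)
      fix u x assume u: "u \<in> V" and x: "x \<in> Q"
      have c: "u \<in> carrier G" "x \<in> carrier G" using u Vc x by (auto simp: Q_def)
      have "inv v \<otimes> (u \<otimes> x \<otimes> inv u) \<otimes> v \<in> P" if v: "v \<in> V" for v
      proof -
        have vc: "v \<in> carrier G" using v Vc by auto
        have "inv u \<otimes> v \<in> V" using u v subgroup.m_closed[OF V(1)] subgroup.m_inv_closed[OF V(1)] by blast
        then have "inv (inv u \<otimes> v) \<otimes> x \<otimes> (inv u \<otimes> v) \<in> P" using x by (auto simp: Q_def)
        then show ?thesis using c vc by (simp add: group_simps)
      qed
      then show "u \<otimes> x \<otimes> inv u \<in> Q" using c by (auto simp: Q_def)
    qed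
    show "normalizes G B Q"
      unfolding normalizes_def
    proof (intro ballI)
      fix b x assume b: "b \<in> B" and x: "x \<in> Q"
      have c: "b \<in> carrier G" "x \<in> carrier G" using b Bc x by (auto simp: Q_def)
      have "inv v \<otimes> (b \<otimes> x \<otimes> inv b) \<otimes> v \<in> P" if v: "v \<in> V" for v
      proof -
        have vc: "v \<in> carrier G" using v Vc by auto
        \<comment> \<open>Conjugating x by b amounts to conjugating v^-1xv \<in> P by v^-1bv, which
          is again an element of B.\<close>
        have "inv v \<otimes> b \<otimes> inv (inv v) \<in> B"
          using B(2) b inv_closed[OF vc] unfolding normalizes_def by blast
        then have "(inv v \<otimes> b \<otimes> v) \<otimes> (inv v \<otimes> x \<otimes> v) \<otimes> inv (inv v \<otimes> b \<otimes> v) \<in> P"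
          using P(3) x v vc unfolding Q_def normalizes_def by simp
        then show ?thesis using c vc by (simp add: group_simps)
      qed
      then show "b \<otimes> x \<otimes> inv b \<in> Q" using c by (auto simp: Q_def)
    qed
  qed
  ultimately have "residual_in G T (carrier G) (carrier G) \<subseteq> Q"
    using Q BV by (intro residual_in_carrier_leI) auto
  moreover have "Q \<subseteq> P"
  proof
    fix x assume "x \<in> Q"
    then have "x \<in> carrier G" "inv \<one> \<otimes> x \<otimes> \<one> \<in> P"
      using subgroup.one_closed[OF V(1)] unfolding Q_def by blast+
    then show "x \<in> P" by simp
  qed
  ultimately show ?thesis by blast
qed

text \<open>The preceding bound is used twice: with P = BU for small U it forces the residual into
  the closed subgroup B, and with P a thickening of N it forces it into every N that defines the
  residual of B.\<close>

lemma residual_cocompact: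
  assumes B: "subgroup B G" "closedin T B" "normalizes G (carrier G) B"
    and S: "compactin T S" "B = generate G S"
    and V: "subgroup V G" "compactin T V" and BV: "B <#> V = carrier G"
  shows "residual_in G T (carrier G) (carrier G) = residual_in G T B B"
proof
  have Bc: "B \<subseteq> carrier G" using subgroup.subset[OF B(1)] .
  have SB: "S \<subseteq> B" using S generate_superset by blast
  show "residual_in G T (carrier G) (carrier G) \<subseteq> residual_in G T B B"
  proof
    fix x assume x: "x \<in> residual_in G T (carrier G) (carrier G)"
    have xc: "x \<in> carrier G" using x residual_in_subset[OF subgroup_self] by blast
    have xB: "x \<in> B"
    proof (rule ccontr)
      assume nx: "x \<notin> B"
      have "openin T (carrier G - B)" using B(2) by (simp add: openin_diff flip: topspace)
      moreover have "continuous_map T T (\<lambda>w. x \<otimes> w)"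
        using xc by (intro continuous_mult continuous_const) auto
      ultimately have op: "openin T {w \<in> topspace T. x \<otimes> w \<in> carrier G - B}"
        using openin_continuous_map_preimage by fastforce
      have "\<one> \<in> {w \<in> topspace T. x \<otimes> w \<in> carrier G - B}" using xc nx by (simp add: topspace)
      then obtain U where U: "subgroup U G" "openin T U" "U \<subseteq> {w \<in> topspace T. x \<otimes> w \<in> carrier G - B}"
        using van_Dantzig[OF op] by metis
      have Uc: "U \<subseteq> carrier G" using subgroup.subset[OF U(1)] .
      have nU: "normalizes G U B" using B(3) Uc by (auto simp: normalizes_def)
      have P: "subgroup (B <#> U) G" by (rule subgroup_set_mult[OF B(1) U(1) nU])
      have "B \<subseteq> B <#> U"
      proof
        fix b assume "b \<in> B"
        then show "b \<in> B <#> U"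
          using subgroup.one_closed[OF U(1)] Bc by (force simp: set_mult_def)
      qed
      then have "normalizes G B (B <#> U)" by (rule normalizes_self[OF P])
      then have "x \<in> B <#> U"
        using residual_le_cocompact_normalized[OF B(1,3) V BV P openin_set_mult_right[OF U(2) Bc]] x
        by blast
      then obtain b u where bu: "b \<in> B" "u \<in> U" "x = b \<otimes> u" by (auto simp: set_mult_def)
      then have "x \<otimes> inv u = b" using Bc Uc by (auto simp: m_assoc subset_iff)
      then show False using bu subgroup.m_inv_closed[OF U(1)] U(3) by blast
    qed
    have "x \<in> N"
      if N: "subgroup N G" "N \<subseteq> B" "openin (subtopology T B) N" "normalizes G B N" for N
    proof -
      obtain P where P: "subgroup P G" "openin T P" "normalizes G B P" "P \<inter> B \<subseteq> N"
        using thicken_normalized_subgroup[OF B(1,3) S(1) SB S(2) N] by blast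
      then show ?thesis
        using residual_le_cocompact_normalized[OF B(1,3) V BV P(1-3)] x xB by blast
    qed
    then show "x \<in> residual_in G T B B" by (auto simp: residual_in_def)
  qed
  have "residual_in G T B B \<subseteq> residual_in G T (carrier G) B"
    by (rule residual_in_mono_ambient[OF B(1) subgroup_self Bc order_refl])
  also have "\<dots> \<subseteq> residual_in G T (carrier G) (carrier G)"
    by (rule residual_in_mono[OF Bc])
  finally show "residual_in G T B B \<subseteq> residual_in G T (carrier G) (carrier G)" .
qed

text \<open>
  Caprace and Monod: a compactly generated group modulo its discrete residual has a base of
  open normal subgroups. By compactness, some open normal subgroup \<open>N\<close> meets the compact set of
  conjugates \<open>sus\<inverse>\<close> with \<open>s \<in> S\<close>, \<open>u \<in> U\<close> only inside \<open>U\<close>, up to the residual.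
\<close>

lemma residual_open_normal:
  assumes S: "compactin T S" "generate G S = carrier G"
    and U: "subgroup U G" "openin T U" "compactin T U"
  obtains P where "subgroup P G" "openin T P" "normalizes G (carrier G) P"
    "residual_in G T (carrier G) (carrier G) \<subseteq> P"
    "P \<subseteq> U <#> residual_in G T (carrier G) (carrier G)"
proof -
  define R where "R = residual_in G T (carrier G) (carrier G)"
  have R: "subgroup R G" unfolding R_def by (rule residual_in_subgroup[OF subgroup_self order_refl])
  have Rn: "normalizes G (carrier G) R" unfolding R_def by (rule residual_in_normalizes)
  have Rc: "R \<subseteq> carrier G" and Uc: "U \<subseteq> carrier G" and Sc: "S \<subseteq> carrier G"
    using subgroup.subset[OF R] subgroup.subset[OF U(1)] compact_carrier[OF S(1)] by auto
  \<comment> \<open>Invariance of P under conjugation has to be checked for the generators and for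
    their inverses.\<close>
  define S' where "S' = S \<union> (\<lambda>x. inv x) ` S"
  have S': "compactin T S'" unfolding S'_def by (intro compactin_Un S(1) compact_inv)
  define K where "K = (\<lambda>(k, x). k \<otimes> x \<otimes> inv k) ` (S' \<times> U)"
  have K: "compactin T K" unfolding K_def by (rule compact_image2[OF S' U(3) continuous_conj])
  define F where "F = {N. subgroup N G \<and> openin T N \<and> normalizes G (carrier G) N}"
  have RF: "R \<subseteq> N" if "N \<in> F" for N
    using that residual_in_carrier_leI by (auto simp: F_def R_def)
  have capF: "\<Inter>F \<subseteq> R"
  proof
    fix x assume "x \<in> \<Inter>F"
    moreover have "N \<in> F" if "subgroup N G" "openin (subtopology T (carrier G)) N" "normalizes G (carrier G) N" for N
      using that by (simp add: F_def subtopology_carrier)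
    ultimately show "x \<in> R" unfolding R_def residual_in_def by blast
  qed
  \<comment> \<open>An open cover of K: points of R lie in UR, and any other point is missed by some
    open normal N, whose complement is open because N is closed.\<close>
  define \<U> where "\<U> = insert (U <#> R) ((\<lambda>N. carrier G - N) ` F)"
  have "openin T (carrier G - N)" if "N \<in> F" for N
    using that open_subgroup_closed by (auto simp: F_def openin_diff simp flip: topspace)
  then have "\<forall>V\<in>\<U>. openin T V"
    using openin_set_mult_left[OF U(2) Rc] by (auto simp: \<U>_def)
  moreover have "K \<subseteq> \<Union>\<U>"
  proof
    fix x assume x: "x \<in> K"
    have xc: "x \<in> carrier G" using x compact_carrier[OF K] by blast
    show "x \<in> \<Union>\<U>"
    proof (cases "x \<in> R")
      case True
      then have "x \<in> U <#> R"
        using subgroup.one_closed[OF U(1)] Rc by (force simp: set_mult_def)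
      then show ?thesis by (auto simp: \<U>_def)
    next
      case False
      then obtain N where "N \<in> F" "x \<notin> N" using capF by blast
      then show ?thesis using xc by (auto simp: \<U>_def)
    qed
  qed
  ultimately obtain \<F> where \<F>: "finite \<F>" "\<F> \<subseteq> \<U>" "K \<subseteq> \<Union>\<F>"
    using K unfolding compactin_def by metis
  have sub: "\<F> - {U <#> R} \<subseteq> (\<lambda>N. carrier G - N) ` F" using \<F>(2) unfolding \<U>_def by blast
  obtain F0 where F0: "F0 \<subseteq> F" "finite F0" "\<F> - {U <#> R} = (\<lambda>N. carrier G - N) ` F0"
    using finite_subset_image[OF finite_Diff[OF \<F>(1)] sub] by (elim bexE exE conjE)
  \<comment> \<open>The factor \<open>carrier G\<close> covers the case of an empty F0.\<close>
  define N where "N = carrier G \<inter> \<Inter>F0"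
  have N_eq: "N = \<Inter>(insert (carrier G) F0)" by (simp add: N_def)
  have Nsub: "subgroup N G"
    unfolding N_eq using F0(1) subgroup_self by (intro subgroups_Inter) (auto simp: F_def)
  have Nop: "openin T N"
  proof -
    have "openin T (\<Inter>(insert (carrier G) F0))"
    proof (rule openin_Inter)
      fix M assume "M \<in> insert (carrier G) F0"
      then show "openin T M" using F0(1) openin_topspace[of T] by (auto simp: F_def topspace)
    qed (use F0 in auto)
    then show ?thesis by (simp add: N_def)
  qed
  have Nn: "normalizes G (carrier G) N"
    using F0(1) by (auto simp: N_def normalizes_def F_def subset_iff)
  have RN: "R \<subseteq> N" using RF F0(1) Rc by (auto simp: N_def)
  have KN: "K \<inter> N \<subseteq> U <#> R"
  proof
    fix x assume x: "x \<in> K \<inter> N"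
    then obtain V where V: "V \<in> \<F>" "x \<in> V" using \<F> by auto
    show "x \<in> U <#> R"
    proof (rule ccontr)
      assume "x \<notin> U <#> R"
      then have "V \<in> (\<lambda>N. carrier G - N) ` F0" using V F0(3) by blast
      then show False using V x by (auto simp: N_def)
    qed
  qed
  \<comment> \<open>Since R \<subseteq> N, writing an element of K \<inter> N \<subseteq> UR as u'r'
    puts u' into N \<inter> U. This is what makes P invariant under conjugation by S'.\<close>
  define P where "P = (N \<inter> U) <#> R"
  have NU: "subgroup (N \<inter> U) G" by (rule subgroups_Inter_pair[OF Nsub U(1)])
  have "R <#> (N \<inter> U) = P"
  proof -
    have "R \<lhd> G" using R Rn by (simp add: normal_iff_normalizes)
    then show ?thesis unfolding P_def using commut_normal[OF NU] by simp
  qed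
  moreover have "normalizes G (N \<inter> U) R" using Rn Uc by (auto simp: normalizes_def)
  ultimately have P: "subgroup P G" using subgroup_set_mult[OF R NU] by simp
  have "openin T P" unfolding P_def
    by (rule openin_set_mult_left[OF openin_Int[OF Nop U(2)] Rc])
  moreover have step: "s \<otimes> x \<otimes> inv s \<in> P" if s: "s \<in> S'" and x: "x \<in> P" for s x
  proof -
    obtain u r where ur: "u \<in> N" "u \<in> U" "r \<in> R" "x = u \<otimes> r" using x by (auto simp: P_def set_mult_def)
    have c: "s \<in> carrier G" "u \<in> carrier G" "r \<in> carrier G" using s ur compact_carrier[OF S'] Uc Rc by auto
    have "s \<otimes> u \<otimes> inv s \<in> K" using s ur by (force simp: K_def)
    moreover have sN: "s \<otimes> u \<otimes> inv s \<in> N" using Nn ur c by (auto simp: normalizes_def)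
    ultimately have "s \<otimes> u \<otimes> inv s \<in> U <#> R" using KN by blast
    then obtain u' r' where u': "u' \<in> U" "r' \<in> R" "s \<otimes> u \<otimes> inv s = u' \<otimes> r'" by (auto simp: set_mult_def)
    have c': "u' \<in> carrier G" "r' \<in> carrier G" using u' Uc Rc by auto
    have "(s \<otimes> u \<otimes> inv s) \<otimes> inv r' \<in> N"
      using sN u' RN subgroup.m_closed[OF Nsub] subgroup.m_inv_closed[OF Nsub] by blast
    then have "u' \<in> N" using u'(3) c' by (simp add: m_assoc)
    moreover have "r' \<otimes> (s \<otimes> r \<otimes> inv s) \<in> R"
      using u' ur Rn c subgroup.m_closed[OF R] by (auto simp: normalizes_def)
    moreover have "s \<otimes> x \<otimes> inv s = (s \<otimes> u \<otimes> inv s) \<otimes> (s \<otimes> r \<otimes> inv s)"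
      using c ur(4) by (simp add: group_simps)
    then have "s \<otimes> x \<otimes> inv s = u' \<otimes> (r' \<otimes> (s \<otimes> r \<otimes> inv s))"
      using u'(3) c c' by (simp add: group_simps)
    ultimately show ?thesis using u'(1) by (auto simp: P_def set_mult_def)
  qed
  have "normalizes G (carrier G) P"
  proof -
    have "normalizes G (generate G S) P"
    proof (rule normalizes_generate[OF Sc subgroup.subset[OF P]])
      show "normalizes G S P" using step by (auto simp: normalizes_def S'_def)
      fix s x assume "s \<in> S" "x \<in> P"
      then show "inv s \<otimes> x \<otimes> s \<in> P" using step[of "inv s" x] Sc by (auto simp: S'_def)
    qed
    then show ?thesis using S(2) by simp
  qed
  moreover have "R \<subseteq> P"
  proof
    fix r assume "r \<in> R"
    then show "r \<in> P" using subgroup.one_closed[OF NU] Rc by (force simp: P_def set_mult_def)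
  qed
  moreover have "P \<subseteq> U <#> R" by (auto simp: P_def set_mult_def)
  ultimately show thesis using that P unfolding R_def by blast
qed

end

section \<open>Decomposable groups\<close>

abbreviation residual :: "('a, 'b) monoid_scheme \<Rightarrow> 'a topology \<Rightarrow> 'a set \<Rightarrow> 'a set" where
  "residual G T A \<equiv> residual_in G T A A"

text \<open>Taking all compactly generated open subgroups avoids the choice of an exhaustion. The
  base case is separate because the trivial group is its own residual: \<open>step\<close> alone
  would admit no group at all.\<close>

inductive decomposable :: "'a monoid \<Rightarrow> 'a topology \<Rightarrow> bool" where
  trivial: "\<lbrakk>tdlcsc_group G T; carrier G = {\<one>\<^bsub>G\<^esub>}\<rbrakk> \<Longrightarrow> decomposable G T"
| step:
    "\<lbrakk>tdlcsc_group G T;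
      \<And>C. \<lbrakk>compactin T C; openin T (generate G C)\<rbrakk> \<Longrightarrow>
        decomposable (subgrp G (residual G T (generate G C)))
          (subtopology T (residual G T (generate G C)))\<rbrakk>
      \<Longrightarrow> decomposable G T"

lemma decomposable_tdlcsc: "decomposable G T \<Longrightarrow> tdlcsc_group G T"
  by (erule decomposable.cases) auto

context tdlcsc
begin

lemma generate_compact_subgroup: "compactin T C \<Longrightarrow> subgroup (generate G C) G"
  using generate_is_subgroup compact_carrier by blast

text \<open>Adjoining a compact open subgroup to C makes the generated subgroup open.\<close>

lemma compact_in_open_generate:
  assumes "compactin T C"
  obtains D where "compactin T D" "C \<subseteq> D" "openin T (generate G D)"
proof -
  obtain U where U: "subgroup U G" "openin T U" "compactin T U"
    using van_Dantzig[OF openin_carrier one_closed] by blast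
  let ?D = "C \<union> U"
  have D: "compactin T ?D" using assms U(3) by (rule compactin_Un)
  have "openin T (generate G ?D)"
    by (rule openin_subgroupI[OF generate_compact_subgroup[OF D] U(2) subgroup.one_closed[OF U(1)]])
       (use generate_superset in blast)
  then show thesis using that[OF D] by blast
qed

lemma residual_closed_subgroup:
  assumes "subgroup A G" "closedin T A"
  shows "subgroup (residual G T A) G" "closedin T (residual G T A)" "residual G T A \<subseteq> A"
  using residual_in_subgroup[OF assms(1) order_refl] residual_in_closed[OF assms order_refl]
    residual_in_subset[OF assms(1) order_refl] by auto

lemma residual_trivialI:
  assumes A: "subgroup A G" and "\<And>x. x \<in> A \<Longrightarrow> x \<noteq> \<one> \<Longrightarrow>
     \<exists>N. subgroup N G \<and> N \<subseteq> A \<and> openin (subtopology T A) N \<and> normalizes G A N \<and> x \<notin> N"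
  shows "residual G T A = {\<one>}"
proof
  show "residual G T A \<subseteq> {\<one>}"
  proof
    fix x assume x: "x \<in> residual G T A"
    then have "x \<in> A" using residual_in_subset[OF A order_refl] by blast
    then show "x \<in> {\<one>}" using assms(2) x unfolding residual_in_def by blast
  qed
  show "{\<one>} \<subseteq> residual G T A"
    using subgroup.one_closed[OF residual_in_subgroup[OF A order_refl]] by auto
qed

lemma trivial_closed_subgroup: "subgroup {\<one>} G" "closedin T {\<one>}"
proof -
  show "subgroup {\<one>} G" by (rule triv_subgroup)
  have "compactin T {\<one>}" by (simp add: topspace)
  then show "closedin T {\<one>}" by (rule compact_closed)
qed

lemma decomposable_one: "decomposable (subgrp G {\<one>}) (subtopology T {\<one>})"
  by (rule decomposable.trivial[OF tdlcsc_subgroup[OF trivial_closed_subgroup]]) simp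

text \<open>Conjugation by m maps A continuously into A, and the preimage of an N that counts for
  the residual of A counts as well.\<close>

lemma normalizes_residual:
  assumes M: "subgroup M G" and A: "subgroup A G" and n: "normalizes G M A"
  shows "normalizes G M (residual G T A)"
  unfolding normalizes_def
proof (intro ballI)
  fix m x assume m: "m \<in> M" and x: "x \<in> residual G T A"
  have Ac: "A \<subseteq> carrier G" using subgroup.subset[OF A] .
  have mc: "m \<in> carrier G" using m subgroup.subset[OF M] by blast
  have xA: "x \<in> A" using x residual_in_subset[OF A order_refl] by blast
  have "m \<otimes> x \<otimes> inv m \<in> N"
    if N: "subgroup N G" "N \<subseteq> A" "openin (subtopology T A) N" "normalizes G A N" for N
  proof -
    let ?N = "{y \<in> A. m \<otimes> y \<otimes> inv m \<in> N}"
    have 1: "subgroup ?N G"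
    proof (rule subgroupI)
      show "?N \<subseteq> carrier G" using Ac by auto
      show "?N \<noteq> {}" using mc subgroup.one_closed[OF A] subgroup.one_closed[OF N(1)] by (auto intro!: exI[of _ \<one>])
    next
      fix a assume a: "a \<in> ?N"
      then have "inv (m \<otimes> a \<otimes> inv m) \<in> N" using subgroup.m_inv_closed[OF N(1)] by blast
      moreover have "a \<in> carrier G" using a Ac by auto
      ultimately show "inv a \<in> ?N" using a mc subgroup.m_inv_closed[OF A] by (simp add: group_simps)
    next
      fix a b assume a: "a \<in> ?N" and b: "b \<in> ?N"
      then have "(m \<otimes> a \<otimes> inv m) \<otimes> (m \<otimes> b \<otimes> inv m) \<in> N" using subgroup.m_closed[OF N(1)] by blast
      moreover have "a \<in> carrier G" "b \<in> carrier G" using a b Ac by auto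
      ultimately show "a \<otimes> b \<in> ?N" using a b mc subgroup.m_closed[OF A] by (simp add: group_simps)
    qed
    have 2: "openin (subtopology T A) ?N"
    proof -
      have "continuous_map T T (\<lambda>y. m \<otimes> y \<otimes> inv m)"
        using mc by (intro continuous_mult continuous_const) auto
      then have "continuous_map (subtopology T A) (subtopology T A) (\<lambda>y. m \<otimes> y \<otimes> inv m)"
        using n m by (auto simp: continuous_map_in_subtopology continuous_map_from_subtopology normalizes_def)
      from openin_continuous_map_preimage[OF this N(3)] show ?thesis
        using Ac topspace by (simp add: topspace_subtopology Int_absorb1)
    qed
    have 3: "normalizes G A ?N"
      unfolding normalizes_def
    proof (intro ballI)
      fix k y assume k: "k \<in> A" and y: "y \<in> ?N"
      have c: "k \<in> carrier G" "y \<in> carrier G" using k y Ac by auto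
      have "m \<otimes> k \<otimes> inv m \<in> A" using n m k by (auto simp: normalizes_def)
      then have "(m \<otimes> k \<otimes> inv m) \<otimes> (m \<otimes> y \<otimes> inv m) \<otimes> inv (m \<otimes> k \<otimes> inv m) \<in> N"
        using N(4) y by (auto simp: normalizes_def)
      moreover have "(m \<otimes> k \<otimes> inv m) \<otimes> (m \<otimes> y \<otimes> inv m) \<otimes> inv (m \<otimes> k \<otimes> inv m)
         = m \<otimes> (k \<otimes> y \<otimes> inv k) \<otimes> inv m" using c mc by (simp add: group_simps)
      moreover have "k \<otimes> y \<otimes> inv k \<in> A"
        using k y normalizes_self[OF A order_refl] by (auto simp: normalizes_def)
      ultimately show "k \<otimes> y \<otimes> inv k \<in> ?N" by simp
    qed
    have "x \<in> ?N" using x 1 2 3 unfolding residual_in_def by blast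
    then show ?thesis by blast
  qed
  then show "m \<otimes> x \<otimes> inv m \<in> residual G T A" by (auto simp: residual_in_def)
qed

end

section \<open>Decomposability along continuous homomorphisms\<close>

locale tdlcsc_hom = D: tdlcsc G T + C: tdlcsc H S
  for G :: "'a monoid" and T and H :: "'b monoid" and S +
  fixes f :: "'a \<Rightarrow> 'b"
  assumes hom: "f \<in> hom G H" and cont: "continuous_map T S f"
begin

sublocale group_hom G H f
  by unfold_locales (rule hom)

lemma preimage_subgroup:
  assumes A: "subgroup A G" and N: "subgroup N H"
  shows "subgroup {x \<in> A. f x \<in> N} G"
proof (rule D.subgroupI)
  have Ac: "A \<subseteq> carrier G" using subgroup.subset[OF A] .
  show "{x \<in> A. f x \<in> N} \<subseteq> carrier G" using Ac by auto
  show "{x \<in> A. f x \<in> N} \<noteq> {}"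
    using subgroup.one_closed[OF A] subgroup.one_closed[OF N] hom_one by auto
  fix a assume a: "a \<in> {x \<in> A. f x \<in> N}"
  then show "inv\<^bsub>G\<^esub> a \<in> {x \<in> A. f x \<in> N}"
    using Ac subgroup.m_inv_closed[OF A] subgroup.m_inv_closed[OF N] by auto
  fix b assume b: "b \<in> {x \<in> A. f x \<in> N}"
  show "a \<otimes>\<^bsub>G\<^esub> b \<in> {x \<in> A. f x \<in> N}"
    using a b Ac subgroup.m_closed[OF A] subgroup.m_closed[OF N] by (auto simp: subset_iff)
qed

text \<open>The preimage in A of a subgroup intersected for B is one of those intersected for
  A.\<close>

lemma residual_image:
  assumes A: "subgroup A G" and B: "subgroup B H" and AB: "f ` A \<subseteq> B"
  shows "f ` residual G T A \<subseteq> residual H S B"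
proof clarify
  fix x assume x: "x \<in> residual G T A"
  have Ac: "A \<subseteq> carrier G" and Bc: "B \<subseteq> carrier H" using subgroup.subset A B by auto
  have "f x \<in> N"
    if N: "subgroup N H" "N \<subseteq> B" "openin (subtopology S B) N" "normalizes H B N" for N
  proof -
    let ?N = "{y \<in> A. f y \<in> N}"
    have 2: "openin (subtopology T A) ?N"
    proof -
      have "continuous_map (subtopology T A) (subtopology S B) f"
        using AB by (auto simp: continuous_map_in_subtopology continuous_map_from_subtopology cont)
      from openin_continuous_map_preimage[OF this N(3)] show ?thesis
        using Ac D.topspace by (simp add: topspace_subtopology Int_absorb1)
    qed
    have "normalizes G A ?N"
      unfolding normalizes_def
    proof (intro ballI)
      fix k y assume k: "k \<in> A" and y: "y \<in> ?N"
      have c: "k \<in> carrier G" "y \<in> carrier G" using k y Ac by auto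
      have "f k \<otimes>\<^bsub>H\<^esub> f y \<otimes>\<^bsub>H\<^esub> inv\<^bsub>H\<^esub> f k \<in> N"
        using N(4) k y AB unfolding normalizes_def by blast
      moreover have "f (k \<otimes>\<^bsub>G\<^esub> y \<otimes>\<^bsub>G\<^esub> inv\<^bsub>G\<^esub> k) = f k \<otimes>\<^bsub>H\<^esub> f y \<otimes>\<^bsub>H\<^esub> inv\<^bsub>H\<^esub> f k"
        using c by simp
      moreover have "k \<otimes>\<^bsub>G\<^esub> y \<otimes>\<^bsub>G\<^esub> inv\<^bsub>G\<^esub> k \<in> A"
        using k y D.normalizes_self[OF A order_refl] by (auto simp: normalizes_def)
      ultimately show "k \<otimes>\<^bsub>G\<^esub> y \<otimes>\<^bsub>G\<^esub> inv\<^bsub>G\<^esub> k \<in> ?N" by simp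
    qed
    then have "x \<in> ?N" using x 2 preimage_subgroup[OF A N(1)] unfolding residual_in_def by blast
    then show ?thesis by blast
  qed
  then show "f x \<in> residual H S B" by (auto simp: residual_in_def)
qed

lemma restrict_hom:
  assumes A: "subgroup A G" "closedin T A" and B: "subgroup B H" "closedin S B" and AB: "f ` A \<subseteq> B"
  shows "tdlcsc_hom (subgrp G A) (subtopology T A) (subgrp H B) (subtopology S B) f"
proof -
  have "f \<in> hom (subgrp G A) (subgrp H B)"
    using AB subgroup.subset[OF A(1)] by (auto simp: hom_def subset_iff image_subset_iff)
  moreover have "continuous_map (subtopology T A) (subtopology S B) f"
    using AB by (auto simp: continuous_map_in_subtopology continuous_map_from_subtopology cont)
  ultimately show ?thesis
    using D.closed_subgroup_tdlcsc[OF A] C.closed_subgroup_tdlcsc[OF B]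
    by (simp add: tdlcsc_hom_def tdlcsc_hom_axioms_def)
qed

end

text \<open>Induction on the target: an open subgroup of G generated by a compact set maps into one
  of H, residuals map into residuals, and once the target is trivial, what is left of G is a closed
  subgroup killed by f. Closed subgroups, copies on another carrier and extensions are all
  instances.\<close>

lemma decomposable_by_kernel:
  assumes "decomposable H S" "tdlcsc_hom G T H S f"
    and "\<And>K. \<lbrakk>subgroup K G; closedin T K; \<forall>x\<in>K. f x = \<one>\<^bsub>H\<^esub>\<rbrakk> \<Longrightarrow> decomposable (subgrp G K) (subtopology T K)"
  shows "decomposable G T"
  using assms
proof (induction arbitrary: G T rule: decomposable.induct)
  case (trivial H S)
  interpret tdlcsc_hom G T H S f by fact
  have "\<forall>x\<in>carrier G. f x = \<one>\<^bsub>H\<^esub>" using trivial.hyps(2) hom_closed by blast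
  moreover have "closedin T (carrier G)" by (rule D.closedin_carrier)
  ultimately have "decomposable (subgrp G (carrier G)) (subtopology T (carrier G))"
    using trivial.prems(2) D.subgroup_self by blast
  then show ?case by (simp add: D.subtopology_carrier)
next
  case (step H S)
  interpret tdlcsc_hom G T H S f by fact
  show ?case
  proof (rule decomposable.step)
    show "tdlcsc_group G T" by (rule D.tdlcsc_group)
  next
    fix A assume A: "compactin T A" "openin T (generate G A)"
    let ?E = "generate G A"
    have E: "subgroup ?E G" by (rule D.generate_compact_subgroup[OF A(1)])
    have Ec: "closedin T ?E" by (rule D.open_subgroup_closed[OF E A(2)])
    \<comment> \<open>f is not assumed to be open, so the image of A must be enlarged before it
      generates an open subgroup of H.\<close>
    obtain B where B: "compactin S B" "f ` A \<subseteq> B" "openin S (generate H B)"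
      using C.compact_in_open_generate[OF image_compactin[OF A(1) cont]] .
    let ?F = "generate H B"
    have F: "subgroup ?F H" by (rule C.generate_compact_subgroup[OF B(1)])
    have Fc: "closedin S ?F" by (rule C.open_subgroup_closed[OF F B(3)])
    have EF: "f ` ?E \<subseteq> ?F"
      using generate_img[of A] D.compact_carrier[OF A(1)] B(2)
        C.generate_leI[OF F, of "f ` A"] C.generate_superset[of B] by simp
    let ?R = "residual G T ?E" and ?R' = "residual H S ?F"
    note R = D.residual_closed_subgroup[OF E Ec] and R' = C.residual_closed_subgroup[OF F Fc]
    have RR: "f ` ?R \<subseteq> ?R'" by (rule residual_image[OF E F EF])
    interpret R: tdlcsc "subgrp G ?R" "subtopology T ?R" by (rule D.closed_subgroup_tdlcsc[OF R(1,2)])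
    show "decomposable (subgrp G ?R) (subtopology T ?R)"
    proof (rule step.IH[OF B(1,3)])
      show "tdlcsc_hom (subgrp G ?R) (subtopology T ?R) (subgrp H ?R') (subtopology S ?R') f"
        by (rule restrict_hom[OF R(1,2) R'(1,2) RR])
    next
      fix K assume K: "subgroup K (subgrp G ?R)" "closedin (subtopology T ?R) K"
        "\<forall>x\<in>K. f x = \<one>\<^bsub>subgrp H ?R'\<^esub>"
      have K': "subgroup K G" "K \<subseteq> ?R" using K(1) D.subgroup_subgrp_iff[OF R(1)] by auto
      have "closedin T K" using K(2) R(2) closedin_trans_full by blast
      then have "decomposable (subgrp G K) (subtopology T K)" using step.prems(2) K' K(3) by simp
      then show "decomposable (subgrp (subgrp G ?R) K) (subtopology (subtopology T ?R) K)"
        using K' by (simp add: subtopology_subtopology Int_absorb1)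
    qed
  qed
qed

lemma decomposable_inj:
  assumes "decomposable H S" "tdlcsc_hom G T H S f" "inj_on f (carrier G)"
  shows "decomposable G T"
proof -
  interpret tdlcsc_hom G T H S f by fact
  show ?thesis
  proof (rule decomposable_by_kernel[OF assms(1,2)])
    fix K assume K: "subgroup K G" "\<forall>x\<in>K. f x = \<one>\<^bsub>H\<^esub>"
    have "K \<subseteq> {\<one>\<^bsub>G\<^esub>}"
    proof
      fix x assume "x \<in> K"
      then have "x \<in> carrier G" "f x = f \<one>\<^bsub>G\<^esub>" using K subgroup.subset[OF K(1)] by auto
      then show "x \<in> {\<one>\<^bsub>G\<^esub>}" using assms(3) inj_onD[OF assms(3)] D.one_closed by blast
    qed
    then have "K = {\<one>\<^bsub>G\<^esub>}" using subgroup.one_closed[OF K(1)] by blast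
    then show "decomposable (subgrp G K) (subtopology T K)" using D.decomposable_one by simp
  qed
qed

lemma decomposable_closed_subgroup:
  assumes "decomposable G T" "subgroup A G" "closedin T A"
  shows "decomposable (subgrp G A) (subtopology T A)"
proof -
  interpret tdlcsc G T using decomposable_tdlcsc[OF assms(1)] by (simp add: tdlcsc_iff)
  have "tdlcsc_hom (subgrp G A) (subtopology T A) G T (\<lambda>x. x)"
    using closed_subgroup_tdlcsc[OF assms(2,3)] tdlcsc_axioms subgroup.subset[OF assms(2)]
    by (auto simp: tdlcsc_hom_def tdlcsc_hom_axioms_def hom_def continuous_map_from_subtopology)
  then show ?thesis by (rule decomposable_inj[OF assms(1)]) simp
qed

lemma decomposable_closed_subgroup_mono:
  assumes "tdlcsc_group G T" "decomposable (subgrp G B) (subtopology T B)"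
    and A: "subgroup A G" "closedin T A" and B: "subgroup B G" "A \<subseteq> B"
  shows "decomposable (subgrp G A) (subtopology T A)"
proof -
  interpret tdlcsc G T using assms(1) by (simp add: tdlcsc_iff)
  have "closedin (subtopology T B) A" using A(2) B(2) by (simp add: closedin_subset_topspace)
  moreover have "subgroup A (subgrp G B)" using A B by (simp add: subgroup_subgrp_iff)
  ultimately have "decomposable (subgrp (subgrp G B) A) (subtopology (subtopology T B) A)"
    using decomposable_closed_subgroup[OF assms(2)] by blast
  then show ?thesis using B(2) by (simp add: subtopology_subtopology Int_absorb1)
qed

lemma decomposable_extension:
  assumes "decomposable H S" "tdlcsc_hom G T H S f"
    and "decomposable (subgrp G N) (subtopology T N)" and N: "subgroup N G"
    and "\<And>x. x \<in> carrier G \<Longrightarrow> f x = \<one>\<^bsub>H\<^esub> \<Longrightarrow> x \<in> N"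
  shows "decomposable G T"
proof -
  interpret tdlcsc_hom G T H S f by fact
  show ?thesis
  proof (rule decomposable_by_kernel[OF assms(1,2)])
    fix K assume K: "subgroup K G" "closedin T K" "\<forall>x\<in>K. f x = \<one>\<^bsub>H\<^esub>"
    then have "K \<subseteq> N" using assms(5) subgroup.subset[OF K(1)] by blast
    then show "decomposable (subgrp G K) (subtopology T K)"
      by (rule decomposable_closed_subgroup_mono[OF D.tdlcsc_group assms(3) K(1,2) N])
  qed
qed

context tdlcsc
begin

lemma decomposable_discrete:
  assumes "T = discrete_topology (carrier G)"
  shows "decomposable G T"
proof (rule decomposable.step[OF tdlcsc_group])
  fix C assume C: "compactin T C" "openin T (generate G C)"
  let ?E = "generate G C"
  have E: "subgroup ?E G" by (rule generate_compact_subgroup[OF C(1)])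
  have "residual G T ?E = {\<one>}"
  proof (rule residual_trivialI[OF E])
    fix x assume "x \<in> ?E" "x \<noteq> \<one>"
    have 1: "{\<one>} \<subseteq> ?E" using subgroup.one_closed[OF E] by auto
    have "openin (subtopology T ?E) {\<one>}"
      using 1 subgroup.subset[OF E] unfolding assms by (simp add: Int_absorb1)
    moreover have "normalizes G ?E {\<one>}" using subgroup.subset[OF E] by (auto simp: normalizes_def)
    ultimately show "\<exists>N. subgroup N G \<and> N \<subseteq> ?E \<and> openin (subtopology T ?E) N \<and> normalizes G ?E N \<and> x \<notin> N"
      using 1 triv_subgroup \<open>x \<noteq> \<one>\<close> by blast
  qed
  then show "decomposable (subgrp G (residual G T ?E)) (subtopology T (residual G T ?E))"
    using decomposable_one by simp
qed

text \<open>The cocompact bound with B = {1} and V the whole group: every open subgroup contains the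
  residual, and open subgroups separate points from 1.\<close>

lemma residual_compact:
  assumes "compact_space T"
  shows "residual G T (carrier G) = {\<one>}"
proof
  have cc: "compactin T (carrier G)" using assms by (simp add: compact_space_def topspace)
  have n1: "normalizes G (carrier G) {\<one>}" by (simp add: normalizes_def)
  have m1: "{\<one>} <#> carrier G = carrier G" by (auto simp: set_mult_def)
  show "residual G T (carrier G) \<subseteq> {\<one>}"
  proof (rule subsetI, rule ccontr)
    fix x assume x: "x \<in> residual G T (carrier G)" "x \<notin> {\<one>}"
    have xc: "x \<in> carrier G" using x residual_in_subset[OF subgroup_self order_refl] by blast
    have x1: "x \<noteq> \<one>" using x(2) by simp
    obtain U where U: "subgroup U G" "openin T U" "x \<notin> U"
      using open_subgroup_avoiding[OF xc x1] .
    have nU: "normalizes G {\<one>} U" using subgroup.subset[OF U(1)] by (auto simp: normalizes_def)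
    have "residual G T (carrier G) \<subseteq> U"
      by (rule residual_le_cocompact_normalized[OF triv_subgroup n1 subgroup_self cc m1 U(1,2) nU])
    then show False using x(1) U(3) by blast
  qed
  show "{\<one>} \<subseteq> residual G T (carrier G)"
    using subgroup.one_closed[OF residual_in_subgroup[OF subgroup_self order_refl]] by blast
qed

lemma residual_compact_subgroup:
  assumes E: "subgroup E G" "compactin T E"
  shows "residual G T E = {\<one>}"
proof -
  interpret E: tdlcsc "subgrp G E" "subtopology T E"
    by (rule closed_subgroup_tdlcsc[OF E(1) compact_closed[OF E(2)]])
  have "compact_space (subtopology T E)" using E(2) by (simp add: compact_space_subtopology)
  then show ?thesis using E.residual_compact residual_in_subgrp[OF E(1) order_refl order_refl] by simp
qed

lemma decomposable_compact:
  assumes "compact_space T"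
  shows "decomposable G T"
proof (rule decomposable.step[OF tdlcsc_group])
  fix C assume C: "compactin T C" "openin T (generate G C)"
  let ?E = "generate G C"
  have E: "subgroup ?E G" by (rule generate_compact_subgroup[OF C(1)])
  have "compactin T ?E"
    using assms open_subgroup_closed[OF E C(2)] closedin_compact_space by blast
  then have "residual G T ?E = {\<one>}" by (rule residual_compact_subgroup[OF E])
  then show "decomposable (subgrp G (residual G T ?E)) (subtopology T (residual G T ?E))"
    using decomposable_one by simp
qed

lemma compact_in_increasing_union:
  assumes U: "incseq U" "(\<Union>i. U i) = carrier G" "\<And>i::nat. openin T (U i)" and C: "compactin T C"
  obtains i where "C \<subseteq> U i"
proof -
  have "C \<subseteq> \<Union>(range U)" using compact_carrier[OF C] U(2) by simp
  then obtain \<F> where F: "finite \<F>" "\<F> \<subseteq> range U" "C \<subseteq> \<Union>\<F>"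
    using C U(3) unfolding compactin_def by (metis rangeE)
  obtain I where I: "finite I" "\<F> = U ` I" using finite_subset_image[OF F(1,2)] by auto
  obtain m where m: "\<forall>i\<in>I. i \<le> m" using I(1) finite_nat_set_iff_bounded_le by blast
  have "C \<subseteq> U m"
  proof
    fix x assume "x \<in> C"
    then obtain i where "i \<in> I" "x \<in> U i" using F(3) I(2) by auto
    then show "x \<in> U m" using m U(1) incseqD by blast
  qed
  then show thesis by (rule that)
qed

text \<open>A compact C already lies in some \<open>U i\<close>, and with it the generated subgroup
  and its residual.\<close>

lemma decomposable_increasing_union:
  assumes U: "incseq U" "(\<Union>i. U i) = carrier G" "\<And>i::nat. subgroup (U i) G" "\<And>i. openin T (U i)"
    and dec: "\<And>i. decomposable (subgrp G (U i)) (subtopology T (U i))"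
  shows "decomposable G T"
proof (rule decomposable.step[OF tdlcsc_group])
  fix C assume C: "compactin T C" "openin T (generate G C)"
  let ?E = "generate G C"
  have E: "subgroup ?E G" by (rule generate_compact_subgroup[OF C(1)])
  note R = residual_closed_subgroup[OF E open_subgroup_closed[OF E C(2)]]
  obtain i where i: "C \<subseteq> U i" using compact_in_increasing_union[OF U(1,2,4) C(1)] .
  have "?E \<subseteq> U i" by (rule generate_leI[OF U(3) i])
  have RU: "residual G T ?E \<subseteq> U i" using R(3) \<open>?E \<subseteq> U i\<close> by blast
  show "decomposable (subgrp G (residual G T ?E)) (subtopology T (residual G T ?E))"
    by (rule decomposable_closed_subgroup_mono[OF tdlcsc_group dec R(1,2) U(3) RU])
qed

end

text \<open>Countably many cosets of a compact open subgroup W cover G by the Lindelof property;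
  \<open>U i\<close> is generated by W and the representatives up to index i.\<close>

lemma (in tdlcsc) exhaustion:
  obtains U :: "nat \<Rightarrow> 'a set" where "incseq U" "(\<Union>i. U i) = carrier G"
    "\<forall>i. subgroup (U i) G" "\<forall>i. openin T (U i)" "\<forall>i. \<exists>C. compactin T C \<and> generate G C = U i"
proof -
  obtain W where W: "subgroup W G" "openin T W" "compactin T W"
    using van_Dantzig[OF openin_carrier one_closed] by blast
  have W1: "x \<in> x <# W" if "x \<in> carrier G" for x
    using subgroup.one_closed[OF W(1)] that by (force simp: l_coset_def)
  define \<W> where "\<W> = (\<lambda>x. x <# W) ` carrier G"
  have opW: "openin T V" if "V \<in> \<W>" for V
    using that openin_l_coset[OF W(2)] unfolding \<W>_def by blast
  have cov: "\<Union>\<W> = topspace T"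
  proof
    show "\<Union>\<W> \<subseteq> topspace T" using opW openin_subset by blast
    show "topspace T \<subseteq> \<Union>\<W>" using W1 by (auto simp: topspace \<W>_def)
  qed
  have "\<exists>\<V>. countable \<V> \<and> \<V> \<subseteq> \<W> \<and> \<Union>\<V> = topspace T"
    by (rule Lindelof_spaceD[OF second_countable_imp_Lindelof_space[OF second_countable] opW cov])
  then obtain \<V> where V: "countable \<V>" "\<V> \<subseteq> \<W>" "\<Union>\<V> = topspace T"
    by (elim exE conjE)
  have "\<exists>D. countable D \<and> D \<subseteq> carrier G \<and> \<V> = (\<lambda>x. x <# W) ` D"
    by (rule countable_subset_image[THEN iffD1]) (use V(1,2) in \<open>simp add: \<W>_def\<close>)
  then obtain D where D: "countable D" "D \<subseteq> carrier G" "\<V> = (\<lambda>x. x <# W) ` D"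
    by (elim exE conjE)
  have Dne: "D \<noteq> {}" using V(3) D(3) topspace one_closed by fastforce
  define d where "d = from_nat_into D"
  have dr: "range d = D" using range_from_nat_into[OF Dne D(1)] by (simp add: d_def)
  define C where "C i = W \<union> d ` {..i}" for i
  have C: "compactin T (C i)" for i
    unfolding C_def using dr D(2) topspace by (intro compactin_Un W(3) finite_imp_compactin) auto
  define U where "U i = generate G (C i)" for i
  have sub: "subgroup (U i) G" for i unfolding U_def by (rule generate_compact_subgroup[OF C])
  have CU: "C i \<subseteq> U i" for i unfolding U_def by (rule generate_superset)
  have op: "openin T (U i)" for i
    by (rule openin_subgroupI[OF sub W(2) subgroup.one_closed[OF W(1)]]) (use CU in \<open>auto simp: C_def\<close>)
  have inc: "incseq U"
  proof (rule incseq_SucI)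
    fix i
    have "C i \<subseteq> C (Suc i)" by (auto simp: C_def)
    then show "U i \<subseteq> U (Suc i)" unfolding U_def by (rule mono_generate)
  qed
  have "carrier G \<subseteq> (\<Union>i. U i)"
  proof
    fix x assume "x \<in> carrier G"
    then obtain y where "y \<in> D" "x \<in> y <# W" using V(3) D(3) topspace by blast
    then obtain i w where iw: "w \<in> W" "x = d i \<otimes> w" using dr by (auto simp: l_coset_def)
    have "d i \<in> U i" "w \<in> U i" using CU[of i] iw by (auto simp: C_def)
    then have "x \<in> U i" using subgroup.m_closed[OF sub] iw by blast
    then show "x \<in> (\<Union>i. U i)" by blast
  qed
  then have "(\<Union>i. U i) = carrier G" using subgroup.subset[OF sub] by blast
  moreover have "\<exists>C. compactin T C \<and> generate G C = U i" for i using C U_def by blast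
  ultimately show thesis using that[OF inc] sub op by simp
qed

section \<open>Quotients of decomposable groups\<close>

context tdlcsc
begin

lemma closure_subgroup:
  assumes A: "subgroup A G"
  shows "subgroup (T closure_of A) G"
proof (rule subgroupI)
  have Ac: "A \<subseteq> carrier G" using subgroup.subset[OF A] .
  have AT: "A \<subseteq> T closure_of A" using Ac by (simp add: closure_of_subset topspace)
  show sub: "T closure_of A \<subseteq> carrier G" using closure_of_subset_topspace[of T A] topspace by simp
  show "T closure_of A \<noteq> {}" using AT subgroup.one_closed[OF A] by blast
  have "(\<lambda>x. inv x) ` (T closure_of A) \<subseteq> T closure_of ((\<lambda>x. inv x) ` A)"
    by (rule continuous_map_image_closure_subset[OF cont_inv])
  also have "\<dots> \<subseteq> T closure_of A"
    using subgroup.m_inv_closed[OF A] by (intro closure_of_mono) auto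
  finally show "\<And>a. a \<in> T closure_of A \<Longrightarrow> inv a \<in> T closure_of A" by blast
  have "(\<lambda>(x, y). x \<otimes> y) ` (prod_topology T T closure_of (A \<times> A)) \<subseteq> T closure_of ((\<lambda>(x, y). x \<otimes> y) ` (A \<times> A))"
    by (rule continuous_map_image_closure_subset[OF cont_mult])
  also have "\<dots> \<subseteq> T closure_of A"
    using subgroup.m_closed[OF A] by (intro closure_of_mono) auto
  finally have *: "(\<lambda>(x, y). x \<otimes> y) ` ((T closure_of A) \<times> (T closure_of A)) \<subseteq> T closure_of A"
    by (simp add: closure_of_Times)
  fix a b assume "a \<in> T closure_of A" "b \<in> T closure_of A"
  then have "(\<lambda>(x, y). x \<otimes> y) (a, b) \<in> (\<lambda>(x, y). x \<otimes> y) ` ((T closure_of A) \<times> (T closure_of A))" by blast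
  then show "a \<otimes> b \<in> T closure_of A" using * by auto
qed

end

context tdlcsc_hom
begin

text \<open>
  The preimage in \<open>V\<close> of the complement of \<open>f ` (V \<inter> P)\<close> is closed, hence compact.
\<close>

lemma closedin_image_compact_diff:
  assumes V: "subgroup V G" "compactin T V" and P: "subgroup P G" "openin (subtopology T V) (V \<inter> P)"
  shows "closedin S (f ` V - f ` (V \<inter> P))"
proof -
  have Vc: "V \<subseteq> carrier G" using subgroup.subset[OF V(1)] .
  interpret V: tdlcsc "subgrp G V" "subtopology T V"
    by (rule D.closed_subgroup_tdlcsc[OF V(1) D.compact_closed[OF V(2)]])
  define K where "K = {x \<in> V. f x = \<one>\<^bsub>H\<^esub>}"
  \<comment> \<open>A is the preimage in V of f(V \<inter> P); it is a union of translates of V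
    \<inter> P, hence open in V.\<close>
  define A where "A = (V \<inter> P) <#>\<^bsub>G\<^esub> K"
  have "openin (subtopology T V) ((V \<inter> P) <#>\<^bsub>subgrp G V\<^esub> K)"
    by (rule V.openin_set_mult_left[OF P(2)]) (auto simp: K_def)
  then have "openin (subtopology T V) A" by (simp add: A_def set_mult_def)
  then have "closedin (subtopology T V) (V - A)"
    using V.closedin_carrier by (simp add: closedin_diff)
  moreover have "compact_space (subtopology T V)" using V(2) by (simp add: compact_space_subtopology)
  ultimately have "compactin (subtopology T V) (V - A)" using closedin_compact_space by blast
  then have "compactin T (V - A)" by (simp add: compactin_subtopology)
  then have "closedin S (f ` (V - A))" using image_compactin[OF _ cont] C.compact_closed by blast
  moreover have "f ` (V - A) = f ` V - f ` (V \<inter> P)"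
  proof -
    have *: "(\<exists>p\<in>V \<inter> P. f x = f p) \<longleftrightarrow> x \<in> A" if x: "x \<in> V" for x
    proof
      assume "\<exists>p\<in>V \<inter> P. f x = f p"
      then obtain p where p: "p \<in> V" "p \<in> P" "f x = f p" by auto
      have c: "x \<in> carrier G" "p \<in> carrier G" using x p Vc by auto
      have "inv\<^bsub>G\<^esub> p \<otimes>\<^bsub>G\<^esub> x \<in> K"
        using p x c subgroup.m_closed[OF V(1)] subgroup.m_inv_closed[OF V(1)] by (simp add: K_def)
      moreover have "p \<otimes>\<^bsub>G\<^esub> (inv\<^bsub>G\<^esub> p \<otimes>\<^bsub>G\<^esub> x) = x" using c by (simp add: D.inv_mult_cancel)
      ultimately show "x \<in> A" unfolding A_def set_mult_def using p by force
    next
      assume "x \<in> A"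
      then obtain p k where "p \<in> V \<inter> P" "k \<in> K" "x = p \<otimes>\<^bsub>G\<^esub> k" by (auto simp: A_def set_mult_def)
      moreover have "f (p \<otimes>\<^bsub>G\<^esub> k) = f p" using calculation Vc by (auto simp: K_def subset_iff)
      ultimately show "\<exists>p\<in>V \<inter> P. f x = f p" by auto
    qed
    show ?thesis
    proof (intro equalityI subsetI)
      fix y assume "y \<in> f ` (V - A)"
      then obtain x where x: "x \<in> V" "x \<notin> A" "y = f x" by blast
      then have "y \<notin> f ` (V \<inter> P)" using *[OF x(1)] x(2,3) by auto
      then show "y \<in> f ` V - f ` (V \<inter> P)" using x by blast
    next
      fix y assume y: "y \<in> f ` V - f ` (V \<inter> P)"
      then obtain x where x: "x \<in> V" "y = f x" by blast
      have "x \<notin> A" using *[OF x(1)] x(2) y by auto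
      then show "y \<in> f ` (V - A)" using x by blast
    qed
  qed
  ultimately show ?thesis by simp
qed

text \<open>
  The compact group \<open>V\<close> supplies the open part of \<open>closure (f ` R)\<close> that \<open>f ` R\<close>
  itself may miss.
\<close>

lemma decomposable_image_closure:
  assumes "decomposable (subgrp G R) (subtopology T R)" "subgroup R G" "closedin T R"
    "subgroup V G" "compactin T V" "normalizes G V R"
    "openin (subtopology S (S closure_of (f ` R))) (f ` V \<inter> S closure_of (f ` R))"
  shows "decomposable (subgrp H (S closure_of (f ` R))) (subtopology S (S closure_of (f ` R)))"
  using assms
proof (induction "subgrp G R" "subtopology T R" arbitrary: R V rule: decomposable.induct)
  case (trivial R V)
  have "R = {\<one>\<^bsub>G\<^esub>}" using trivial.hyps(2) by simp
  then have "S closure_of (f ` R) = {\<one>\<^bsub>H\<^esub>}"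
    using C.trivial_closed_subgroup(2) by (simp add: closure_of_closedin)
  then show ?case using C.decomposable_one by simp
next
  case (step R V)
  note R = step.prems(1,2) and V = step.prems(3,4) and VR = step.prems(5)
  have Rc: "R \<subseteq> carrier G" and Vc: "V \<subseteq> carrier G"
    using subgroup.subset[OF R(1)] subgroup.subset[OF V(1)] by auto
  define R' where "R' = S closure_of (f ` R)"
  have R': "subgroup R' H" "closedin S R'"
    unfolding R'_def using C.closure_subgroup[OF subgroup_img_is_subgroup[OF R(1)]] by auto
  have R'c: "R' \<subseteq> carrier H" using subgroup.subset[OF R'(1)] .
  have fR: "f ` R \<subseteq> R'"
    unfolding R'_def using Rc C.topspace by (intro closure_of_subset) auto
  have VR': "openin (subtopology S R') (f ` V \<inter> R')" using step.prems(6) unfolding R'_def .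
  interpret R: tdlcsc "subgrp G R" "subtopology T R" by (rule D.closed_subgroup_tdlcsc[OF R])
  interpret R': tdlcsc "subgrp H R'" "subtopology S R'" by (rule C.closed_subgroup_tdlcsc[OF R'])
  \<comment> \<open>The part of V that f maps into R': its image f(V) \<inter> R' is compact and
    open in R', and it still normalizes R.\<close>
  define V2 where "V2 = {v \<in> V. f v \<in> R'}"
  have V2: "subgroup V2 G" unfolding V2_def by (rule preimage_subgroup[OF V(1) R'(1)])
  have V2V: "V2 \<subseteq> V" and V2c: "V2 \<subseteq> carrier G" using Vc by (auto simp: V2_def)
  have fV2: "f ` V2 = f ` V \<inter> R'" by (auto simp: V2_def)
  have V2comp: "compactin T V2"
  proof -
    have "closedin T {v \<in> topspace T. f v \<in> R'}"
      using closedin_continuous_map_preimage[OF cont R'(2)] .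
    then have "closedin T ({v \<in> topspace T. f v \<in> R'} \<inter> V)"
      using D.compact_closed[OF V(2)] by blast
    moreover have "{v \<in> topspace T. f v \<in> R'} \<inter> V = V2" using Vc D.topspace by (auto simp: V2_def)
    ultimately show ?thesis using closed_compactin[OF V(2) V2V] by simp
  qed
  have fV2s: "subgroup (f ` V2) H" by (rule subgroup_img_is_subgroup[OF V2])
  have fV2op: "openin (subtopology S R') (f ` V2)" using VR' fV2 by simp
  have "decomposable (subgrp H R') (subtopology S R')"
  proof (rule decomposable.step[OF R'.tdlcsc_group])
    fix C assume C: "compactin (subtopology S R') C" "openin (subtopology S R') (generate (subgrp H R') C)"
    have CR': "C \<subseteq> R'" using R'.compact_carrier[OF C(1)] by simp
    have Cc: "C \<subseteq> carrier H" using CR' R'c by blast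
    define E where "E = generate H C"
    have Egen: "generate (subgrp H R') C = E"
      unfolding E_def by (rule C.generate_consistent[OF CR' R'(1)])
    have E: "subgroup E H" unfolding E_def by (rule C.generate_is_subgroup[OF Cc])
    have ER': "E \<subseteq> R'" unfolding E_def by (rule C.generate_leI[OF R'(1) CR'])
    have Eop: "openin (subtopology S R') E" using C(2) Egen by simp
    have Ecl: "closedin S E" by (rule C.closed_rel_open_subgroup[OF R' E ER' Eop])
    \<comment> \<open>f(R) is dense in R', so the cosets f(r)f(V2) with r \<in> R cover C, and
      finitely many of them suffice.\<close>
    obtain F where F: "finite F" "F \<subseteq> R" "C \<subseteq> (\<Union>r\<in>F. f r <#\<^bsub>H\<^esub> (f ` V2))"
    proof -
      let ?W = "\<lambda>r. f r <#\<^bsub>H\<^esub> (f ` V2)"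
      have op: "openin (subtopology S R') (?W r)" if "r \<in> R" for r
        using R'.openin_l_coset[OF fV2op, of "f r"] that fR by (auto simp: l_coset_def)
      have "C \<subseteq> \<Union>(?W ` R)"
      proof
        fix c assume c: "c \<in> C"
        have cR: "c \<in> R'" and cc: "c \<in> carrier H" using c CR' Cc by auto
        have "openin (subtopology S R') (c <#\<^bsub>subgrp H R'\<^esub> (f ` V2))"
          using R'.openin_l_coset[OF fV2op, of c] cR by simp
        then obtain A where A: "openin S A" "c <#\<^bsub>H\<^esub> (f ` V2) = A \<inter> R'"
          by (auto simp: openin_subtopology l_coset_def)
        have "c \<otimes>\<^bsub>H\<^esub> f \<one>\<^bsub>G\<^esub> \<in> c <#\<^bsub>H\<^esub> (f ` V2)"
          using subgroup.one_closed[OF V2] unfolding l_coset_def by blast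
        then have "c \<in> A" using cc A by simp
        then have "A \<inter> f ` R \<noteq> {}"
          using cR A(1) unfolding R'_def in_closure_of by blast
        then obtain r where r: "r \<in> R" "f r \<in> A" by blast
        then have "f r \<in> c <#\<^bsub>H\<^esub> (f ` V2)" using A(2) fR by blast
        then obtain v where v: "v \<in> V2" "f r = c \<otimes>\<^bsub>H\<^esub> f v" by (auto simp: l_coset_def)
        have "f r \<otimes>\<^bsub>H\<^esub> f (inv\<^bsub>G\<^esub> v) = c"
          using v cc V2c by (auto simp: C.m_assoc subset_iff)
        moreover have "inv\<^bsub>G\<^esub> v \<in> V2" using v subgroup.m_inv_closed[OF V2] by blast
        ultimately have "c \<in> ?W r" by (force simp: l_coset_def)
        then show "c \<in> \<Union>(?W ` R)" using r by blast
      qed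
      moreover have "\<forall>U\<in>?W ` R. openin (subtopology S R') U" using op by blast
      ultimately obtain \<F> where \<F>: "finite \<F>" "\<F> \<subseteq> ?W ` R" "C \<subseteq> \<Union>\<F>"
        using C(1) unfolding compactin_def by meson
      obtain F where "F \<subseteq> R" "finite F" "\<F> = ?W ` F"
        using finite_subset_image[OF \<F>(1,2)] by (elim bexE exE conjE)
      then show thesis using that \<F>(3) by blast
    qed
    obtain U where U: "subgroup U G" "openin T U" "compactin T U"
      using D.van_Dantzig[OF D.openin_carrier D.one_closed] by blast
    \<comment> \<open>F makes f(BV2) contain C, U \<inter> R makes B open in R, and closing under
      V2-conjugation makes B normalized by V2 while C2 stays compact.\<close>
    define C2 where "C2 = (\<lambda>(v, x). v \<otimes>\<^bsub>G\<^esub> x \<otimes>\<^bsub>G\<^esub> inv\<^bsub>G\<^esub> v) ` (V2 \<times> (F \<union> (U \<inter> R)))"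
    have C2comp: "compactin T C2"
    proof -
      have "compactin T F" using F(1,2) Rc D.topspace by (intro finite_imp_compactin) auto
      moreover have "compactin T (U \<inter> R)"
        using closed_Int_compactin[OF R(2) U(3)] by (simp add: Int_commute)
      ultimately have "compactin T (F \<union> (U \<inter> R))" by (rule compactin_Un)
      then show ?thesis unfolding C2_def by (rule D.compact_image2[OF V2comp _ D.continuous_conj])
    qed
    have C2R: "C2 \<subseteq> R"
      using VR V2V F(2) by (auto simp: C2_def normalizes_def)
    have C2c: "C2 \<subseteq> carrier G" using C2R Rc by blast
    define B where "B = generate G C2"
    have B: "subgroup B G" unfolding B_def by (rule D.generate_is_subgroup[OF C2c])
    have BR: "B \<subseteq> R" unfolding B_def by (rule D.generate_leI[OF R(1) C2R])
    have Bc: "B \<subseteq> carrier G" using BR Rc by blast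
    have Bgen: "generate (subgrp G R) C2 = B" unfolding B_def by (rule D.generate_consistent[OF C2R R(1)])
    have inC2: "x \<in> C2" if "x \<in> F \<union> (U \<inter> R)" for x
    proof -
      have "(\<lambda>(v, x). v \<otimes>\<^bsub>G\<^esub> x \<otimes>\<^bsub>G\<^esub> inv\<^bsub>G\<^esub> v) (\<one>\<^bsub>G\<^esub>, x) \<in> C2"
        unfolding C2_def using subgroup.one_closed[OF V2] that by blast
      moreover have "x \<in> carrier G" using that F(2) Rc by auto
      ultimately show ?thesis by simp
    qed
    have FB: "F \<union> (U \<inter> R) \<subseteq> B" using inC2 D.generate_superset unfolding B_def by blast
    have Bop: "openin (subtopology T R) B"
    proof (rule R.openin_subgroupI[where w = "\<one>\<^bsub>G\<^esub>" and W = "U \<inter> R"])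
      show "subgroup B (subgrp G R)" using B BR by (simp add: D.subgroup_subgrp_iff[OF R(1)])
      show "openin (subtopology T R) (U \<inter> R)" using U(2) by (auto simp: openin_subtopology)
      show "\<one>\<^bsub>G\<^esub> \<in> U \<inter> R" using subgroup.one_closed[OF U(1)] subgroup.one_closed[OF R(1)] by blast
      show "U \<inter> R \<subseteq> B" using FB by blast
    qed
    have Bcl: "closedin T B" by (rule D.closed_rel_open_subgroup[OF R B BR Bop])
    have V2B: "normalizes G V2 B"
      unfolding B_def
    proof (rule D.normalizes_on_generate[OF V2c C2c])
      fix k c assume k: "k \<in> V2" and "c \<in> C2"
      then obtain v x where c: "v \<in> V2" "x \<in> F \<union> (U \<inter> R)" "c = v \<otimes>\<^bsub>G\<^esub> x \<otimes>\<^bsub>G\<^esub> inv\<^bsub>G\<^esub> v"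
        by (auto simp: C2_def)
      have xc: "x \<in> carrier G" "v \<in> carrier G" "k \<in> carrier G" using c k F(2) Rc V2c by auto
      have "k \<otimes>\<^bsub>G\<^esub> v \<in> V2" using k c subgroup.m_closed[OF V2] by blast
      then have "(\<lambda>(v, x). v \<otimes>\<^bsub>G\<^esub> x \<otimes>\<^bsub>G\<^esub> inv\<^bsub>G\<^esub> v) (k \<otimes>\<^bsub>G\<^esub> v, x) \<in> C2"
        unfolding C2_def using c by blast
      moreover have "k \<otimes>\<^bsub>G\<^esub> c \<otimes>\<^bsub>G\<^esub> inv\<^bsub>G\<^esub> k = (\<lambda>(v, x). v \<otimes>\<^bsub>G\<^esub> x \<otimes>\<^bsub>G\<^esub> inv\<^bsub>G\<^esub> v) (k \<otimes>\<^bsub>G\<^esub> v, x)"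
        using xc c(3) by (simp add: D.group_simps)
      ultimately show "k \<otimes>\<^bsub>G\<^esub> c \<otimes>\<^bsub>G\<^esub> inv\<^bsub>G\<^esub> k \<in> generate G C2" using D.generate_superset by auto
    qed
    define R2 where "R2 = residual G T B"
    have R2: "subgroup R2 G" "closedin T R2" "R2 \<subseteq> B"
      unfolding R2_def using D.residual_closed_subgroup[OF B Bcl] by auto
    have R2c: "R2 \<subseteq> carrier G" using R2(3) Bc by blast
    define R2' where "R2' = S closure_of (f ` R2)"
    have R2': "subgroup R2' H" "closedin S R2'"
      unfolding R2'_def using C.closure_subgroup[OF subgroup_img_is_subgroup[OF R2(1)]] by auto
    have fR2: "f ` R2 \<subseteq> R2'"
      unfolding R2'_def using R2c C.topspace by (intro closure_of_subset) auto
    have R2R': "R2' \<subseteq> R'" unfolding R2'_def R'_def using R2(3) BR by (intro closure_of_mono) auto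
    \<comment> \<open>R2 precedes R in the induction, and V2 does for R2 what V does for R: it
      normalizes R2, and f(V2) is open in R', which contains R2'.\<close>
    have dec2: "decomposable (subgrp H R2') (subtopology S R2')"
      unfolding R2'_def
    proof (rule step.hyps(3)[of C2 R2 V2])
      show "compactin (subtopology T R) C2" using C2comp C2R by (simp add: compactin_subtopology)
      show "openin (subtopology T R) (generate (subgrp G R) C2)" using Bop Bgen by simp
      have res: "residual (subgrp G R) (subtopology T R) B = R2"
        unfolding R2_def by (rule D.residual_in_subgrp[OF R(1) order_refl BR])
      show "subgrp (subgrp G R) (residual (subgrp G R) (subtopology T R) (generate (subgrp G R) C2)) = subgrp G R2"
        unfolding Bgen res by simp
      show "subtopology (subtopology T R) (residual (subgrp G R) (subtopology T R) (generate (subgrp G R) C2)) = subtopology T R2"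
        unfolding Bgen res using R2(3) BR by (simp add: subtopology_subtopology Int_absorb1)
      show "normalizes G V2 R2" unfolding R2_def by (rule D.normalizes_residual[OF V2 B V2B])
      have "openin (subtopology (subtopology S R') R2') (R2' \<inter> f ` V2)"
        by (rule openin_subtopology_Int2[OF fV2op])
      then show "openin (subtopology S (S closure_of f ` R2)) (f ` V2 \<inter> S closure_of f ` R2)"
        using R2R' unfolding R2'_def[symmetric] by (simp add: subtopology_subtopology Int_absorb1 Int_commute)
    qed (use R2 V2 V2comp in auto)
    \<comment> \<open>f(B) need not contain E, but f(BV2) does, and BV2 is still closed and
      compactly generated.\<close>
    define M where "M = B <#>\<^bsub>G\<^esub> V2"
    have M: "subgroup M G" unfolding M_def by (rule D.subgroup_set_mult[OF B V2 V2B])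
    have Mcl: "closedin T M" unfolding M_def by (rule D.closed_set_mult_compact[OF Bcl V2comp])
    have Mc: "M \<subseteq> carrier G" using subgroup.subset[OF M] .
    have BM: "B \<subseteq> M"
    proof
      fix b assume "b \<in> B"
      then show "b \<in> M" using subgroup.one_closed[OF V2] Bc by (force simp: M_def set_mult_def)
    qed
    have V2M: "V2 \<subseteq> M"
    proof
      fix v assume "v \<in> V2"
      then show "v \<in> M" using subgroup.one_closed[OF B] V2c by (force simp: M_def set_mult_def)
    qed
    have nMB: "normalizes G M B"
      unfolding M_def by (rule D.normalizes_mult[OF Bc V2c Bc D.normalizes_self[OF B order_refl] V2B])
    interpret M: tdlcsc "subgrp G M" "subtopology T M" by (rule D.closed_subgroup_tdlcsc[OF M Mcl])
    have C2M: "C2 \<subseteq> M" using BM D.generate_superset unfolding B_def by blast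
    \<comment> \<open>B is closed, compactly generated and normal in M = BV2 with V2 compact, so
      adjoining V2 leaves the residual unchanged.\<close>
    have resM: "residual G T M = R2"
    proof -
      have "residual_in (subgrp G M) (subtopology T M) (carrier (subgrp G M)) (carrier (subgrp G M))
          = residual_in (subgrp G M) (subtopology T M) B B"
      proof (rule M.residual_cocompact)
        show "subgroup B (subgrp G M)" using B BM by (simp add: D.subgroup_subgrp_iff[OF M])
        show "closedin (subtopology T M) B" using Bcl BM by (simp add: closedin_subset_topspace)
        show "normalizes (subgrp G M) (carrier (subgrp G M)) B"
          using nMB by (simp add: D.normalizes_subgrp[OF M])
        show "compactin (subtopology T M) C2" using C2comp C2M by (simp add: compactin_subtopology)
        show "B = generate (subgrp G M) C2" unfolding B_def using D.generate_consistent[OF C2M M] by simp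
        show "subgroup V2 (subgrp G M)" using V2 V2M by (simp add: D.subgroup_subgrp_iff[OF M])
        show "compactin (subtopology T M) V2" using V2comp V2M by (simp add: compactin_subtopology)
        show "B <#>\<^bsub>subgrp G M\<^esub> V2 = carrier (subgrp G M)" by (simp add: M_def set_mult_def)
      qed
      then show ?thesis
        using D.residual_in_subgrp[OF M order_refl order_refl] D.residual_in_subgrp[OF M order_refl BM]
        by (simp add: R2_def)
    qed
    have EM: "E \<subseteq> f ` M"
      unfolding E_def
    proof (rule C.generate_leI[OF subgroup_img_is_subgroup[OF M]], rule subsetI)
      fix c assume "c \<in> C"
      then obtain r v where rv: "r \<in> F" "v \<in> V2" "c = f r \<otimes>\<^bsub>H\<^esub> f v"
        using F(3) by (auto simp: l_coset_def)
      have "r \<otimes>\<^bsub>G\<^esub> v \<in> M" using rv FB by (auto simp: M_def set_mult_def)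
      moreover have "f (r \<otimes>\<^bsub>G\<^esub> v) = c" using rv F(2) Rc V2c by (auto simp: subset_iff)
      ultimately show "c \<in> f ` M" by blast
    qed
    \<comment> \<open>For y outside R2' choose B' with B'y off R2', and an open normal P of M inside
      U1R2 with f(U1) \<subseteq> B'. The trace f(P) \<inter> E is open and normal in E and so
      contains y, yet f(P) \<subseteq> B'R2' does not.\<close>
    have "residual H S E \<subseteq> R2'"
    proof
      fix y assume y: "y \<in> residual H S E"
      have yE: "y \<in> E" using y C.residual_in_subset[OF E order_refl] by blast
      have yc: "y \<in> carrier H" using yE ER' R'c by blast
      show "y \<in> R2'"
      proof (rule ccontr)
        assume ny: "y \<notin> R2'"
        have "openin S (carrier H - R2')" using R2'(2) by (simp add: openin_diff flip: C.topspace)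
        moreover have "continuous_map S S (\<lambda>w. w \<otimes>\<^bsub>H\<^esub> y)"
          using yc by (intro C.continuous_mult C.continuous_const) auto
        ultimately have op: "openin S {w \<in> topspace S. w \<otimes>\<^bsub>H\<^esub> y \<in> carrier H - R2'}"
          using openin_continuous_map_preimage by fastforce
        have "\<one>\<^bsub>H\<^esub> \<in> {w \<in> topspace S. w \<otimes>\<^bsub>H\<^esub> y \<in> carrier H - R2'}" using yc ny by (simp add: C.topspace)
        then obtain B' where B': "subgroup B' H" "openin S B'" "B' \<subseteq> {w \<in> topspace S. w \<otimes>\<^bsub>H\<^esub> y \<in> carrier H - R2'}"
          using C.van_Dantzig[OF op] by blast
        have "openin T {x \<in> topspace T. f x \<in> B'}" using openin_continuous_map_preimage[OF cont B'(2)] .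
        then have op': "openin (subtopology T M) (M \<inter> {x \<in> topspace T. f x \<in> B'})"
          by (rule openin_subtopology_Int2)
        have "\<one>\<^bsub>subgrp G M\<^esub> \<in> M \<inter> {x \<in> topspace T. f x \<in> B'}"
          using subgroup.one_closed[OF M] subgroup.one_closed[OF B'(1)] by (simp add: D.topspace)
        then obtain U1 where U1: "subgroup U1 (subgrp G M)" "openin (subtopology T M) U1"
          "compactin (subtopology T M) U1" "U1 \<subseteq> M \<inter> {x \<in> topspace T. f x \<in> B'}"
          using M.van_Dantzig[OF op'] by blast
        have CV: "C2 \<union> V2 \<subseteq> M" using C2M V2M by blast
        have genM: "generate (subgrp G M) (C2 \<union> V2) = carrier (subgrp G M)"
        proof -
          have "generate G (C2 \<union> V2) = M"
          proof
            show "generate G (C2 \<union> V2) \<subseteq> M" by (rule D.generate_leI[OF M CV])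
            show "M \<subseteq> generate G (C2 \<union> V2)"
            proof
              fix m assume "m \<in> M"
              then obtain b v where bv: "b \<in> B" "v \<in> V2" "m = b \<otimes>\<^bsub>G\<^esub> v" by (auto simp: M_def set_mult_def)
              have "b \<in> generate G (C2 \<union> V2)"
                using bv(1) D.mono_generate[of C2 "C2 \<union> V2"] unfolding B_def by blast
              moreover have "v \<in> generate G (C2 \<union> V2)" using bv(2) by (auto intro: generate.incl)
              ultimately show "m \<in> generate G (C2 \<union> V2)" unfolding bv(3) by (rule generate.eng)
            qed
          qed
          then show ?thesis using D.generate_consistent[OF CV M] by simp
        qed
        have CVcomp: "compactin (subtopology T M) (C2 \<union> V2)"
          using C2comp V2comp CV by (simp add: compactin_subtopology compactin_Un)
        obtain P where P: "subgroup P (subgrp G M)" "openin (subtopology T M) P"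
          "normalizes (subgrp G M) (carrier (subgrp G M)) P"
          "residual_in (subgrp G M) (subtopology T M) (carrier (subgrp G M)) (carrier (subgrp G M)) \<subseteq> P"
          "P \<subseteq> U1 <#>\<^bsub>subgrp G M\<^esub> residual_in (subgrp G M) (subtopology T M) (carrier (subgrp G M)) (carrier (subgrp G M))"
          using M.residual_open_normal[OF CVcomp genM U1(1-3)] .
        have Ps: "subgroup P G" "P \<subseteq> M" using P(1) D.subgroup_subgrp_iff[OF M] by auto
        have Pn: "normalizes G M P" using P(3) by (simp add: D.normalizes_subgrp[OF M])
        have PU: "P \<subseteq> U1 <#>\<^bsub>G\<^esub> R2"
          using P(5) D.residual_in_subgrp[OF M order_refl order_refl] resM by (simp add: set_mult_def)
        let ?N = "f ` P \<inter> E"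
        have N: "subgroup ?N H" by (rule C.subgroups_Inter_pair[OF subgroup_img_is_subgroup[OF Ps(1)] E])
        have Nn: "normalizes H E ?N"
          unfolding normalizes_def
        proof (intro ballI)
          fix k z assume k: "k \<in> E" and z: "z \<in> ?N"
          obtain m where m: "m \<in> M" "k = f m" using k EM by blast
          obtain p where p: "p \<in> P" "z = f p" using z by blast
          have "m \<otimes>\<^bsub>G\<^esub> p \<otimes>\<^bsub>G\<^esub> inv\<^bsub>G\<^esub> m \<in> P" using Pn m p by (auto simp: normalizes_def)
          moreover have "f (m \<otimes>\<^bsub>G\<^esub> p \<otimes>\<^bsub>G\<^esub> inv\<^bsub>G\<^esub> m) = k \<otimes>\<^bsub>H\<^esub> z \<otimes>\<^bsub>H\<^esub> inv\<^bsub>H\<^esub> k"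
            using m p Mc Ps(2) by (auto simp: subset_iff)
          ultimately have "k \<otimes>\<^bsub>H\<^esub> z \<otimes>\<^bsub>H\<^esub> inv\<^bsub>H\<^esub> k \<in> f ` P" by (metis imageI)
          moreover have "k \<otimes>\<^bsub>H\<^esub> z \<otimes>\<^bsub>H\<^esub> inv\<^bsub>H\<^esub> k \<in> E"
            using k z C.normalizes_self[OF E order_refl] by (auto simp: normalizes_def)
          ultimately show "k \<otimes>\<^bsub>H\<^esub> z \<otimes>\<^bsub>H\<^esub> inv\<^bsub>H\<^esub> k \<in> ?N" by blast
        qed
        \<comment> \<open>f need not be open; that f(V2 \<inter> P) is open in R' comes from the
          compactness of V2 together with f(V2) being open in R'.\<close>
        have "openin (subtopology S E) ?N"
        proof -
          have "openin (subtopology T V2) (V2 \<inter> P)"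
          proof -
            have "openin (subtopology (subtopology T M) V2) (V2 \<inter> P)" by (rule openin_subtopology_Int2[OF P(2)])
            then show ?thesis using V2M by (simp add: subtopology_subtopology Int_absorb1)
          qed
          then have "closedin S (f ` V2 - f ` (V2 \<inter> P))"
            by (rule closedin_image_compact_diff[OF V2 V2comp Ps(1)])
          then have "closedin (subtopology S R') (f ` V2 - f ` (V2 \<inter> P))"
            using fV2 by (intro closedin_subset_topspace) auto
          then have "openin (subtopology S R') (f ` V2 - (f ` V2 - f ` (V2 \<inter> P)))"
            using fV2op openin_diff by blast
          moreover have "f ` V2 - (f ` V2 - f ` (V2 \<inter> P)) = f ` (V2 \<inter> P)" by auto
          ultimately have "openin (subtopology S R') (f ` (V2 \<inter> P))" by simp
          then have "openin (subtopology (subtopology S R') E) (E \<inter> f ` (V2 \<inter> P))"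
            by (rule openin_subtopology_Int2)
          then have o: "openin (subtopology S E) (E \<inter> f ` (V2 \<inter> P))"
            using ER' by (simp add: subtopology_subtopology Int_absorb1)
          interpret E: tdlcsc "subgrp H E" "subtopology S E" by (rule C.closed_subgroup_tdlcsc[OF E Ecl])
          show ?thesis
          proof (rule E.openin_subgroupI[OF _ o])
            show "subgroup ?N (subgrp H E)" using N by (simp add: C.subgroup_subgrp_iff[OF E])
            have "f \<one>\<^bsub>G\<^esub> \<in> f ` (V2 \<inter> P)" using subgroup.one_closed[OF V2] subgroup.one_closed[OF Ps(1)] by blast
            then show "\<one>\<^bsub>H\<^esub> \<in> E \<inter> f ` (V2 \<inter> P)" using subgroup.one_closed[OF E] by simp
          qed auto
        qed
        then have "y \<in> ?N" using y N Nn unfolding residual_in_def by blast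
        then obtain p where p: "p \<in> P" "y = f p" by blast
        then obtain u r where ur: "u \<in> U1" "r \<in> R2" "p = u \<otimes>\<^bsub>G\<^esub> r" using PU by (auto simp: set_mult_def)
        have uc: "u \<in> carrier G" "r \<in> carrier G" "f u \<in> B'" using ur U1(4) Mc R2c by auto
        have "inv\<^bsub>H\<^esub> (f u) \<otimes>\<^bsub>H\<^esub> y = f r" using p ur uc by (simp add: C.inv_mult_cancel)
        moreover have "inv\<^bsub>H\<^esub> (f u) \<in> B'" using uc subgroup.m_inv_closed[OF B'(1)] by blast
        ultimately have "f r \<notin> R2'" using B'(3) by auto
        then show False using fR2 ur by blast
      qed
    qed
    then have "decomposable (subgrp H (residual H S E)) (subtopology S (residual H S E))"
      using decomposable_closed_subgroup_mono[OF C.tdlcsc_group dec2 _ _ R2'(1)]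
        C.residual_closed_subgroup[OF E Ecl] by blast
    moreover have "residual (subgrp H R') (subtopology S R') E = residual H S E"
      by (rule C.residual_in_subgrp[OF R'(1) order_refl ER'])
    moreover have "residual H S E \<subseteq> R'"
      using C.residual_closed_subgroup(3)[OF E Ecl] ER' by blast
    ultimately show "decomposable (subgrp (subgrp H R') (residual (subgrp H R') (subtopology S R') (generate (subgrp H R') C)))
        (subtopology (subtopology S R') (residual (subgrp H R') (subtopology S R') (generate (subgrp H R') C)))"
      unfolding Egen by (simp add: subtopology_subtopology Int_absorb1)
  qed
  then show ?case unfolding R'_def .
qed

text \<open>Here R is all of G and V is any compact open subgroup: f(V) is open because f is, and
  f(G) = H is its own closure.\<close>

lemma decomposable_quotient:
  assumes "decomposable G T" "open_map T S f" "f ` carrier G = carrier H"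
  shows "decomposable H S"
proof -
  obtain U where U: "subgroup U G" "openin T U" "compactin T U"
    using D.van_Dantzig[OF D.openin_carrier D.one_closed] by blast
  have cl: "S closure_of (f ` carrier G) = carrier H"
    using assms(3) C.closedin_carrier by (simp add: closure_of_closedin)
  have "decomposable (subgrp H (S closure_of (f ` carrier G))) (subtopology S (S closure_of (f ` carrier G)))"
  proof (rule decomposable_image_closure[OF _ D.subgroup_self D.closedin_carrier U(1,3)])
    show "decomposable (subgrp G (carrier G)) (subtopology T (carrier G))"
      using assms(1) by (simp add: D.subtopology_carrier)
    show "normalizes G U (carrier G)" by (rule D.normalizes_self[OF D.subgroup_self subgroup.subset[OF U(1)]])
    have "openin S (f ` U)" using assms(2) U(2) by (auto simp: open_map_def)
    then show "openin (subtopology S (S closure_of (f ` carrier G))) (f ` U \<inter> S closure_of (f ` carrier G))"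
      by (rule openin_subtopology_Int)
  qed
  then show ?thesis unfolding cl by (simp add: C.subtopology_carrier)
qed

end

section \<open>Elementary groups are decomposable\<close>

context tdlcsc
begin

text \<open>Composing the projection onto cosets with the given isomorphism replaces G/N by a
  continuous open surjection onto H, which is the form in which extensions and quotients are
  treated.\<close>

lemma quotient_hom:
  assumes N: "N \<lhd> G" and Q: "tdlcsc_group H S"
    and iso: "top_group_isomorphic (G Mod N) (quotient_topology G T N) H S"
  obtains f where "tdlcsc_hom G T H S f" "open_map T S f" "f ` carrier G = carrier H"
    "\<And>x. x \<in> carrier G \<Longrightarrow> f x = \<one>\<^bsub>H\<^esub> \<Longrightarrow> x \<in> N"
proof -
  interpret N: normal N G by (rule N)
  interpret H: tdlcsc H S using Q by (simp add: tdlcsc_iff)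
  interpret Q: group "G Mod N" by (rule N.factorgroup_is_group)
  obtain g where g: "g \<in> iso (G Mod N) H" "homeomorphic_map (quotient_topology G T N) S g"
    using iso by (auto simp: top_group_isomorphic_def)
  have car: "carrier (G Mod N) = (\<lambda>x. N #> x) ` carrier G"
    by (auto simp: FactGroup_def RCOSETS_def)
  note op = openin_quotient_topology[OF is_group N]
  have "\<Union>(carrier (G Mod N)) = carrier G"
    using rcosets_part_G[OF N.subgroup_axioms] by (simp add: FactGroup_def)
  then have ts: "topspace (quotient_topology G T N) = carrier (G Mod N)"
    using op[of T "carrier (G Mod N)"] op[of T "topspace (quotient_topology G T N)"]
      openin_subset[of "quotient_topology G T N" "carrier (G Mod N)"] openin_carrier
    by (simp add: subset_antisym)
  have cm: "continuous_map T (quotient_topology G T N) (\<lambda>x. N #> x)"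
    unfolding continuous_map_def
  proof (intro conjI allI impI)
    show "(\<lambda>x. N #> x) \<in> topspace T \<rightarrow> topspace (quotient_topology G T N)"
      unfolding ts car topspace by auto
    fix \<U> assume U: "openin (quotient_topology G T N) \<U>"
    \<comment> \<open>The preimage of a set of cosets is its union, which is exactly what the
      quotient topology tests for openness.\<close>
    have "{x \<in> topspace T. N #> x \<in> \<U>} = \<Union>\<U>"
    proof
      show "{x \<in> topspace T. N #> x \<in> \<U>} \<subseteq> \<Union>\<U>"
        using rcos_self[OF _ N.subgroup_axioms] unfolding topspace by blast
      show "\<Union>\<U> \<subseteq> {x \<in> topspace T. N #> x \<in> \<U>}"
      proof
        fix y assume "y \<in> \<Union>\<U>"
        then obtain A where A: "A \<in> \<U>" "y \<in> A" by blast
        then obtain x where x: "x \<in> carrier G" "A = N #> x" using U unfolding op car by blast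
        have "N #> x = N #> y" by (rule repr_independence[OF _ x(1) N.subgroup_axioms]) (use A x in simp)
        moreover have "y \<in> carrier G" using A x r_coset_subset_G[OF N.subset] by blast
        ultimately show "y \<in> {x \<in> topspace T. N #> x \<in> \<U>}" using A x by (simp add: topspace)
      qed
    qed
    then show "openin T {x \<in> topspace T. N #> x \<in> \<U>}" using U by (simp add: op)
  qed
  have om: "open_map T (quotient_topology G T N) (\<lambda>x. N #> x)"
    unfolding open_map_def
  proof (intro allI impI)
    fix U assume U: "openin T U"
    have "\<Union>((\<lambda>x. N #> x) ` U) = N <#> U" by (auto simp: r_coset_def set_mult_def)
    moreover have "openin T (N <#> U)" by (rule openin_set_mult_right[OF U N.subset])
    ultimately show "openin (quotient_topology G T N) ((\<lambda>x. N #> x) ` U)"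
      unfolding op car using open_carrier[OF U] by auto
  qed
  let ?f = "g \<circ> (\<lambda>x. N #> x)"
  have gh: "g \<in> hom (G Mod N) H" "bij_betw g (carrier (G Mod N)) (carrier H)"
    using g(1) by (auto simp: iso_def)
  have fhom: "?f \<in> hom G H" using Group.hom_compose[OF N.r_coset_hom_Mod gh(1)] .
  have "continuous_map T S ?f"
    by (rule continuous_map_compose[OF cm homeomorphic_imp_continuous_map[OF g(2)]])
  then have 1: "tdlcsc_hom G T H S ?f"
    using fhom tdlcsc_axioms H.tdlcsc_axioms by (simp add: tdlcsc_hom_def tdlcsc_hom_axioms_def)
  have 2: "open_map T S ?f"
    by (rule open_map_compose[OF om homeomorphic_imp_open_map[OF g(2)]])
  have 3: "?f ` carrier G = carrier H"
    using gh(2) car by (auto simp: bij_betw_def image_comp)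
  have 4: "x \<in> N" if x: "x \<in> carrier G" "?f x = \<one>\<^bsub>H\<^esub>" for x
  proof -
    interpret g: group_hom "G Mod N" H g by unfold_locales (rule gh(1))
    have "g (N #> x) = g \<one>\<^bsub>G Mod N\<^esub>" using x(2) g.hom_one by simp
    moreover have "N #> x \<in> carrier (G Mod N)" using car x(1) by blast
    ultimately have "N #> x = \<one>\<^bsub>G Mod N\<^esub>"
      using inj_onD[OF bij_betw_imp_inj_on[OF gh(2)]] Q.one_closed by blast
    then have "N #> x = N" by (simp add: FactGroup_def)
    then show ?thesis using rcos_self[OF x(1) N.subgroup_axioms] by simp
  qed
  show thesis by (rule that[OF 1 2 3 4])
qed

end

lemma top_group_isomorphic_hom:
  assumes "tdlcsc_group G T" "tdlcsc_group H S" "f \<in> iso G H" "homeomorphic_map T S f"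
  shows "tdlcsc_hom G T H S f"
  using assms by (auto simp: tdlcsc_hom_def tdlcsc_hom_axioms_def tdlcsc_iff iso_def
      homeomorphic_imp_continuous_map)

lemma elementary_copy_tdlcsc: "elementary_copy G T \<Longrightarrow> tdlcsc_group G T"
proof (induction rule: elementary_copy.induct)
  case (closed_subgroup G T H)
  then interpret tdlcsc G T by (simp add: tdlcsc_iff)
  show ?case using tdlcsc_subgroup closed_subgroup.hyps by blast
qed auto

lemma elementary_copy_decomposable: "elementary_copy G T \<Longrightarrow> decomposable G T"
proof (induction rule: elementary_copy.induct)
  case (profinite G T)
  then interpret tdlcsc G T by (simp add: tdlcsc_iff)
  show ?case using decomposable_compact profinite by blast
next
  case (discrete G T)
  then interpret tdlcsc G T by (simp add: tdlcsc_iff)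
  show ?case using decomposable_discrete discrete by blast
next
  case (extension G T N Q S)
  then interpret tdlcsc G T by (simp add: tdlcsc_iff)
  obtain f where f: "tdlcsc_hom G T Q S f" "\<And>x. x \<in> carrier G \<Longrightarrow> f x = \<one>\<^bsub>Q\<^esub> \<Longrightarrow> x \<in> N"
    using quotient_hom[OF extension.hyps(2) elementary_copy_tdlcsc[OF extension.hyps(5)] extension.hyps(6)]
    by metis
  show ?case
    by (rule decomposable_extension[OF extension.IH(2) f(1) extension.IH(1) normal_imp_subgroup[OF extension.hyps(2)] f(2)])
next
  case (closed_subgroup G T H)
  then show ?case by (blast intro: decomposable_closed_subgroup)
next
  case (quotient G T N Q S)
  then interpret tdlcsc G T by (simp add: tdlcsc_iff decomposable_tdlcsc)
  obtain f where f: "tdlcsc_hom G T Q S f" "open_map T S f" "f ` carrier G = carrier Q"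
    using quotient_hom[OF quotient.hyps(2,4,5)] by metis
  show ?case by (rule tdlcsc_hom.decomposable_quotient[OF f(1) quotient.IH f(2,3)])
next
  case (increasing_union G T U)
  then interpret tdlcsc G T by (simp add: tdlcsc_iff)
  show ?case using increasing_union by (intro decomposable_increasing_union)
qed

lemma elementary_decomposable:
  assumes "elementary G T"
  shows "decomposable G T"
proof -
  obtain H S f where H: "elementary_copy H S" and f: "f \<in> iso G H" "homeomorphic_map T S f"
    and G: "tdlcsc_group G T"
    using assms by (auto simp: elementary_def top_group_isomorphic_def)
  show ?thesis
  proof (rule decomposable_inj[OF elementary_copy_decomposable[OF H]])
    show "tdlcsc_hom G T H S f" by (rule top_group_isomorphic_hom[OF G elementary_copy_tdlcsc[OF H] f])
    show "inj_on f (carrier G)" using f(1) by (auto simp: iso_def bij_betw_def)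
  qed
qed

text \<open>The defining equations of the decomposition rank speak only of elementary groups, so
  uniqueness requires the residuals to be elementary.\<close>

lemma elementary_closed_subgroup:
  assumes "elementary G T" "subgroup A G" "closedin T A"
  shows "elementary (subgrp G A) (subtopology T A)"
proof -
  obtain H S f where H: "elementary_copy H S" and f: "f \<in> iso G H" "homeomorphic_map T S f"
    and G: "tdlcsc_group G T"
    using assms by (auto simp: elementary_def top_group_isomorphic_def)
  interpret f: tdlcsc_hom G T H S f by (rule top_group_isomorphic_hom[OF G elementary_copy_tdlcsc[OF H] f])
  have Ac: "A \<subseteq> carrier G" using subgroup.subset[OF assms(2)] .
  have fA: "subgroup (f ` A) H" by (rule f.subgroup_img_is_subgroup[OF assms(2)])
  have fAc: "closedin S (f ` A)"
    using homeomorphic_imp_closed_map[OF f(2)] assms(3) by (simp add: closed_map_def)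
  have "elementary_copy (subgrp H (f ` A)) (subtopology S (f ` A))"
    by (rule elementary_copy.closed_subgroup[OF H fA fAc])
  moreover have "homeomorphic_map (subtopology T A) (subtopology S (f ` A)) f"
    by (rule homeomorphic_map_subtopologies[OF f(2)])
       (use Ac subgroup.subset[OF fA] f.D.topspace f.C.topspace in \<open>auto simp: Int_absorb1\<close>)
  moreover have "f \<in> iso (subgrp G A) (subgrp H (f ` A))"
  proof -
    have "inj_on f A" using f(1) Ac by (auto simp: iso_def bij_betw_def intro: inj_on_subset)
    then have "bij_betw f A (f ` A)" by (simp add: bij_betw_def)
    moreover have "f \<in> hom (subgrp G A) (subgrp H (f ` A))"
      using Ac by (auto simp: hom_def subset_iff)
    ultimately show ?thesis by (simp add: iso_def)
  qed
  ultimately show ?thesis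
    using f.D.tdlcsc_subgroup[OF assms(2,3)] by (auto simp: elementary_def top_group_isomorphic_def)
qed

section \<open>Ordinals\<close>

lemma zero_ordinal_le [simp]: "(0 :: ordinal) \<le> \<alpha>"
  unfolding zero_ordinal_def by (rule Least_le) simp

lemma ordinal_le_zero_iff: "(\<alpha> :: ordinal) \<le> 0 \<longleftrightarrow> \<alpha> = 0"
  using zero_ordinal_le[of \<alpha>] by (auto intro: antisym)

lemma ord_succ_le_iff: "ord_succ \<alpha> \<le> \<beta> \<longleftrightarrow> \<alpha> < \<beta>"
proof
  assume "\<alpha> < \<beta>"
  then show "ord_succ \<alpha> \<le> \<beta>" unfolding ord_succ_def by (rule Least_le)
qed (use less_ord_succ in \<open>rule less_le_trans\<close>)

lemma less_ord_succ_iff: "\<alpha> < ord_succ \<beta> \<longleftrightarrow> \<alpha> \<le> \<beta>"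
  using ord_succ_le_iff[of \<beta> \<alpha>] not_le[of "ord_succ \<beta>" \<alpha>] not_less[of \<beta> \<alpha>] by blast

lemma ord_succ_le_ord_succ_iff: "ord_succ \<alpha> \<le> ord_succ \<beta> \<longleftrightarrow> \<alpha> \<le> \<beta>"
  by (simp add: ord_succ_le_iff less_ord_succ_iff)

lemma ord_succ_neq_zero: "ord_succ \<alpha> \<noteq> 0"
  using less_ord_succ[of \<alpha>] zero_ordinal_le[of \<alpha>] by (metis not_le)

lemma is_succ_ord_succ: "is_succ (ord_succ \<alpha>)"
  by (auto simp: is_succ_def)

text \<open>The bound \<beta> guarantees that a least upper bound exists; the type
  \<open>ordinal\<close> does not provide one for every set.\<close>

lemma ord_sup_upper:
  assumes "\<And>\<alpha>. \<alpha> \<in> A \<Longrightarrow> \<alpha> \<le> \<beta>" "\<alpha> \<in> A"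
  shows "\<alpha> \<le> ord_sup A"
proof -
  have "\<forall>\<alpha>\<in>A. \<alpha> \<le> ord_sup A"
    unfolding ord_sup_def by (rule LeastI[of _ \<beta>]) (use assms in auto)
  then show ?thesis using assms(2) by blast
qed

lemma ord_sup_le: "(\<And>\<alpha>. \<alpha> \<in> A \<Longrightarrow> \<alpha> \<le> \<beta>) \<Longrightarrow> ord_sup A \<le> \<beta>"
  unfolding ord_sup_def by (rule Least_le) simp

lemma ord_sup_le_iff:
  assumes "\<And>\<alpha>. \<alpha> \<in> A \<Longrightarrow> \<alpha> \<le> \<gamma>"
  shows "ord_sup A \<le> \<beta> \<longleftrightarrow> (\<forall>\<alpha>\<in>A. \<alpha> \<le> \<beta>)"
proof
  assume "ord_sup A \<le> \<beta>"
  then show "\<forall>\<alpha>\<in>A. \<alpha> \<le> \<beta>" using ord_sup_upper[of A \<gamma>] assms by (meson order_trans)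
qed (auto intro: ord_sup_le)

lemma ord_sup_singleton: "ord_sup {\<alpha>} = \<alpha>"
  by (rule antisym) (auto intro: ord_sup_le ord_sup_upper)

lemma countable_below_omega_1: "\<alpha> < omega_1 \<Longrightarrow> countable {..<\<alpha>}"
  unfolding omega_1_def by (auto dest: not_less_Least)

text \<open>Otherwise the ordinals below \<open>omega_1\<close> would be covered by countably many
  countable initial segments.\<close>

lemma ord_sup_countable_less_omega_1:
  assumes "countable A" "\<And>\<alpha>. \<alpha> \<in> A \<Longrightarrow> \<alpha> < omega_1"
  shows "ord_sup A < omega_1"
proof (rule ccontr)
  assume n: "\<not> ord_sup A < omega_1"
  have "{..<omega_1} \<subseteq> (\<Union>\<alpha>\<in>A. {..<\<alpha>})"
  proof
    fix \<beta> assume b: "\<beta> \<in> {..<omega_1}"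
    show "\<beta> \<in> (\<Union>\<alpha>\<in>A. {..<\<alpha>})"
    proof (rule ccontr)
      assume "\<beta> \<notin> (\<Union>\<alpha>\<in>A. {..<\<alpha>})"
      then have "ord_sup A \<le> \<beta>" by (intro ord_sup_le) (auto simp: not_less)
      then show False using n b by auto
    qed
  qed
  moreover have "countable (\<Union>\<alpha>\<in>A. {..<\<alpha>})"
    using assms countable_below_omega_1 by blast
  ultimately show False using uncountable_omega_1 countable_subset by blast
qed

lemma ord_succ_less_omega_1:
  assumes "\<alpha> < omega_1"
  shows "ord_succ \<alpha> < omega_1"
proof (rule ccontr)
  assume n: "\<not> ord_succ \<alpha> < omega_1"
  have "{..<omega_1} \<subseteq> insert \<alpha> {..<\<alpha>}"
  proof
    fix \<beta> assume "\<beta> \<in> {..<omega_1}"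
    then have "\<beta> < ord_succ \<alpha>" using n by (auto simp: not_less)
    then show "\<beta> \<in> insert \<alpha> {..<\<alpha>}" by (auto simp: less_ord_succ_iff le_less)
  qed
  then show False
    using uncountable_omega_1 countable_below_omega_1[OF assms] by (meson countable_insert countable_subset)
qed

lemma zero_less_omega_1: "0 < omega_1"
proof -
  have "{..<0 :: ordinal} = {}" by (simp add: lessThan_def not_less)
  then have "omega_1 \<noteq> 0" using uncountable_omega_1 by (metis countable_empty)
  then show ?thesis using zero_ordinal_le[of omega_1] by (simp add: less_le)
qed

text \<open>The supremum of the successors lies between the supremum of A and its successor. If it
  is a successor it equals the latter; if not, it equals the former and \<open>ord_sup_plus\<close>
  adds one.\<close>

lemma ord_sup_plus_succ:
  assumes bdd: "\<And>\<alpha>. \<alpha> \<in> A \<Longrightarrow> \<alpha> < \<gamma>"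
  shows "A \<noteq> {} \<Longrightarrow> ord_sup_plus (ord_succ ` A) = ord_succ (ord_sup A)"
proof -
  assume ne: "A \<noteq> {}"
  define s where "s = ord_sup (ord_succ ` A)"
  have up: "ord_succ \<alpha> \<le> s" if "\<alpha> \<in> A" for \<alpha>
    unfolding s_def by (rule ord_sup_upper[where \<beta> = \<gamma>]) (use bdd that ord_succ_le_iff in auto)
  have upA: "\<alpha> \<le> ord_sup A" if "\<alpha> \<in> A" for \<alpha>
    by (rule ord_sup_upper[where \<beta> = \<gamma>]) (use bdd that less_imp_le in blast)+
  have le: "s \<le> ord_succ (ord_sup A)"
    unfolding s_def by (rule ord_sup_le) (use upA ord_succ_le_ord_succ_iff in auto)
  have sA: "ord_sup A \<le> s"
    by (rule ord_sup_le) (use up ord_succ_le_iff in \<open>auto intro: less_imp_le\<close>)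
  show ?thesis
  proof (cases "is_succ s")
    case True
    then obtain \<beta> where b: "s = ord_succ \<beta>" by (auto simp: is_succ_def)
    have "ord_sup A \<le> \<beta>"
      by (rule ord_sup_le) (use up b ord_succ_le_ord_succ_iff in auto)
    then have "ord_succ (ord_sup A) \<le> s" using b ord_succ_le_ord_succ_iff by simp
    then show ?thesis using True le by (simp add: ord_sup_plus_def flip: s_def)
  next
    case False
    have "s \<noteq> ord_succ (ord_sup A)" using False is_succ_ord_succ by metis
    then have "s \<le> ord_sup A" using le less_ord_succ_iff by (metis order.not_eq_order_implies_strict)
    then have "s = ord_sup A" using sA by simp
    then show ?thesis using False by (simp add: ord_sup_plus_def flip: s_def)
  qed
qed

section \<open>Residual heights\<close>

text \<open>
  Unlike in the residual order, \<open>L = K\<close> is not excluded: that a nontrivial \<open>K\<close> is never contained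
  in its own residual is part of the well-foundedness of this relation.
\<close>

definition residual_below :: "'a monoid \<Rightarrow> 'a topology \<Rightarrow> ('a set \<times> 'a set) set" where
  "residual_below G T =
     {(L, K). L \<in> cg_closed_subgroups G T \<and> K \<in> cg_closed_subgroups G T \<and>
        K \<noteq> {\<one>\<^bsub>G\<^esub>} \<and> L \<subseteq> relative_residual G T K}"

text \<open>A well-founded rank, identified with the residual height through the levels. Adding one
  after the supremum makes the height of every nontrivial K a successor, in accordance with limit
  levels being mere unions of earlier ones.\<close>

definition height :: "'a monoid \<Rightarrow> 'a topology \<Rightarrow> 'a set \<Rightarrow> ordinal" where
  "height G T = wfrec (residual_below G T) (\<lambda>h K.
     if K = {\<one>\<^bsub>G\<^esub>} then 0 else ord_succ (ord_sup (h ` {L. (L, K) \<in> residual_below G T})))"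

lemma height_eq:
  assumes "wf (residual_below G T)"
  shows "height G T K =
    (if K = {\<one>\<^bsub>G\<^esub>} then 0 else ord_succ (ord_sup (height G T ` {L. (L, K) \<in> residual_below G T})))"
proof -
  let ?F = "\<lambda>h K. if K = {\<one>\<^bsub>G\<^esub>} then 0
    else ord_succ (ord_sup (h ` {L. (L, K) \<in> residual_below G T}))"
  have "cut h (residual_below G T) K ` {L. (L, K) \<in> residual_below G T}
    = h ` {L. (L, K) \<in> residual_below G T}" for h :: "'a set \<Rightarrow> ordinal"
    by (rule image_cong) (auto simp: cut_def)
  then show ?thesis
    unfolding height_def by (subst wfrec[OF assms]) simp
qed

section \<open>Compactly generated closed subgroups and their relative residuals\<close>

context tdlcsc
begin

lemma compactly_generated_subgrp:
  assumes "subgroup K G"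
  shows "compactly_generated (subgrp G K) (subtopology T K) \<longleftrightarrow> (\<exists>C. compactin T C \<and> generate G C = K)"
proof
  assume "compactly_generated (subgrp G K) (subtopology T K)"
  then obtain C where C: "compactin (subtopology T K) C" "generate (subgrp G K) C = K"
    by (auto simp: compactly_generated_def)
  have "C \<subseteq> K" "compactin T C" using C(1) by (auto simp: compactin_subtopology)
  then show "\<exists>C. compactin T C \<and> generate G C = K"
    using C(2) generate_consistent[OF _ assms] by auto
next
  assume "\<exists>C. compactin T C \<and> generate G C = K"
  then obtain C where C: "compactin T C" "generate G C = K" by blast
  have CK: "C \<subseteq> K" using C(2) generate_superset by blast
  then have "compactin (subtopology T K) C" using C(1) by (simp add: compactin_subtopology)
  then show "compactly_generated (subgrp G K) (subtopology T K)"
    using C(2) generate_consistent[OF CK assms] by (auto simp: compactly_generated_def)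
qed

lemma cg_closed_subgroups_iff:
  "K \<in> cg_closed_subgroups G T \<longleftrightarrow> closedin T K \<and> (\<exists>C. compactin T C \<and> generate G C = K)"
  using compactly_generated_subgrp generate_compact_subgroup
  by (auto simp: cg_closed_subgroups_def)

lemma cg_closed_subgroupsD:
  assumes "K \<in> cg_closed_subgroups G T"
  shows "subgroup K G" "closedin T K"
  using assms by (auto simp: cg_closed_subgroups_def)

lemma one_in_cg_closed_subgroups: "{\<one>} \<in> cg_closed_subgroups G T"
  unfolding cg_closed_subgroups_iff
  using trivial_closed_subgroup(2) generate_empty compactin_empty by blast

lemma cg_closed_subgroups_subgrp:
  assumes A: "subgroup A G" "closedin T A"
  shows "cg_closed_subgroups (subgrp G A) (subtopology T A) = {K \<in> cg_closed_subgroups G T. K \<subseteq> A}"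
proof -
  interpret A: tdlcsc "subgrp G A" "subtopology T A" by (rule closed_subgroup_tdlcsc[OF A])
  have "subtopology (subtopology T A) K = subtopology T K" if "K \<subseteq> A" for K
    using that by (simp add: subtopology_subtopology Int_absorb1)
  moreover have "closedin (subtopology T A) K \<longleftrightarrow> closedin T K" if "K \<subseteq> A" for K
    using that A(2) closedin_trans_full closedin_subset_topspace by blast
  ultimately show ?thesis
    by (auto simp: cg_closed_subgroups_def subgroup_subgrp_iff[OF A(1)])
qed

lemma relative_residual_closed_subgroup:
  assumes "subgroup K G"
  shows "subgroup (relative_residual G T K) G" "closedin T (relative_residual G T K)"
  using residual_in_subgroup[OF subgroup_self subgroup.subset[OF assms]]
    residual_in_closed[OF subgroup_self closedin_carrier subgroup.subset[OF assms]]
  by (auto simp: relative_residual_eq[OF assms])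

lemma relative_residual_mono:
  assumes "subgroup K G" "subgroup L G" "K \<subseteq> L"
  shows "relative_residual G T K \<subseteq> relative_residual G T L"
  using residual_in_mono[OF assms(3)] by (simp add: relative_residual_eq assms)

text \<open>An open subgroup normalized by K contains Res_G(K), hence L, and is therefore normalized
  by L.\<close>

lemma relative_residual_trans:
  assumes "subgroup K G" "subgroup L G" "L \<subseteq> relative_residual G T K"
  shows "relative_residual G T L \<subseteq> relative_residual G T K"
proof -
  have "normalizes G L N" if N: "subgroup N G" "N \<subseteq> carrier G" "openin (subtopology T (carrier G)) N" "normalizes G K N" for N
  proof -
    have "L \<subseteq> N"
      using assms(3) N unfolding relative_residual_eq[OF assms(1)] residual_in_def by blast
    then show ?thesis by (rule normalizes_self[OF N(1)])
  qed
  then show ?thesis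
    unfolding relative_residual_eq[OF assms(1)] relative_residual_eq[OF assms(2)] residual_in_def
    by blast
qed

lemma relative_residual_open:
  assumes "subgroup E G" "openin T E"
  shows "relative_residual G T E = residual G T E"
  using residual_in_rel_open[OF assms(1) subgroup_self subgroup.subset[OF assms(1)] order_refl]
    assms by (simp add: relative_residual_eq subtopology_carrier)

text \<open>Since E is open, Res_G(L) = Res_E(L), which lies in R = Res_E(E) because L \<le> E. As R
  is normal in E and L is compactly generated, Res_E(L) \<inter> R = Res_R(L).\<close>

lemma relative_residual_residual:
  assumes E: "subgroup E G" "openin T E"
    and L: "L \<in> cg_closed_subgroups G T" "L \<subseteq> residual G T E"
  shows "relative_residual (subgrp G (residual G T E)) (subtopology T (residual G T E)) L
       = relative_residual G T L"
    and "relative_residual G T L \<subseteq> residual G T E"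
proof -
  let ?R = "residual G T E"
  note R = residual_closed_subgroup[OF E(1) open_subgroup_closed[OF E]]
  note Lsub = cg_closed_subgroupsD(1)[OF L(1)]
  have LE: "L \<subseteq> E" using L(2) R(3) by blast
  obtain C where C: "compactin T C" "generate G C = L" using L(1) by (auto simp: cg_closed_subgroups_iff)
  have CR: "C \<subseteq> ?R" using C(2) L(2) generate_superset by blast
  have *: "residual_in G T E L \<inter> ?R = residual_in G T ?R L"
    using residual_in_relatively_normal[OF E(1) open_subgroup_closed[OF E] R(1,3) residual_in_normalizes C(1) CR]
    by (simp add: C(2))
  have 1: "relative_residual G T L = residual_in G T E L"
    using residual_in_rel_open[OF E(1) subgroup_self subgroup.subset[OF E(1)] LE] E(2)
    by (simp add: relative_residual_eq[OF Lsub] subtopology_carrier)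
  then show 2: "relative_residual G T L \<subseteq> ?R" using residual_in_mono[OF LE] by blast
  show "relative_residual (subgrp G ?R) (subtopology T ?R) L = relative_residual G T L"
    using relative_residual_subgrp[OF R(1,2) Lsub L(2)] * 1 2 by auto
qed

text \<open>Nothing below a K \<le> R leaves R, so the relation of R is an initial part of that of
  G.\<close>

lemma residual_below_residual:
  assumes E: "subgroup E G" "openin T E"
  shows "residual_below (subgrp G (residual G T E)) (subtopology T (residual G T E))
       = {(L, K) \<in> residual_below G T. K \<subseteq> residual G T E}"
proof -
  let ?R = "residual G T E"
  note R = residual_closed_subgroup[OF E(1) open_subgroup_closed[OF E]]
  have 1: "L \<subseteq> ?R" if "K \<in> cg_closed_subgroups G T" "K \<subseteq> ?R" "L \<subseteq> relative_residual G T K" for L K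
    using relative_residual_residual(2)[OF E that(1,2)] that(3) by (rule order_trans[rotated])
  show ?thesis
  proof (rule Set.set_eqI)
    fix p :: "'a set \<times> 'a set"
    obtain L K where p: "p = (L, K)" by (cases p)
    show "p \<in> residual_below (subgrp G ?R) (subtopology T ?R)
       \<longleftrightarrow> p \<in> {(L, K) \<in> residual_below G T. K \<subseteq> ?R}"
    proof (cases "K \<in> cg_closed_subgroups G T \<and> K \<subseteq> ?R")
      case True
      then show ?thesis
        using relative_residual_residual(1)[OF E, of K] 1[of K L]
        unfolding p residual_below_def cg_closed_subgroups_subgrp[OF R(1,2)] by auto
    next
      case False
      then show ?thesis
        unfolding p residual_below_def cg_closed_subgroups_subgrp[OF R(1,2)] by auto
    qed
  qed
qed

lemma cg_closed_in_open:
  assumes "K \<in> cg_closed_subgroups G T"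
  obtains C where "compactin T C" "openin T (generate G C)" "K \<subseteq> generate G C"
proof -
  obtain D where D: "compactin T D" "generate G D = K" using assms by (auto simp: cg_closed_subgroups_iff)
  obtain C where C: "compactin T C" "D \<subseteq> C" "openin T (generate G C)"
    using compact_in_open_generate[OF D(1)] .
  show thesis using that[OF C(1,3)] mono_generate[OF C(2)] D(2) by simp
qed

end

text \<open>If K0 is not minimal in Q, then Q has a member inside R = Res(E) for an open compactly
  generated E containing K0. A minimal one among the members inside R exists by induction, and it is
  minimal in Q since everything below it stays in R.\<close>

lemma wf_residual_below: "decomposable G T \<Longrightarrow> wf (residual_below G T)"
proof (induction rule: decomposable.induct)
  case (trivial G T)
  then interpret tdlcsc G T by (simp add: tdlcsc_iff)
  have "K = {\<one>\<^bsub>G\<^esub>}" if "K \<in> cg_closed_subgroups G T" for K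
    using subgroup.subset[OF cg_closed_subgroupsD(1)[OF that]] trivial.hyps(2)
      subgroup.one_closed[OF cg_closed_subgroupsD(1)[OF that]] by blast
  then have "residual_below G T = {}" by (auto simp: residual_below_def)
  then show ?case by simp
next
  case (step G T)
  then interpret tdlcsc G T by (simp add: tdlcsc_iff)
  show ?case
    unfolding wf_eq_minimal
  proof (intro allI impI)
    fix Q :: "'a set set" and K0 assume K0: "K0 \<in> Q"
    show "\<exists>z\<in>Q. \<forall>y. (y, z) \<in> residual_below G T \<longrightarrow> y \<notin> Q"
    proof (cases "\<exists>L\<in>Q. (L, K0) \<in> residual_below G T")
      case False
      then show ?thesis using K0 by blast
    next
      case True
      then obtain L where L: "L \<in> Q" "(L, K0) \<in> residual_below G T" by blast
      then have K0cg: "K0 \<in> cg_closed_subgroups G T" and LK: "L \<subseteq> relative_residual G T K0"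
        and Lcg: "L \<in> cg_closed_subgroups G T" by (auto simp: residual_below_def)
      obtain C where C: "compactin T C" "openin T (generate G C)" "K0 \<subseteq> generate G C"
        using cg_closed_in_open[OF K0cg] .
      let ?E = "generate G C"
      let ?R = "residual G T ?E"
      have E: "subgroup ?E G" by (rule generate_compact_subgroup[OF C(1)])
      have "L \<subseteq> ?R"
        using LK relative_residual_mono[OF cg_closed_subgroupsD(1)[OF K0cg] E C(3)]
        by (simp add: relative_residual_open[OF E C(2)])
      then have LQ: "L \<in> {M \<in> Q. M \<subseteq> ?R}" using L by blast
      have wfR: "wf {(L, K) \<in> residual_below G T. K \<subseteq> ?R}"
        using step.IH[OF C(1,2)] residual_below_residual[OF E C(2)] by simp
      obtain z where z: "z \<in> {M \<in> Q. M \<subseteq> ?R}"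
        "\<forall>y. (y, z) \<in> {(L, K) \<in> residual_below G T. K \<subseteq> ?R} \<longrightarrow> y \<notin> {M \<in> Q. M \<subseteq> ?R}"
        using wfR[unfolded wf_eq_minimal, rule_format, OF LQ] by (elim bexE)
      have "y \<notin> Q" if y: "(y, z) \<in> residual_below G T" for y
      proof -
        have "z \<in> cg_closed_subgroups G T" "y \<subseteq> relative_residual G T z"
          using y by (auto simp: residual_below_def)
        then have "y \<subseteq> ?R" using relative_residual_residual(2)[OF E C(2), of z] z(1) by blast
        then show ?thesis using z y by blast
      qed
      then show ?thesis using z(1) by blast
    qed
  qed
qed

section \<open>Heights, levels and the residual rank of a decomposable group\<close>

locale decomposable_group = tdlcsc +
  assumes decomposable: "decomposable G T"
begin

abbreviation "\<K> \<equiv> cg_closed_subgroups G T"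
abbreviation "below \<equiv> residual_below G T"
abbreviation "h \<equiv> height G T"

lemma wf_below: "wf below"
  by (rule wf_residual_below[OF decomposable])

lemma h_one: "h {\<one>} = 0"
  using height_eq[OF wf_below, of "{\<one>}"] by simp

lemma h_eq:
  assumes "K \<in> \<K>" "K \<noteq> {\<one>}"
  shows "h K = ord_succ (ord_sup (h ` {L \<in> \<K>. L \<subseteq> relative_residual G T K}))"
proof -
  have "{L. (L, K) \<in> below} = {L \<in> \<K>. L \<subseteq> relative_residual G T K}"
    using assms by (auto simp: residual_below_def)
  then show ?thesis using height_eq[OF wf_below, of K] assms(2) by simp
qed

lemma height_residual:
  assumes E: "subgroup E G" "openin T E" and L: "L \<in> \<K>" "L \<subseteq> residual G T E"
  shows "height (subgrp G (residual G T E)) (subtopology T (residual G T E)) L = h L"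
proof -
  let ?R = "residual G T E"
  let ?b = "residual_below (subgrp G ?R) (subtopology T ?R)"
  note R = residual_closed_subgroup[OF E(1) open_subgroup_closed[OF E]]
  have b: "?b = {(L, K) \<in> below. K \<subseteq> ?R}" by (rule residual_below_residual[OF E])
  have wf: "wf ?b" unfolding b by (rule wf_subset[OF wf_below]) auto
  show ?thesis
    using L
  proof (induction L rule: wf_induct_rule[OF wf_below])
    case (1 K)
    have eq: "{L. (L, K) \<in> ?b} = {L. (L, K) \<in> below}" using 1(3) b by auto
    have "height (subgrp G ?R) (subtopology T ?R) ` {L. (L, K) \<in> below} = h ` {L. (L, K) \<in> below}"
    proof (rule image_cong[OF refl])
      fix L assume "L \<in> {L. (L, K) \<in> below}"
      then have L: "(L, K) \<in> below" by simp
      then have "L \<in> \<K>" "L \<subseteq> relative_residual G T K" by (auto simp: residual_below_def)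
      moreover have "relative_residual G T K \<subseteq> ?R" by (rule relative_residual_residual(2)[OF E 1(2,3)])
      ultimately show "height (subgrp G ?R) (subtopology T ?R) L = h L" using 1(1)[OF L] by blast
    qed
    then show ?case
      using height_eq[OF wf, of K] height_eq[OF wf_below, of K] eq by simp
  qed
qed

text \<open>The sequence is cofinal among the members of \<open>\<K>\<close> inside A; this reduces
  suprema over possibly uncountable families to countable ones.\<close>

lemma exhaust_closed:
  assumes A: "subgroup A G" "closedin T A"
  obtains U :: "nat \<Rightarrow> 'a set" where "\<forall>i. U i \<in> \<K>" "\<forall>i. U i \<subseteq> A" "(\<Union>i. U i) = A"
    "\<forall>L\<in>\<K>. L \<subseteq> A \<longrightarrow> (\<exists>i. L \<subseteq> U i)"
proof -
  interpret A: tdlcsc "subgrp G A" "subtopology T A" by (rule closed_subgroup_tdlcsc[OF A])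
  obtain U :: "nat \<Rightarrow> 'a set" where *: "incseq U" "(\<Union>i. U i) = carrier (subgrp G A)"
    "\<forall>i. subgroup (U i) (subgrp G A)" "\<forall>i. openin (subtopology T A) (U i)"
    "\<forall>i. \<exists>C. compactin (subtopology T A) C \<and> generate (subgrp G A) C = U i"
    using A.exhaustion .
  note U = *(1,2) *(3-5)[rule_format]
  have cg: "U i \<in> cg_closed_subgroups (subgrp G A) (subtopology T A)" for i
    unfolding A.cg_closed_subgroups_iff using A.open_subgroup_closed[OF U(3,4)] U(5) by blast
  then have 1: "U i \<in> \<K>" "U i \<subseteq> A" for i
    unfolding cg_closed_subgroups_subgrp[OF A] by auto
  have "\<exists>i. L \<subseteq> U i" if L: "L \<in> \<K>" "L \<subseteq> A" for L
  proof -
    have "L \<in> cg_closed_subgroups (subgrp G A) (subtopology T A)"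
      using L by (simp add: cg_closed_subgroups_subgrp[OF A])
    then obtain C where C: "compactin (subtopology T A) C" "generate (subgrp G A) C = L"
      unfolding A.cg_closed_subgroups_iff by blast
    obtain i where "C \<subseteq> U i" using A.compact_in_increasing_union[OF U(1,2,4) C(1)] .
    then show ?thesis using A.generate_leI[OF U(3)] C(2) by blast
  qed
  then show thesis using that[of U] 1 U(2) by simp
qed

text \<open>The bound on the heights below K is an assumption because monotonicity is itself used to
  prove that heights are countable; \<open>h_mono\<close> discharges it afterwards.\<close>

lemma h_mono_bounded:
  assumes "L \<in> \<K>" "K \<in> \<K>" "L \<subseteq> K"
    and bdd: "\<And>M. M \<in> \<K> \<Longrightarrow> M \<subseteq> relative_residual G T K \<Longrightarrow> h M < omega_1"
  shows "h L \<le> h K"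
proof (cases "L = {\<one>}")
  case True
  then show ?thesis by (simp add: h_one)
next
  case False
  have "K \<noteq> {\<one>}" using False assms(3) subgroup.one_closed[OF cg_closed_subgroupsD(1)[OF assms(1)]] by blast
  have "ord_sup (h ` {M \<in> \<K>. M \<subseteq> relative_residual G T L}) \<le> ord_sup (h ` {M \<in> \<K>. M \<subseteq> relative_residual G T K})"
  proof (rule ord_sup_le)
    fix \<alpha> assume "\<alpha> \<in> h ` {M \<in> \<K>. M \<subseteq> relative_residual G T L}"
    then have "\<alpha> \<in> h ` {M \<in> \<K>. M \<subseteq> relative_residual G T K}"
      using relative_residual_mono[OF cg_closed_subgroupsD(1)[OF assms(1)] cg_closed_subgroupsD(1)[OF assms(2)] assms(3)]
      by blast
    then show "\<alpha> \<le> ord_sup (h ` {M \<in> \<K>. M \<subseteq> relative_residual G T K})"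
      by (rule ord_sup_upper[where \<beta> = omega_1, rotated]) (use bdd in \<open>auto intro: less_imp_le\<close>)
  qed
  then show ?thesis
    using h_eq[OF assms(1) False] h_eq[OF assms(2) \<open>K \<noteq> {\<one>}\<close>] by (simp add: ord_succ_le_ord_succ_iff)
qed

text \<open>By monotonicity the supremum is bounded by that over a cofinal sequence, a countable
  family of countable ordinals. The assumption \<open>res\<close> keeps everything below a K \<le> A
  inside A, where the bound on heights applies.\<close>

lemma h_sup_countable:
  assumes A: "subgroup A G" "closedin T A"
    and bdd: "\<And>L. L \<in> \<K> \<Longrightarrow> L \<subseteq> A \<Longrightarrow> h L < omega_1"
    and res: "\<And>K. K \<in> \<K> \<Longrightarrow> K \<subseteq> A \<Longrightarrow> relative_residual G T K \<subseteq> A"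
  shows "ord_sup (h ` {L \<in> \<K>. L \<subseteq> A}) < omega_1"
proof -
  obtain U :: "nat \<Rightarrow> 'a set" where *: "\<forall>i. U i \<in> \<K>" "\<forall>i. U i \<subseteq> A" "(\<Union>i. U i) = A"
    "\<forall>L\<in>\<K>. L \<subseteq> A \<longrightarrow> (\<exists>i. L \<subseteq> U i)"
    using exhaust_closed[OF A] .
  note U = *(1,2,4)[rule_format]
  have bU: "h (U i) < omega_1" for i using bdd U by blast
  have "ord_sup (h ` {L \<in> \<K>. L \<subseteq> A}) \<le> ord_sup (range (\<lambda>i. h (U i)))"
  proof (rule ord_sup_le)
    fix \<alpha> assume "\<alpha> \<in> h ` {L \<in> \<K>. L \<subseteq> A}"
    then obtain L where L: "L \<in> \<K>" "L \<subseteq> A" "\<alpha> = h L" by blast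
    obtain i where i: "L \<subseteq> U i" using U(3)[OF L(1,2)] by blast
    have "\<alpha> \<le> h (U i)"
      unfolding L(3) by (rule h_mono_bounded[OF L(1) U(1) i]) (use bdd res[OF U(1,2)] in blast)
    also have "\<dots> \<le> ord_sup (range (\<lambda>i. h (U i)))"
      by (rule ord_sup_upper[where \<beta> = omega_1]) (use bU in \<open>auto intro: less_imp_le\<close>)
    finally show "\<alpha> \<le> ord_sup (range (\<lambda>i. h (U i)))" .
  qed
  also have "\<dots> < omega_1"
    by (rule ord_sup_countable_less_omega_1) (use bU in auto)
  finally show ?thesis .
qed

lemma h_less_omega_1:
  assumes "K \<in> \<K>"
  shows "h K < omega_1"
  using assms
proof (induction K rule: wf_induct_rule[OF wf_below])
  case (1 K)
  show ?case
  proof (cases "K = {\<one>}")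
    case True
    then show ?thesis using h_one zero_less_omega_1 by simp
  next
    case False
    note Ks = cg_closed_subgroupsD(1)[OF 1(2)]
    have "ord_sup (h ` {L \<in> \<K>. L \<subseteq> relative_residual G T K}) < omega_1"
    proof (rule h_sup_countable[OF relative_residual_closed_subgroup[OF Ks]])
      fix L assume "L \<in> \<K>" "L \<subseteq> relative_residual G T K"
      then show "h L < omega_1" using 1 False by (auto simp: residual_below_def)
    next
      fix L assume "L \<in> \<K>" "L \<subseteq> relative_residual G T K"
      then show "relative_residual G T L \<subseteq> relative_residual G T K"
        using relative_residual_trans[OF Ks cg_closed_subgroupsD(1)] by blast
    qed
    then show ?thesis using h_eq[OF 1(2) False] ord_succ_less_omega_1 by simp
  qed
qed

lemma h_mono: "L \<in> \<K> \<Longrightarrow> K \<in> \<K> \<Longrightarrow> L \<subseteq> K \<Longrightarrow> h L \<le> h K"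
  by (rule h_mono_bounded) (auto intro: h_less_omega_1)

lemma h_le_ord_succ_iff:
  assumes "K \<in> \<K>" "K \<noteq> {\<one>}"
  shows "h K \<le> ord_succ \<beta> \<longleftrightarrow> (\<forall>L\<in>\<K>. L \<subseteq> relative_residual G T K \<longrightarrow> h L \<le> \<beta>)"
proof -
  have "ord_sup (h ` {L \<in> \<K>. L \<subseteq> relative_residual G T K}) \<le> \<beta> \<longleftrightarrow>
    (\<forall>\<alpha>\<in>h ` {L \<in> \<K>. L \<subseteq> relative_residual G T K}. \<alpha> \<le> \<beta>)"
    by (rule ord_sup_le_iff[where \<gamma> = omega_1]) (auto intro: h_less_omega_1 less_imp_le)
  then show ?thesis by (auto simp: h_eq[OF assms] ord_succ_le_ord_succ_iff)
qed

lemma h_eq_zero_iff: "K \<in> \<K> \<Longrightarrow> h K = 0 \<longleftrightarrow> K = {\<one>}"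
  using h_one h_eq ord_succ_neq_zero by metis

lemma relative_residual_one: "relative_residual G T {\<one>} = {\<one>}"
proof -
  have "x = \<one>" if x: "x \<in> relative_residual G T {\<one>}" for x
  proof (rule ccontr)
    assume "x \<noteq> \<one>"
    have xc: "x \<in> carrier G"
      using x subgroup.subset[OF relative_residual_closed_subgroup(1)[OF triv_subgroup]] by blast
    obtain U where U: "subgroup U G" "openin T U" "x \<notin> U"
      using open_subgroup_avoiding[OF xc \<open>x \<noteq> \<one>\<close>] .
    have "normalizes G {\<one>} U" using subgroup.subset[OF U(1)] by (auto simp: normalizes_def)
    then have "x \<in> U"
      using x U(1,2) subgroup.subset[OF U(1)]
      unfolding relative_residual_eq[OF triv_subgroup] residual_in_def subtopology_carrier by blast
    then show False using U(3) by blast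
  qed
  then show ?thesis
    using subgroup.one_closed[OF relative_residual_closed_subgroup(1)[OF triv_subgroup]] by blast
qed

text \<open>The relative residual is a closed subgroup and hence the union of its closed compactly
  generated subgroups.\<close>

lemma relative_residual_trivial_iff:
  assumes "subgroup K G"
  shows "relative_residual G T K = {\<one>} \<longleftrightarrow> (\<forall>L\<in>\<K>. L \<subseteq> relative_residual G T K \<longrightarrow> L = {\<one>})"
proof
  assume r: "relative_residual G T K = {\<one>}"
  show "\<forall>L\<in>\<K>. L \<subseteq> relative_residual G T K \<longrightarrow> L = {\<one>}"
  proof (intro ballI impI)
    fix L assume "L \<in> \<K>" "L \<subseteq> relative_residual G T K"
    then show "L = {\<one>}" using r subgroup.one_closed[OF cg_closed_subgroupsD(1)] by blast
  qed
next
  assume *: "\<forall>L\<in>\<K>. L \<subseteq> relative_residual G T K \<longrightarrow> L = {\<one>}"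
  obtain U :: "nat \<Rightarrow> 'a set" where U: "\<forall>i. U i \<in> \<K>" "\<forall>i. U i \<subseteq> relative_residual G T K"
    "(\<Union>i. U i) = relative_residual G T K"
    using exhaust_closed[OF relative_residual_closed_subgroup[OF assms]] .
  have "U i = {\<one>}" for i
    by (rule *[rule_format]) (use U(1,2) in simp_all)
  then show "relative_residual G T K = {\<one>}" using U(3) by simp
qed

text \<open>The levels are cumulative, so each is cut out by the height alone. The separate clause
  for level 1 amounts to \<open>h K \<le> 1\<close>, because a relative residual is trivial once all
  its members of \<open>\<K>\<close> are.\<close>

lemma residual_level_eq: "residual_level G T \<alpha> = {K \<in> \<K>. h K \<le> \<alpha>}"
proof (induction \<alpha> rule: less_induct)
  case (less \<alpha>)
  show ?case
  proof (cases "\<alpha> = 0")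
    case True
    then show ?thesis
      using h_eq_zero_iff one_in_cg_closed_subgroups
      by (subst residual_level.simps) (auto simp: ordinal_le_zero_iff)
  next
    case nz: False
    show ?thesis
    proof (cases "\<alpha> = 1")
      case True
      have "relative_residual G T K = {\<one>} \<longleftrightarrow> h K \<le> 1" if K: "K \<in> \<K>" for K
      proof (cases "K = {\<one>}")
        case True
        then show ?thesis using relative_residual_one h_one by simp
      next
        case False
        have "h K \<le> 1 \<longleftrightarrow> (\<forall>L\<in>\<K>. L \<subseteq> relative_residual G T K \<longrightarrow> h L \<le> 0)"
          unfolding one_ordinal_def by (rule h_le_ord_succ_iff[OF K False])
        then show ?thesis
          using relative_residual_trivial_iff[OF cg_closed_subgroupsD(1)[OF K]]
          by (auto simp: ordinal_le_zero_iff h_eq_zero_iff)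
      qed
      then show ?thesis using nz True by (subst residual_level.simps) auto
    next
      case n1: False
      show ?thesis
      proof (cases "is_succ \<alpha>")
        case True
        then obtain \<beta> where \<beta>: "\<alpha> = ord_succ \<beta>" by (auto simp: is_succ_def)
        have ex: "(\<exists>\<gamma>\<in>{..<\<alpha>}. L \<in> residual_level G T \<gamma>) \<longleftrightarrow> h L \<le> \<beta>" if "L \<in> \<K>" for L
        proof
          assume "\<exists>\<gamma>\<in>{..<\<alpha>}. L \<in> residual_level G T \<gamma>"
          then obtain \<gamma> where "\<gamma> < \<alpha>" "L \<in> residual_level G T \<gamma>" by auto
          then have "h L \<le> \<gamma>" "\<gamma> \<le> \<beta>" using less.IH \<beta> by (auto simp: less_ord_succ_iff)
          then show "h L \<le> \<beta>" by simp
        next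
          assume "h L \<le> \<beta>"
          then have "L \<in> residual_level G T \<beta>" using less.IH[of \<beta>] \<beta> less_ord_succ that by simp
          then show "\<exists>\<gamma>\<in>{..<\<alpha>}. L \<in> residual_level G T \<gamma>" using \<beta> less_ord_succ by blast
        qed
        have "(\<forall>L\<in>\<K>. residual_less G T L K \<longrightarrow> (\<exists>\<gamma>\<in>{..<\<alpha>}. L \<in> residual_level G T \<gamma>)) \<longleftrightarrow> h K \<le> \<alpha>"
          if K: "K \<in> \<K>" for K
        proof (cases "K = {\<one>}")
          case True
          have "\<not> residual_less G T L K" if "L \<in> \<K>" for L
            using True relative_residual_one subgroup.one_closed[OF cg_closed_subgroupsD(1)[OF that]]
            by (auto simp: residual_less_def residual_le_def)
          then show ?thesis using True h_one by simp
        next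
          case False
          \<comment> \<open>Well-foundedness excludes K \<le> Res_G(K), so being strictly below K in
            the residual order is plain inclusion in Res_G(K).\<close>
          have "(K, K) \<notin> below" using wf_below by (auto dest: wf_not_refl)
          then have nK: "\<not> K \<subseteq> relative_residual G T K" using False K by (auto simp: residual_below_def)
          have "residual_less G T L K \<longleftrightarrow> L \<subseteq> relative_residual G T K" for L
            using nK by (auto simp: residual_less_def residual_le_def)
          then show ?thesis
            unfolding \<beta> h_le_ord_succ_iff[OF K False] using ex \<beta> by simp
        qed
        then show ?thesis using nz n1 True by (subst residual_level.simps) auto
      next
        case False
        have "h K < \<alpha> \<longleftrightarrow> h K \<le> \<alpha>" if K: "K \<in> \<K>" for K
        proof -
          \<comment> \<open>A height is 0 or a successor, so it never equals a limit
            \<alpha>.\<close>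
          have "h K \<noteq> \<alpha>" using h_eq[OF K] h_one False nz is_succ_ord_succ by metis
          then show ?thesis by (simp add: less_le)
        qed
        moreover have "(\<Union>\<gamma>\<in>{..<\<alpha>}. residual_level G T \<gamma>) = {K \<in> \<K>. h K < \<alpha>}"
          using less.IH by (auto intro: le_less_trans)
        moreover have "residual_level G T \<alpha> = (\<Union>\<gamma>\<in>{..<\<alpha>}. residual_level G T \<gamma>)"
          using nz n1 False by (subst residual_level.simps) simp
        ultimately show ?thesis by auto
      qed
    qed
  qed
qed

lemma residual_rank_well_defined: "residual_rank_well_defined G T"
  unfolding residual_rank_well_defined_def residual_level_eq
  using h_less_omega_1 by auto

lemma residual_height_eq:
  assumes "K \<in> \<K>"
  shows "residual_height G T K = h K"
  unfolding residual_height_def residual_level_eq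
  by (rule Least_equality) (use assms h_less_omega_1 in auto)

lemma residual_rank_eq: "residual_rank G T = ord_succ (ord_sup (h ` \<K>))"
proof -
  have "(\<lambda>K. ord_succ (residual_height G T K)) ` \<K> = ord_succ ` h ` \<K>"
    unfolding image_image by (rule image_cong) (auto simp: residual_height_eq)
  then show ?thesis
    unfolding residual_rank_def
    using ord_sup_plus_succ[of "h ` \<K>" omega_1] h_less_omega_1 one_in_cg_closed_subgroups by auto
qed

lemma residual_rank_trivial:
  assumes "carrier G = {\<one>}"
  shows "residual_rank G T = 1"
proof -
  have "K = {\<one>}" if "K \<in> \<K>" for K
    using subgroup.subset[OF cg_closed_subgroupsD(1)[OF that]] assms
      subgroup.one_closed[OF cg_closed_subgroupsD(1)[OF that]] by blast
  then have "\<K> = {{\<one>}}" using one_in_cg_closed_subgroups by blast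
  then show ?thesis by (simp add: residual_rank_eq h_one ord_sup_singleton one_ordinal_def)
qed

lemma residual_rank_ge_1: "1 \<le> residual_rank G T"
  by (simp add: residual_rank_eq one_ordinal_def ord_succ_le_ord_succ_iff)

lemma residual_rank_less_omega_1: "residual_rank G T < omega_1"
proof -
  have "ord_sup (h ` {L \<in> \<K>. L \<subseteq> carrier G}) < omega_1"
    by (rule h_sup_countable[OF subgroup_self closedin_carrier])
       (use h_less_omega_1 subgroup.subset[OF relative_residual_closed_subgroup(1)[OF cg_closed_subgroupsD(1)]] in auto)
  moreover have "{L \<in> \<K>. L \<subseteq> carrier G} = \<K>" using subgroup.subset[OF cg_closed_subgroupsD(1)] by auto
  ultimately show ?thesis by (simp add: residual_rank_eq ord_succ_less_omega_1)
qed

lemma residual_decomposable: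
  assumes "compactin T C" "openin T (generate G C)"
  shows "decomposable_group (subgrp G (residual G T (generate G C))) (subtopology T (residual G T (generate G C)))"
proof -
  have E: "subgroup (generate G C) G" by (rule generate_compact_subgroup[OF assms(1)])
  note R = residual_closed_subgroup[OF E open_subgroup_closed[OF E assms(2)]]
  show ?thesis
    using closed_subgroup_tdlcsc[OF R(1,2)] decomposable_closed_subgroup[OF decomposable R(1,2)]
    by (simp add: decomposable_group_def decomposable_group_axioms_def)
qed

text \<open>Both sides are the successor of the supremum of the heights of the members of
  \<open>\<K>\<close> inside R = Res_G(E). For E = {1} the equality fails: the height is 0, while
  the trivial group has rank 1.\<close>

lemma residual_rank_residual:
  assumes C: "compactin T C" "openin T (generate G C)" and ne: "generate G C \<noteq> {\<one>}"
  shows "residual_rank (subgrp G (residual G T (generate G C))) (subtopology T (residual G T (generate G C)))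
       = h (generate G C)"
proof -
  let ?E = "generate G C"
  let ?R = "residual G T ?E"
  have E: "subgroup ?E G" by (rule generate_compact_subgroup[OF C(1)])
  have Ec: "closedin T ?E" by (rule open_subgroup_closed[OF E C(2)])
  note R = residual_closed_subgroup[OF E Ec]
  interpret R: decomposable_group "subgrp G ?R" "subtopology T ?R" by (rule residual_decomposable[OF C])
  have EK: "?E \<in> \<K>" using C(1) Ec by (auto simp: cg_closed_subgroups_iff)
  have "R.h ` {L \<in> \<K>. L \<subseteq> ?R} = h ` {L \<in> \<K>. L \<subseteq> ?R}"
    by (rule image_cong[OF refl]) (use height_residual[OF E C(2)] in auto)
  then show ?thesis
    using R.residual_rank_eq h_eq[OF EK ne] relative_residual_open[OF E C(2)]
    by (simp add: cg_closed_subgroups_subgrp[OF R(1,2)])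
qed

text \<open>A member of \<open>\<K>\<close> is generated by a compact set and so lies in some
  \<open>U i\<close>; by monotonicity the heights of the \<open>U i\<close> have the same supremum
  as all heights.\<close>

lemma residual_rank_increasing_union:
  assumes nt: "carrier G \<noteq> {\<one>}" and U: "incseq U" "(\<Union>i. U i) = carrier G"
    "\<And>i::nat. subgroup (U i) G" "\<And>i. openin T (U i)" "\<And>i. \<exists>C. compactin T C \<and> generate G C = U i"
  shows "residual_rank G T = ord_succ (ord_sup (range (\<lambda>i.
    residual_rank (subgrp G (residual G T (U i))) (subtopology T (residual G T (U i))))))"
proof -
  let ?r = "\<lambda>i. residual_rank (subgrp G (residual G T (U i))) (subtopology T (residual G T (U i)))"
  have UK: "U i \<in> \<K>" for i
    using U(5) open_subgroup_closed[OF U(3,4)] by (auto simp: cg_closed_subgroups_iff)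
  have r: "?r i = h (U i)" if "U i \<noteq> {\<one>}" for i
  proof -
    obtain C where C: "compactin T C" "generate G C = U i" using U(5) by blast
    show ?thesis using residual_rank_residual[of C] C U(4) that by simp
  qed
  have U1: "\<one> \<in> U i" for i by (rule subgroup.one_closed[OF U(3)])
  \<comment> \<open>A trivial \<open>U i\<close> contributes rank 1 although its height is 0;
    comparison with a nontrivial \<open>U n\<close> absorbs this discrepancy.\<close>
  obtain n where n: "U n \<noteq> {\<one>}" using nt U(2) U1 by (metis SUP_eq_const UNIV_not_empty)
  have ri: "?r i < omega_1" for i
  proof -
    obtain C where C: "compactin T C" "generate G C = U i" using U(5) by blast
    interpret R: decomposable_group "subgrp G (residual G T (U i))" "subtopology T (residual G T (U i))"
      using residual_decomposable[of C] C U(4) by simp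
    show ?thesis by (rule R.residual_rank_less_omega_1)
  qed
  have le: "?r i \<le> ord_sup (h ` \<K>)" for i
  proof -
    have up: "h K \<le> ord_sup (h ` \<K>)" if "K \<in> \<K>" for K
      by (rule ord_sup_upper[where \<beta> = omega_1]) (use that h_less_omega_1 in \<open>auto intro: less_imp_le\<close>)
    show ?thesis
    proof (cases "U i = {\<one>}")
      case False
      then show ?thesis using r up[OF UK] by simp
    next
      case True
      have "residual G T (U i) = {\<one>}"
        using residual_closed_subgroup(1,3)[OF U(3) open_subgroup_closed[OF U(3,4)], of i] True
          subgroup.one_closed by blast
      moreover have "decomposable_group (subgrp G {\<one>}) (subtopology T {\<one>})"
        using closed_subgroup_tdlcsc[OF trivial_closed_subgroup] decomposable_one
        by (simp add: decomposable_group_def decomposable_group_axioms_def)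
      ultimately have "?r i = 1" using decomposable_group.residual_rank_trivial by fastforce
      also have "1 \<le> h (U n)"
        using h_eq[OF UK n] by (simp add: one_ordinal_def ord_succ_le_ord_succ_iff)
      also have "\<dots> \<le> ord_sup (h ` \<K>)" by (rule up[OF UK])
      finally show ?thesis .
    qed
  qed
  have "ord_sup (h ` \<K>) = ord_sup (range ?r)"
  proof (rule antisym)
    show "ord_sup (range ?r) \<le> ord_sup (h ` \<K>)" by (rule ord_sup_le) (use le in auto)
    show "ord_sup (h ` \<K>) \<le> ord_sup (range ?r)"
    proof (rule ord_sup_le)
      fix \<alpha> assume "\<alpha> \<in> h ` \<K>"
      then obtain K where K: "K \<in> \<K>" "\<alpha> = h K" by blast
      obtain C where C: "compactin T C" "generate G C = K" using K(1) by (auto simp: cg_closed_subgroups_iff)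
      obtain i where i: "C \<subseteq> U i" using compact_in_increasing_union[OF U(1,2,4) C(1)] .
      have "K \<subseteq> U i" using generate_leI[OF U(3) i] C(2) by simp
      \<comment> \<open>Passing to the index \<open>max i n\<close> keeps K inside and makes the
        group nontrivial, so that the rank of its residual equals its height.\<close>
      also have "U i \<subseteq> U (max i n)" by (rule incseqD[OF U(1)]) simp
      finally have KU: "K \<subseteq> U (max i n)" .
      have "U n \<subseteq> U (max i n)" by (rule incseqD[OF U(1)]) simp
      then have ne: "U (max i n) \<noteq> {\<one>}" using n U1[of n] by blast
      have "\<alpha> \<le> h (U (max i n))" unfolding K(2) by (rule h_mono[OF K(1) UK KU])
      also have "\<dots> = ?r (max i n)" using r[OF ne] by simp
      also have "\<dots> \<le> ord_sup (range ?r)"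
        by (rule ord_sup_upper[where \<beta> = omega_1]) (use ri in \<open>auto intro: less_imp_le\<close>)
      finally show "\<alpha> \<le> ord_sup (range ?r)" .
    qed
  qed
  then show ?thesis by (simp add: residual_rank_eq)
qed

end

section \<open>Comparison with the decomposition rank\<close>

lemma decomposable_groupI: "decomposable G T \<Longrightarrow> decomposable_group G T"
  using decomposable_tdlcsc by (simp add: decomposable_group_def decomposable_group_axioms_def tdlcsc_iff)

lemma is_decomposition_rank_residual_rank: "is_decomposition_rank residual_rank"
  unfolding is_decomposition_rank_def Let_def
proof (intro allI impI conjI)
  fix G :: "'a monoid" and T assume "elementary G T"
  then interpret decomposable_group G T by (rule decomposable_groupI[OF elementary_decomposable])
  show "1 \<le> residual_rank G T" by (rule residual_rank_ge_1)
  show "residual_rank G T < omega_1" by (rule residual_rank_less_omega_1)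
  show "carrier G = {\<one>\<^bsub>G\<^esub>} \<Longrightarrow> residual_rank G T = 1" by (rule residual_rank_trivial)
  have union: "residual_rank G T = ord_succ (ord_sup (range (\<lambda>i.
      residual_rank (subgrp G (discrete_residual (subgrp G (U i)) (subtopology T (U i))))
        (subtopology T (discrete_residual (subgrp G (U i)) (subtopology T (U i)))))))"
    if "carrier G \<noteq> {\<one>\<^bsub>G\<^esub>} \<and> incseq U \<and> (\<Union>i. U i) = carrier G \<and>
           (\<forall>i. subgroup (U i) G \<and> openin T (U i) \<and>
                compactly_generated (subgrp G (U i)) (subtopology T (U i)))" for U :: "nat \<Rightarrow> 'a set"
  proof -
    have U: "carrier G \<noteq> {\<one>\<^bsub>G\<^esub>}" "incseq U" "(\<Union>i. U i) = carrier G" "\<And>i. subgroup (U i) G"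
      "\<And>i. openin T (U i)" "\<And>i. \<exists>C. compactin T C \<and> generate G C = U i"
      using that compactly_generated_subgrp by auto
    have "discrete_residual (subgrp G (U i)) (subtopology T (U i)) = residual G T (U i)" for i
      by (rule discrete_residual_subgrp[OF U(4) open_subgroup_closed[OF U(4,5)]])
    then show ?thesis using residual_rank_increasing_union[OF U] by simp
  qed
  show "\<And>U :: nat \<Rightarrow> 'a set. carrier G \<noteq> {\<one>\<^bsub>G\<^esub>} \<and> incseq U \<and> (\<Union>i. U i) = carrier G \<and>
           (\<forall>i. subgroup (U i) G \<and> openin T (U i) \<and>
                compactly_generated (subgrp G (U i)) (subtopology T (U i))) \<Longrightarrow>
    residual_rank G T = ord_succ (ord_sup (range (\<lambda>i.
      residual_rank (subgrp G (discrete_residual (subgrp G (U i)) (subtopology T (U i))))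
        (subtopology T (discrete_residual (subgrp G (U i)) (subtopology T (U i)))))))"
    by (rule union)
  assume nt: "carrier G \<noteq> {\<one>\<^bsub>G\<^esub>} \<and> compactly_generated G T"
  \<comment> \<open>The equation for compactly generated G is the union equation for the constant
    sequence with value G.\<close>
  have "residual_rank G T = ord_succ (ord_sup (range (\<lambda>i::nat.
      residual_rank (subgrp G (discrete_residual (subgrp G (carrier G)) (subtopology T (carrier G))))
        (subtopology T (discrete_residual (subgrp G (carrier G)) (subtopology T (carrier G)))))))"
    by (rule union) (use nt subgroup_self openin_carrier in \<open>simp add: subtopology_carrier incseq_def\<close>)
  then show "residual_rank G T = ord_succ (residual_rank (subgrp G (discrete_residual G T))
      (subtopology T (discrete_residual G T)))"
    by (simp add: subtopology_carrier ord_sup_singleton)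
qed

lemma is_decomposition_rank_union:
  fixes U :: "nat \<Rightarrow> 'a set"
  assumes "is_decomposition_rank \<xi>" "elementary G T"
    and "carrier G \<noteq> {\<one>\<^bsub>G\<^esub>} \<and> incseq U \<and> (\<Union>i. U i) = carrier G \<and>
           (\<forall>i. subgroup (U i) G \<and> openin T (U i) \<and>
                compactly_generated (subgrp G (U i)) (subtopology T (U i)))"
  shows "\<xi> G T = ord_succ (ord_sup (range (\<lambda>i.
      \<xi> (subgrp G (discrete_residual (subgrp G (U i)) (subtopology T (U i))))
        (subtopology T (discrete_residual (subgrp G (U i)) (subtopology T (U i)))))))"
  by (rule assms(1)[unfolded is_decomposition_rank_def Let_def, THEN spec, THEN spec, THEN mp,
        OF assms(2), THEN conjunct2, THEN conjunct2, THEN conjunct2, THEN conjunct2,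
        THEN spec, THEN mp, OF assms(3)])

text \<open>One exhaustion expresses both functions at G through the same residuals, where they
  agree by induction; the residuals are elementary, so the equations apply to them.\<close>

lemma decomposition_rank_unique:
  assumes "decomposable G T" "elementary G T" "is_decomposition_rank \<xi>"
  shows "\<xi> G T = residual_rank G T"
  using assms(1,2)
proof (induction rule: decomposable.induct)
  case (trivial G T)
  have "\<xi> G T = 1" "residual_rank G T = 1"
    using assms(3) is_decomposition_rank_residual_rank trivial unfolding is_decomposition_rank_def by blast+
  then show ?case by simp
next
  case (step G T)
  interpret decomposable_group G T
    by (rule decomposable_groupI[OF elementary_decomposable[OF step.prems]])
  show ?case
  proof (cases "carrier G = {\<one>\<^bsub>G\<^esub>}")
    case True
    have "\<xi> G T = 1" "residual_rank G T = 1"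
      using assms(3) is_decomposition_rank_residual_rank step.prems True
      unfolding is_decomposition_rank_def by blast+
    then show ?thesis by simp
  next
    case False
    obtain U :: "nat \<Rightarrow> 'a set" where *: "incseq U" "(\<Union>i. U i) = carrier G"
      "\<forall>i. subgroup (U i) G" "\<forall>i. openin T (U i)" "\<forall>i. \<exists>C. compactin T C \<and> generate G C = U i"
      using exhaustion .
    note U = *(1,2) *(3-5)[rule_format]
    have cond: "carrier G \<noteq> {\<one>\<^bsub>G\<^esub>} \<and> incseq U \<and> (\<Union>i. U i) = carrier G \<and>
           (\<forall>i. subgroup (U i) G \<and> openin T (U i) \<and>
                compactly_generated (subgrp G (U i)) (subtopology T (U i)))"
      using False U compactly_generated_subgrp by simp
    have dr: "discrete_residual (subgrp G (U i)) (subtopology T (U i)) = residual G T (U i)" for i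
      by (rule discrete_residual_subgrp[OF U(3) open_subgroup_closed[OF U(3,4)]])
    have "\<xi> G T = ord_succ (ord_sup (range (\<lambda>i.
        \<xi> (subgrp G (residual G T (U i))) (subtopology T (residual G T (U i))))))"
      using is_decomposition_rank_union[OF assms(3) step.prems cond] by (simp only: dr)
    moreover have "\<xi> (subgrp G (residual G T (U i))) (subtopology T (residual G T (U i)))
      = residual_rank (subgrp G (residual G T (U i))) (subtopology T (residual G T (U i)))" for i
    proof -
      obtain C where C: "compactin T C" "generate G C = U i" using U(5) by blast
      note R = residual_closed_subgroup[OF U(3) open_subgroup_closed[OF U(3,4)], of i]
      show ?thesis
        using step.IH[OF C(1)] C(2) U(4) elementary_closed_subgroup[OF step.prems R(1,2)] by simp
    qed
    ultimately show ?thesis using residual_rank_increasing_union[OF False U] by simp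
  qed
qed

theorem theorem4p15:
  fixes G :: "'a monoid" and T :: "'a topology"
  assumes "elementary G T"
  shows "residual_rank_well_defined G T \<and> decomposition_rank G T = residual_rank G T"
proof
  have dec: "decomposable G T" by (rule elementary_decomposable[OF assms])
  then interpret decomposable_group G T by (rule decomposable_groupI)
  show "residual_rank_well_defined G T" by (rule residual_rank_well_defined)
  \<comment> \<open>The residual rank witnesses that a solution exists, so the function chosen by
    \<open>SOME\<close> is one.\<close>
  have "is_decomposition_rank (decomposition_rank :: 'a monoid \<Rightarrow> 'a topology \<Rightarrow> ordinal)"
    unfolding decomposition_rank_def by (rule someI[of is_decomposition_rank, OF is_decomposition_rank_residual_rank])
  then show "decomposition_rank G T = residual_rank G T"
    by (rule decomposition_rank_unique[OF dec assms])
qed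

end
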